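(* Let $r\in\mathbb{N}$, $\alpha>0$, $\mathbf{x}_0\in\mathbb{R}^n$, and let $\ell$ be a constant. Suppose that an $(M,r)$-regular (resp. $r$-regular) MRA is given, and let $\mu$ be a positive Radon measure on $\mathbb{R}^n$ such that $\int_{\mathbb{R}^n}e^{-M(k\mathbf{x})}\,d\mu(\mathbf{x})<\infty$ (resp. $\int_{\mathbb{R}^n}(1+|\mathbf{x}|)^{-k}\,d\mu(\mathbf{x})<\infty$) for some $k\ge0$. If $$\mu(B(\mathbf{x}_0,\varepsilon))=O(\varepsilon^\alpha)\quad\text{as }\varepsilon\to0^+$$ and $$\lim_{\varepsilon\to0^+}\frac{(q_{1/\varepsilon}\mu)(\mathbf{x}_0+\varepsilon\mathbf{x})}{\varepsilon^{\alpha-n}}=\ell|\mathbf{x}|^{\alpha-n}\quad\text{weakly$^*$ in }\mathcal{K}'_{M,r}(\mathbb{R}^n)\ (\text{resp. }\mathcal{S}'_r(\mathbb{R}^n)),$$ then $\mu$ possesses an $\alpha$-density at $\mathbf{x}_0$, given by $$\theta^\alpha(\mu,\mathbf{x}_0)=\frac{\sigma_{n-1}\,\ell}{\alpha\,\omega_\alpha},$$ where $\sigma_{n-1}=2\pi^{n/2}/\Gamma(n/2)$ is the surface measure of the unit sphere of $\mathbb{R}^n$.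
   Context: $\mathbb{N}=\{0,1,2,\dots\}$. $M:[0,\infty)\to[0,\infty)$ is a continuous increasing function with $M(t)+M(s)\le M(t+s)$ and $M(t+s)\le M(2t)+M(2s)$ for all $t,s\ge0$; write $M(\mathbf{x})=M(|\mathbf{x}|)$ for $\mathbf{x}\in\mathbb{R}^n$. $B(\mathbf{x}_0,\varepsilon)$ is the Euclidean ball. $\alpha$-density: $\mu$ possesses an $\alpha$-density at $\mathbf{x}_0$ (i.e. $\mathbf{x}_0$ is an $\alpha$-density point of $\mu$) if the limit $\theta^\alpha(\mu,\mathbf{x}_0)=\lim_{\varepsilon\to0^+}\frac{\mu(B(\mathbf{x}_0,\varepsilon))}{\omega_\alpha\varepsilon^\alpha}$ exists and is finite, where $\omega_\alpha=\pi^{\alpha/2}/\Gamma(1+\alpha/2)$. $\mathcal{K}_{M,r}(\mathbb{R}^n)$ is the Fréchet space of all $\varphi\in C^r(\mathbb{R}^n)$ such that for every $l\in\mathbb{N}$ the norm $\nu_{r,l}(\varphi)=\sup_{|\beta|\le r,\,\mathbf{x}\in\mathbb{R}^n}e^{M(l\mathbf{x})}|\varphi^{(\beta)}(\mathbf{x})|$ is finite, topologized by these norms. $\mathcal{S}_r(\mathbb{R}^n)$ is the Fréchet space of all $\varphi\in C^r(\mathbb{R}^n)$ such that for every $l\in\mathbb{N}$ the norm $\rho_{r,l}(\varphi)=\sup_{|\beta|\le r,\,\mathbf{x}\in\mathbb{R}^n}(1+|\mathbf{x}|)^l|\varphi^{(\beta)}(\mathbf{x})|$ is finite, topologized by these norms.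 $\mathcal{K}'_{M,r}$ and $\mathcal{S}'_r$ are the duals; weak$^*$ convergence means convergence when tested against each fixed $\varphi$ in the test space. MRA: an increasing sequence $\{V_j\}_{j\in\mathbb{Z}}$ of closed linear subspaces of $L^2(\mathbb{R}^n)$ such that (i) $f\in V_j\Leftrightarrow f(2\,\cdot)\in V_{j+1}$; (ii) $f\in V_0\Leftrightarrow f(\cdot-\mathbf{m})\in V_0$ for $\mathbf{m}\in\mathbb{Z}^n$; (iii) $\bigcap_jV_j=\{0\}$ and $\overline{\bigcup_jV_j}=L^2(\mathbb{R}^n)$; (iv) there is a scaling function $\phi\in L^2(\mathbb{R}^n)$ such that $\{\phi(\cdot-\mathbf{m})\}_{\mathbf{m}\in\mathbb{Z}^n}$ is an orthonormal basis of $V_0$. The MRA is $(M,r)$-regular (resp. $r$-regular) if the scaling function can be chosen in $\mathcal{K}_{M,r}(\mathbb{R}^n)$ (resp. $\mathcal{S}_r(\mathbb{R}^n)$); such a $\phi$ is then fixed. Put $q_0(\mathbf{x},\mathbf{y})=\sum_{\mathbf{m}\in\mathbb{Z}^n}\phi(\mathbf{x}-\mathbf{m})\overline{\phi(\mathbf{y}-\mathbf{m})}$ and, for $\lambda\in\mathbb{R}$, $q_\lambda(\mathbf{x},\mathbf{y})=2^{n\lambda}q_0(2^\lambda\mathbf{x},2^\lambda\mathbf{y})$ and $(q_\lambda\mu)(\mathbf{x})=\int_{\mathbb{R}^n}q_\lambda(\mathbf{x},\mathbf{y})\,d\mu(\mathbf{y})$; $q_{1/\varepsilon}$ is $q_\lambda$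 with $\lambda=1/\varepsilon$. *)

theory Defs
  imports "HOL-Analysis.Analysis" "HOL-Library.Landau_Symbols"
begin

subsection \<open>Spaces of test functions\<close>

text \<open>Only the values of \<open>M\<close> on \<open>[0, \<infinity>)\<close> matter. ``Increasing'' is read as non-decreasing, excluding
  only the constant function \<open>0\<close>: by superadditivity every other \<open>M\<close> grows at least linearly, whereas
  for \<open>M = 0\<close> the spaces below would impose no decay at all. Strictly increasing \<open>M\<close> are
  included.\<close>

definition weight_function :: "(real \<Rightarrow> real) \<Rightarrow> bool" where
  "weight_function M \<longleftrightarrow>
     continuous_on {0..} M \<and> mono_on {0..} M \<and> (\<forall>t\<ge>0. 0 \<le> M t) \<and> (\<exists>t\<ge>0. M t \<noteq> 0) \<and>
     (\<forall>t\<ge>0. \<forall>s\<ge>0. M t + M s \<le> M (t + s)) \<and>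
     (\<forall>t\<ge>0. \<forall>s\<ge>0. M (t + s) \<le> M (2 * t) + M (2 * s))"

definition partial_deriv :: "'n \<Rightarrow> (real^'n \<Rightarrow> complex) \<Rightarrow> real^'n \<Rightarrow> complex" where
  "partial_deriv i f x = vector_derivative (\<lambda>t. f (x + t *\<^sub>R axis i 1)) (at 0)"

primrec iter_partial_deriv :: "'n list \<Rightarrow> (real^'n \<Rightarrow> complex) \<Rightarrow> real^'n \<Rightarrow> complex" where
  "iter_partial_deriv [] f = f"
| "iter_partial_deriv (i # w) f = iter_partial_deriv w (partial_deriv i f)"

text \<open>\<open>C_space r\<close> is \<open>C\<^sup>r(\<real>\<^sup>n)\<close>: all partial derivatives of order at most \<open>r\<close> exist everywhere and
  are continuous.\<close>

primrec C_space :: "nat \<Rightarrow> (real^'n \<Rightarrow> complex) set" where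
  "C_space 0 = {f. continuous_on UNIV f}"
| "C_space (Suc r) = {f. continuous_on UNIV f \<and>
     (\<forall>i x. (\<lambda>t::real. f (x + t *\<^sub>R axis i 1)) differentiable (at 0)) \<and>
     (\<forall>i. partial_deriv i f \<in> C_space r)}"

text \<open>The derivatives of order at most \<open>r\<close> are indexed by the words \<open>w\<close> of length at most \<open>r\<close> in the
  coordinate directions. The word \<open>w\<close> stands for the multi-index counting the occurrences of each
  direction in \<open>w\<close>; on \<open>C_space r\<close> the order of differentiation is irrelevant.\<close>

definition nu :: "(real \<Rightarrow> real) \<Rightarrow> nat \<Rightarrow> nat \<Rightarrow> (real^'n \<Rightarrow> complex) \<Rightarrow> ennreal" where
  "nu M r l \<phi> = (SUP w\<in>{w. length w \<le> r}. SUP x.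
     ennreal (exp (M (norm (real l *\<^sub>R x))) * cmod (iter_partial_deriv w \<phi> x)))"

definition rho :: "nat \<Rightarrow> nat \<Rightarrow> (real^'n \<Rightarrow> complex) \<Rightarrow> ennreal" where
  "rho r l \<phi> = (SUP w\<in>{w. length w \<le> r}. SUP x.
     ennreal ((1 + norm x) ^ l * cmod (iter_partial_deriv w \<phi> x)))"

definition K_space :: "(real \<Rightarrow> real) \<Rightarrow> nat \<Rightarrow> (real^'n \<Rightarrow> complex) set" where
  "K_space M r = {\<phi> \<in> C_space r. \<forall>l. nu M r l \<phi> < \<infinity>}"

definition S_space :: "nat \<Rightarrow> (real^'n \<Rightarrow> complex) set" where
  "S_space r = {\<phi> \<in> C_space r. \<forall>l. rho r l \<phi> < \<infinity>}"


subsection \<open>Duals and weak* limits\<close>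

text \<open>The topological dual of a function space \<open>X\<close> topologized by the seminorms \<open>p 0, p 1, \<dots>\<close>.\<close>

definition dual_space ::
    "(real^'n \<Rightarrow> complex) set \<Rightarrow> (nat \<Rightarrow> (real^'n \<Rightarrow> complex) \<Rightarrow> ennreal)
      \<Rightarrow> ((real^'n \<Rightarrow> complex) \<Rightarrow> complex) set" where
  "dual_space X p = {T.
     (\<forall>\<phi>\<in>X. \<forall>\<psi>\<in>X. T (\<lambda>x. \<phi> x + \<psi> x) = T \<phi> + T \<psi>) \<and>
     (\<forall>c. \<forall>\<phi>\<in>X. T (\<lambda>x. c * \<phi> x) = c * T \<phi>) \<and>
     (\<forall>\<phi>\<in>X. \<forall>e>0. \<exists>L. \<exists>\<delta>>0. \<forall>\<psi>\<in>X.
        (\<forall>l\<le>L. p l (\<lambda>x. \<psi> x - \<phi> x) < ennreal \<delta>) \<longrightarrow> cmod (T \<psi> - T \<phi>) < e)}"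

definition pairing :: "(real^'n \<Rightarrow> complex) \<Rightarrow> (real^'n \<Rightarrow> complex) \<Rightarrow> complex" where
  "pairing f \<phi> = (LINT x|lborel. f x * \<phi> x)"

definition function_in_dual ::
    "(real^'n \<Rightarrow> complex) set \<Rightarrow> (nat \<Rightarrow> (real^'n \<Rightarrow> complex) \<Rightarrow> ennreal)
      \<Rightarrow> (real^'n \<Rightarrow> complex) \<Rightarrow> bool" where
  "function_in_dual X p f \<longleftrightarrow>
     (\<forall>\<phi>\<in>X. integrable lborel (\<lambda>x. f x * \<phi> x)) \<and> pairing f \<in> dual_space X p"

text \<open>Weak* convergence in the dual of \<open>X\<close>, as \<open>\<epsilon> \<rightarrow> 0\<^sup>+\<close>, of functions identified with the
  functionals they induce.\<close>

definition weak_star_limit_0 ::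
    "(real^'n \<Rightarrow> complex) set \<Rightarrow> (nat \<Rightarrow> (real^'n \<Rightarrow> complex) \<Rightarrow> ennreal)
      \<Rightarrow> (real \<Rightarrow> real^'n \<Rightarrow> complex) \<Rightarrow> (real^'n \<Rightarrow> complex) \<Rightarrow> bool" where
  "weak_star_limit_0 X p G f \<longleftrightarrow>
     (\<forall>\<^sub>F \<epsilon> in at_right 0. function_in_dual X p (G \<epsilon>)) \<and> function_in_dual X p f \<and>
     (\<forall>\<phi>\<in>X. ((\<lambda>\<epsilon>. pairing (G \<epsilon>) \<phi>) \<longlongrightarrow> pairing f \<phi>) (at_right 0))"


subsection \<open>Multiresolution analyses\<close>

text \<open>Elements of \<open>L\<^sup>2(\<real>\<^sup>n)\<close> are represented by Borel functions rather than equivalence classes. A set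
  that is closed in the sense of \<open>L2_closed_subspace\<close> is automatically saturated with respect to
  equality almost everywhere.\<close>

definition L2_space :: "(real^'n \<Rightarrow> complex) set" where
  "L2_space = {f \<in> borel_measurable lborel. integrable lborel (\<lambda>x. (cmod (f x))\<^sup>2)}"

definition L2_inner :: "(real^'n \<Rightarrow> complex) \<Rightarrow> (real^'n \<Rightarrow> complex) \<Rightarrow> complex" where
  "L2_inner f g = (LINT x|lborel. f x * cnj (g x))"

definition L2_norm :: "(real^'n \<Rightarrow> complex) \<Rightarrow> real" where
  "L2_norm f = sqrt (LINT x|lborel. (cmod (f x))\<^sup>2)"

definition L2_closure :: "(real^'n \<Rightarrow> complex) set \<Rightarrow> (real^'n \<Rightarrow> complex) set" where
  "L2_closure A = {f \<in> L2_space. \<forall>e>0. \<exists>g\<in>A. L2_norm (\<lambda>x. f x - g x) < e}"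

definition L2_closed_subspace :: "(real^'n \<Rightarrow> complex) set \<Rightarrow> bool" where
  "L2_closed_subspace V \<longleftrightarrow>
     V \<subseteq> L2_space \<and> (\<lambda>x. 0) \<in> V \<and>
     (\<forall>f\<in>V. \<forall>g\<in>V. (\<lambda>x. f x + g x) \<in> V) \<and> (\<forall>c. \<forall>f\<in>V. (\<lambda>x. c * f x) \<in> V) \<and>
     L2_closure V = V"

definition int_lattice :: "(real^'n) set" where
  "int_lattice = {m. \<forall>i. m $ i \<in> \<int>}"

text \<open>The integer translates of \<open>\<phi>\<close> form an orthonormal basis of the closed subspace \<open>W\<close>:
  they are orthonormal and their closed linear span is \<open>W\<close>.\<close>

definition translates_orthonormal_basis ::
    "(real^'n \<Rightarrow> complex) \<Rightarrow> (real^'n \<Rightarrow> complex) set \<Rightarrow> bool" where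
  "translates_orthonormal_basis \<phi> W \<longleftrightarrow>
     (\<forall>m\<in>int_lattice. \<forall>m'\<in>int_lattice.
        L2_inner (\<lambda>x. \<phi> (x - m)) (\<lambda>x. \<phi> (x - m')) = (if m = m' then 1 else 0)) \<and>
     L2_closure {(\<lambda>x. \<Sum>m\<in>F. c m * \<phi> (x - m)) | F c. finite F \<and> F \<subseteq> int_lattice} = W"

definition scaling_function ::
    "(int \<Rightarrow> (real^'n \<Rightarrow> complex) set) \<Rightarrow> (real^'n \<Rightarrow> complex) \<Rightarrow> bool" where
  "scaling_function V \<phi> \<longleftrightarrow> \<phi> \<in> L2_space \<and> translates_orthonormal_basis \<phi> (V 0)"

definition MRA :: "(int \<Rightarrow> (real^'n \<Rightarrow> complex) set) \<Rightarrow> bool" where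
  "MRA V \<longleftrightarrow>
     (\<forall>j. L2_closed_subspace (V j)) \<and>
     (\<forall>j. V j \<subseteq> V (j + 1)) \<and>
     (\<forall>j. \<forall>f\<in>L2_space. f \<in> V j \<longleftrightarrow> (\<lambda>x. f (2 *\<^sub>R x)) \<in> V (j + 1)) \<and>
     (\<forall>f\<in>L2_space. \<forall>m\<in>int_lattice. f \<in> V 0 \<longleftrightarrow> (\<lambda>x. f (x - m)) \<in> V 0) \<and>
     (\<Inter>j. V j) = {f \<in> L2_space. AE x in lborel. f x = 0} \<and>
     L2_closure (\<Union>j. V j) = L2_space \<and>
     (\<exists>\<phi>. scaling_function V \<phi>)"

text \<open>A regular multiresolution analysis comes with a fixed scaling function \<open>\<phi>\<close> in the respective
  test function space.\<close>

definition M_regular_MRA ::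
    "(real \<Rightarrow> real) \<Rightarrow> nat \<Rightarrow> (int \<Rightarrow> (real^'n \<Rightarrow> complex) set) \<Rightarrow> (real^'n \<Rightarrow> complex) \<Rightarrow> bool" where
  "M_regular_MRA M r V \<phi> \<longleftrightarrow> MRA V \<and> scaling_function V \<phi> \<and> \<phi> \<in> K_space M r"

definition regular_MRA ::
    "nat \<Rightarrow> (int \<Rightarrow> (real^'n \<Rightarrow> complex) set) \<Rightarrow> (real^'n \<Rightarrow> complex) \<Rightarrow> bool" where
  "regular_MRA r V \<phi> \<longleftrightarrow> MRA V \<and> scaling_function V \<phi> \<and> \<phi> \<in> S_space r"

definition q0_kernel :: "(real^'n \<Rightarrow> complex) \<Rightarrow> real^'n \<Rightarrow> real^'n \<Rightarrow> complex" where
  "q0_kernel \<phi> x y = (\<Sum>\<^sub>\<infinity>m\<in>int_lattice. \<phi> (x - m) * cnj (\<phi> (y - m)))"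

definition q_kernel :: "(real^'n \<Rightarrow> complex) \<Rightarrow> real \<Rightarrow> real^'n \<Rightarrow> real^'n \<Rightarrow> complex" where
  "q_kernel \<phi> lam x y = complex_of_real (2 powr (real CARD('n) * lam)) *
     q0_kernel \<phi> ((2 powr lam) *\<^sub>R x) ((2 powr lam) *\<^sub>R y)"

definition q_operator ::
    "(real^'n \<Rightarrow> complex) \<Rightarrow> real \<Rightarrow> (real^'n) measure \<Rightarrow> real^'n \<Rightarrow> complex" where
  "q_operator \<phi> lam \<mu> x = (LINT y|\<mu>. q_kernel \<phi> lam x y)"


subsection \<open>Radon measures and densities\<close>

text \<open>On \<open>\<real>\<^sup>n\<close>, inner and outer regularity follow from finiteness on compact sets.\<close>

definition radon_measure :: "(real^'n) measure \<Rightarrow> bool" where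
  "radon_measure \<mu> \<longleftrightarrow> sets \<mu> = sets borel \<and> (\<forall>K. compact K \<longrightarrow> emeasure \<mu> K < \<infinity>)"

text \<open>The constant \<open>\<omega>\<^sub>\<alpha> = \<pi>\<^bsup>\<alpha>/2\<^esup> / \<Gamma>(1 + \<alpha>/2)\<close> is \<open>unit_ball_vol \<alpha>\<close>.\<close>

definition density_quotient :: "(real^'n) measure \<Rightarrow> real \<Rightarrow> real^'n \<Rightarrow> real \<Rightarrow> real" where
  "density_quotient \<mu> \<alpha> x0 \<epsilon> = measure \<mu> (ball x0 \<epsilon>) / (unit_ball_vol \<alpha> * \<epsilon> powr \<alpha>)"

definition alpha_density_point :: "(real^'n) measure \<Rightarrow> real \<Rightarrow> real^'n \<Rightarrow> bool" where
  "alpha_density_point \<mu> \<alpha> x0 \<longleftrightarrow> (\<exists>\<theta>. (density_quotient \<mu> \<alpha> x0 \<longlongrightarrow> \<theta>) (at_right 0))"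

definition alpha_density :: "(real^'n) measure \<Rightarrow> real \<Rightarrow> real^'n \<Rightarrow> real" where
  "alpha_density \<mu> \<alpha> x0 = Lim (at_right 0) (density_quotient \<mu> \<alpha> x0)"

text \<open>The surface measure of the unit sphere of \<open>\<real>\<^sup>n\<close>.\<close>

definition unit_sphere_area :: "nat \<Rightarrow> real" where
  "unit_sphere_area n = 2 * pi powr (real n / 2) / Gamma (real n / 2)"

end

theory Submission
  imports Defs "HOL-Real_Asymp.Real_Asymp"
begin

text \<open>
  At scale \<open>\<epsilon>\<close> the operator \<open>q\<^bsub>1/\<epsilon>\<^esub>\<close> smears \<open>\<mu>\<close> out over distances of order
  \<open>2 powr (- 1/\<epsilon>)\<close>, which is \<open>o(\<epsilon>\<^sup>N)\<close> for every \<open>N\<close>. Hence the hypothesis says that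
  \<open>\<epsilon> powr (- \<alpha>) * \<integral> \<psi>((y - x0)/\<epsilon>) d\<mu>(y)\<close> tends to \<open>\<l> * \<integral> \<bar>x\<bar> powr (\<alpha> - n) * \<psi>(x) dx\<close> for compactly supported
  \<open>\<psi>\<close> of class \<open>C\<^sup>r\<close>, and the density follows by squeezing the indicator of the unit ball between such \<open>\<psi>\<close>.

  The smearing reproduces \<open>\<mu>\<close> only because \<open>\<integral> q\<^sub>0(x, y) dx = 1\<close> for every \<open>y\<close>. Let \<open>a\<close> be the integral of the
  scaling function \<open>\<phi>\<close>. Approximating indicators of large cubes in the spaces \<open>V\<^sub>j\<close> gives \<open>\<bar>a\<bar> \<ge> 1\<close>.
  The periodization of \<open>\<phi>\<close> has mean \<open>a\<close> over the unit cube, and its mean square is \<open>1\<close> by orthonormality; so it is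
  the constant \<open>a\<close>, and \<open>\<integral> q\<^sub>0(x, y) dx = \<bar>a\<bar>\<^sup>2 = 1\<close>.

  Both regularity classes are covered by bounds \<open>cmod (\<phi> x) \<le> C\<^sub>N * E (norm x) / (1 + norm x)\<^sup>N\<close>, where the weight \<open>E\<close>,
  suitably rescaled, is \<open>\<mu>\<close>-integrable.
\<close>

subsection \<open>Changes of variables and radial integrals\<close>

text \<open>The measure may be singular, so the reproducing identity of the kernel is needed at
  every point: an almost everywhere version would say nothing about \<open>\<mu>\<close>. Hence the
  continuity of the periodization. The function whose reproduction is at stake, the constant 1, is
  not in L^2; indicators of cubes of side 2^j replace it. Such a cube is a dilate of the unit cube,
  so approximating the unit cube in the union of the V_j gives approximations in V_0 whose error is
  small relative to the volume, and what the kernel carries across the boundary is also of lower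
  order than the volume. The measure need not have compact support either. Since 2 powr
  (1/\<epsilon>) eventually exceeds any constant, the weight seen by the kernel far from
  \<open>x0\<close> is eventually below the fixed dilate of \<open>E\<close> that is
  \<open>\<mu>\<close>-integrable; the total error is a constant times \<epsilon> powr (-\<alpha>) /
  (2 powr (1/\<epsilon>) * \<epsilon>). Finally, \<open>\<l>\<close> is an arbitrary complex
  constant. That it is real and nonnegative comes from testing with a single cutoff, and the squeeze
  relies on it.\<close>

lemma nn_integral_lborel_affine:
  fixes f :: "'a::euclidean_space \<Rightarrow> ennreal"
  assumes [measurable]: "f \<in> borel_measurable borel" and "c \<noteq> 0"
  shows "(\<integral>\<^sup>+x. f x \<partial>lborel) = ennreal (\<bar>c\<bar> ^ DIM('a)) * (\<integral>\<^sup>+x. f (t + c *\<^sub>R x) \<partial>lborel)"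
  by (subst lborel_affine[OF \<open>c \<noteq> 0\<close>, of t])
     (simp add: nn_integral_density nn_integral_distr nn_integral_cmult)

lemma integral_lborel_affine:
  fixes f :: "'a::euclidean_space \<Rightarrow> 'b::{banach, second_countable_topology}"
  assumes [measurable]: "f \<in> borel_measurable borel" and "c \<noteq> 0"
  shows "(LINT x|lborel. f x) = \<bar>c\<bar> ^ DIM('a) *\<^sub>R (LINT x|lborel. f (t + c *\<^sub>R x))"
  by (subst lborel_affine[OF \<open>c \<noteq> 0\<close>, of t])
     (simp add: integral_density integral_distr)

lemma integrable_lborel_affine:
  fixes f :: "'a::euclidean_space \<Rightarrow> 'b::{banach, second_countable_topology}"
  assumes "integrable lborel f" and "c \<noteq> 0"
  shows "integrable lborel (\<lambda>x. f (t + c *\<^sub>R x))"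
proof -
  have [measurable]: "f \<in> borel_measurable borel"
    using borel_measurable_integrable[OF assms(1)] by simp
  have "(\<integral>\<^sup>+x. norm (f x) \<partial>lborel) < \<infinity>"
    using assms(1) by (simp add: integrable_iff_bounded)
  then have "ennreal (\<bar>c\<bar> ^ DIM('a)) * (\<integral>\<^sup>+x. norm (f (t + c *\<^sub>R x)) \<partial>lborel) < \<infinity>"
    using nn_integral_lborel_affine[of "\<lambda>x. ennreal (norm (f x))" c t] \<open>c \<noteq> 0\<close> by simp
  then show ?thesis
    using \<open>c \<noteq> 0\<close> by (auto simp: integrable_iff_bounded ennreal_mult_less_top)
qed

lemma lborel_translate:
  fixes f :: "'a::euclidean_space \<Rightarrow> 'b::{banach, second_countable_topology}"
  assumes "f \<in> borel_measurable borel"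
  shows "(LINT x|lborel. f (x - t)) = (LINT x|lborel. f x)"
  using integral_lborel_affine[OF assms, of 1 "- t"] by simp

lemma nn_integral_lborel_translate:
  fixes f :: "'a::euclidean_space \<Rightarrow> ennreal"
  assumes "f \<in> borel_measurable borel"
  shows "(\<integral>\<^sup>+x. f (x - t) \<partial>lborel) = (\<integral>\<^sup>+x. f x \<partial>lborel)"
  using nn_integral_lborel_affine[OF assms, of 1 "- t"] by simp

lemma integrable_lborel_translate:
  fixes f :: "'a::euclidean_space \<Rightarrow> 'b::{banach, second_countable_topology}"
  assumes "integrable lborel f"
  shows "integrable lborel (\<lambda>x. f (x - t))"
  using integrable_lborel_affine[OF assms, of 1 "- t"] by simp

text \<open>The distribution of \<open>- norm x\<close> rather than \<open>norm x\<close>, so that the generating sets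
  \<open>{c<..}\<close> have finite measure.\<close>

lemma distr_uminus_norm:
  "distr (lborel :: 'a::euclidean_space measure) borel (\<lambda>x. - norm x) =
   density lborel (\<lambda>r. ennreal (DIM('a) * unit_ball_vol DIM('a) * (- r) ^ (DIM('a) - 1)) * indicator {..0} r)"
proof -
  let ?n = "DIM('a)"
  let ?D = "distr (lborel :: 'a measure) borel (\<lambda>x. - norm x)"
  let ?E = "density lborel (\<lambda>r. ennreal (DIM('a) * unit_ball_vol ?n * (- r) ^ (?n - 1)) * indicator {..0} r)"
  have D: "emeasure ?D {c<..} = ennreal (unit_ball_vol ?n * (- min c 0) ^ ?n)" for c
  proof -
    \<comment> \<open>The minimum covers c \<ge> 0, where the set is empty and the ball has radius
      0.\<close>
    have "{x::'a. - norm x > c} = ball 0 (- min c 0)"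
      by (auto simp: min_def intro: order.trans[of _ "0::real"] dest: less_le_trans[of c _ 0])
    then show ?thesis
      by (subst emeasure_distr) (auto simp: vimage_def emeasure_ball)
  qed
  have E: "emeasure ?E {c<..} = ennreal (unit_ball_vol ?n * (- min c 0) ^ ?n)" for c
  proof -
    let ?c = "min c 0"
    have "emeasure ?E {c<..} = (\<integral>\<^sup>+r. ennreal (?n * unit_ball_vol ?n * (- r) ^ (?n - 1)) * indicator {..0} r * indicator {c<..} r \<partial>lborel)"
      by (subst emeasure_density) auto
    also have "\<dots> = (\<integral>\<^sup>+r. ennreal (?n * unit_ball_vol ?n * (- r) ^ (?n - 1)) * indicator {?c..0} r \<partial>lborel)"
    proof (rule nn_integral_cong_AE)
      have "AE r in lborel. r \<noteq> c \<and> r \<noteq> (0::real)"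
        using AE_lborel_singleton[of c] AE_lborel_singleton[of 0] by auto
      then show "AE r in lborel. ennreal (?n * unit_ball_vol ?n * (- r) ^ (?n - 1)) * indicator {..0} r * indicator {c<..} r
          = ennreal (?n * unit_ball_vol ?n * (- r) ^ (?n - 1)) * indicator {?c..0} r"
        by eventually_elim (auto simp: indicator_def min_def)
    qed
    also have "\<dots> = ennreal (- unit_ball_vol ?n * (- 0) ^ ?n - - unit_ball_vol ?n * (- ?c) ^ ?n)"
    proof (rule nn_integral_FTC_Icc[where F="\<lambda>x. - unit_ball_vol ?n * (- x) ^ ?n"])
      fix x :: real assume x: "x \<in> {?c..0}"
      show "((\<lambda>x. - unit_ball_vol ?n * (- x) ^ ?n) has_real_derivative
          real ?n * unit_ball_vol ?n * (- x) ^ (?n - 1)) (at x)"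
        by (auto intro!: derivative_eq_intros)
      show "0 \<le> real ?n * unit_ball_vol ?n * (- x) ^ (?n - 1)"
        using x by auto
    qed auto
    finally show ?thesis by simp
  qed
  show ?thesis
  proof (rule measure_eqI_lessThan)
    show "emeasure ?D {c<..} = emeasure ?E {c<..}" for c
      by (simp only: D E)
    show "emeasure ?D {c<..} < \<infinity>" for c
      by (simp only: D) simp
  qed auto
qed

text \<open>Polar coordinates for radial functions: the substitution r -> -r undoes the sign in
  \<open>distr_uminus_norm\<close>.\<close>

lemma nn_integral_norm:
  assumes [measurable]: "f \<in> borel_measurable borel"
  shows "(\<integral>\<^sup>+(x::'a::euclidean_space). f (norm x) \<partial>lborel) =
    (\<integral>\<^sup>+r. ennreal (DIM('a) * unit_ball_vol DIM('a) * r ^ (DIM('a) - 1)) * f r * indicator {0..} r \<partial>lborel)"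
proof -
  let ?n = "DIM('a)"
  have "(\<integral>\<^sup>+(x::'a). f (norm x) \<partial>lborel) = (\<integral>\<^sup>+r. f (- r) \<partial>distr (lborel :: 'a measure) borel (\<lambda>x. - norm x))"
    by (subst nn_integral_distr) auto
  also have "\<dots> = (\<integral>\<^sup>+r. ennreal (?n * unit_ball_vol ?n * (- r) ^ (?n - 1)) * indicator {..0} r * f (- r) \<partial>lborel)"
    unfolding distr_uminus_norm by (subst nn_integral_density) auto
  also have "\<dots> = (\<integral>\<^sup>+r. ennreal (?n * unit_ball_vol ?n * r ^ (?n - 1)) * f r * indicator {0..} r \<partial>lborel)"
    by (subst nn_integral_lborel_affine[of _ "-1" 0])
       (auto intro!: nn_integral_cong simp: indicator_def)
  finally show ?thesis .
qed

text \<open>In polar coordinates the Jacobian r^(n-1) leaves at most a constant times (1 + r)^(-2),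
  which has an explicit primitive. The exponent n + 1 is the one used below for all lattice sums and
  kernel bounds.\<close>

lemma integrable_inverse_norm_power:
  "integrable lborel (\<lambda>x::'a::euclidean_space. 1 / (1 + norm x) ^ (DIM('a) + 1))"
proof -
  let ?n = "DIM('a)"
  have n: "?n > 0" by simp
  have "(\<integral>\<^sup>+(x::'a). ennreal (1 / (1 + norm x) ^ (?n + 1)) \<partial>lborel) =
     (\<integral>\<^sup>+r. ennreal (?n * unit_ball_vol ?n * r ^ (?n - 1)) * ennreal (1 / (1 + r) ^ (?n + 1)) * indicator {0..} r \<partial>lborel)"
    by (rule nn_integral_norm) auto
  also have "\<dots> \<le> (\<integral>\<^sup>+r. ennreal (?n * unit_ball_vol ?n / (1 + r) ^ 2) * indicator {0..} r \<partial>lborel)"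
  proof (rule nn_integral_mono)
    fix r :: real
    show "ennreal (?n * unit_ball_vol ?n * r ^ (?n - 1)) * ennreal (1 / (1 + r) ^ (?n + 1)) * indicator {0..} r
       \<le> ennreal (?n * unit_ball_vol ?n / (1 + r) ^ 2) * indicator {0..} r"
    proof (cases "r \<ge> 0")
      case True
      have "(1 + r) ^ (?n + 1) = (1 + r) ^ (?n - 1) * (1 + r)\<^sup>2"
        using n by (simp flip: power_add)
      then have "r ^ (?n - 1) * (1 / (1 + r) ^ (?n + 1)) = (r ^ (?n - 1) / (1 + r) ^ (?n - 1)) * (1 / (1 + r) ^ 2)"
        by simp
      also have "\<dots> \<le> 1 * (1 / (1 + r) ^ 2)"
        using True by (intro mult_right_mono) (auto intro!: divide_le_eq_1_pos[THEN iffD2] power_mono)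
      finally have "r ^ (?n - 1) * (1 / (1 + r) ^ (?n + 1)) \<le> 1 * (1 / (1 + r) ^ 2)" .
      from mult_left_mono[OF this, of "?n * unit_ball_vol ?n"]
      have "?n * unit_ball_vol ?n * r ^ (?n - 1) * (1 / (1 + r) ^ (?n + 1)) \<le> ?n * unit_ball_vol ?n / (1 + r) ^ 2"
        by (simp add: mult.assoc)
      then show ?thesis using True
        by (auto simp: ennreal_mult[symmetric] intro!: ennreal_leI)
    qed auto
  qed
  also have "\<dots> = ennreal (0 - (- (?n * unit_ball_vol ?n) / (1 + 0)))"
  proof (rule nn_integral_FTC_atLeast[where F="\<lambda>x. - (?n * unit_ball_vol ?n) / (1 + x)"])
    fix x :: real assume x: "0 \<le> x"
    show "((\<lambda>x. - (?n * unit_ball_vol ?n) / (1 + x)) has_real_derivative ?n * unit_ball_vol ?n / (1 + x)\<^sup>2) (at x)"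
      using x by (auto intro!: derivative_eq_intros simp: power2_eq_square field_simps)
    show "0 \<le> real ?n * unit_ball_vol ?n / (1 + x)\<^sup>2" by auto
  next
    show "((\<lambda>x. - (?n * unit_ball_vol ?n) / (1 + x)) \<longlongrightarrow> 0) at_top"
      by real_asymp
  qed auto
  also have "\<dots> < \<infinity>" by simp
  finally show ?thesis
    by (intro integrableI_bounded) auto
qed

text \<open>The source of the constant in the density: the Jacobian r^(n-1) turns the weight into r
  powr (a - 1), integrable at 0 because a > 0, and n times the volume of the unit ball is the area
  of the sphere.\<close>

lemma has_bochner_integral_norm_powr:
  fixes a b :: real
  assumes a: "a > 0" and b: "b \<ge> 0"
  shows "has_bochner_integral lborel (\<lambda>x::'a::euclidean_space. indicator (cball 0 b) x * norm x powr (a - DIM('a)))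
      (DIM('a) * unit_ball_vol DIM('a) * (b powr a / a))"
proof -
  let ?n = "DIM('a)"
  have n: "?n > 0" by simp
  have "(\<integral>\<^sup>+(x::'a). ennreal (indicator {..b} (norm x) * norm x powr (a - ?n)) \<partial>lborel) =
     (\<integral>\<^sup>+r. ennreal (?n * unit_ball_vol ?n * r ^ (?n - 1)) * ennreal (indicator {..b} r * r powr (a - ?n)) * indicator {0..} r \<partial>lborel)"
    by (rule nn_integral_norm) auto
  also have "\<dots> = (\<integral>\<^sup>+r. ennreal (?n * unit_ball_vol ?n) * ennreal (r powr (a - 1) * indicator {0..b} r) \<partial>lborel)"
  proof (rule nn_integral_cong)
    fix r :: real
    have "r ^ (?n - 1) * r powr (a - ?n) = r powr (a - 1)" if "r > 0"
    proof -
      have "r ^ (?n - 1) = r powr (?n - 1)" using that n by (simp add: powr_realpow[symmetric] of_nat_diff)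
      then show ?thesis using n by (simp flip: powr_add)
    qed
    \<comment> \<open>At r = 0 both sides vanish, by the convention
      \<open>0 powr x = 0\<close>.\<close>
    then show "ennreal (?n * unit_ball_vol ?n * r ^ (?n - 1)) * ennreal (indicator {..b} r * r powr (a - ?n)) * indicator {0..} r
       = ennreal (?n * unit_ball_vol ?n) * ennreal (r powr (a - 1) * indicator {0..b} r)"
      by (cases "r = 0"; cases "r > 0") (auto simp: indicator_def ennreal_mult[symmetric] mult.assoc)
  qed
  also have "\<dots> = ennreal (?n * unit_ball_vol ?n) * ennreal (b powr a / a)"
  proof (subst nn_integral_cmult)
    have "((\<lambda>r. r powr (a - 1)) has_integral (b powr a / a)) {0..b}"
      using has_integral_powr_from_0[of "a - 1" b] a b by simp
    then have "((\<lambda>r. r powr (a - 1) * indicator {0..b} r) has_integral (b powr a / a)) UNIV"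
      by (subst (asm) has_integral_restrict_UNIV[symmetric])
         (auto simp: indicator_def if_distrib mult.commute of_bool_def cong: if_cong)
    then show "ennreal (?n * unit_ball_vol ?n) * (\<integral>\<^sup>+r. ennreal (r powr (a - 1) * indicator {0..b} r) \<partial>lborel) =
       ennreal (?n * unit_ball_vol ?n) * ennreal (b powr a / a)"
      by (subst nn_integral_has_integral_lborel) auto
  qed auto
  finally have *: "(\<integral>\<^sup>+(x::'a). ennreal (indicator (cball 0 b) x * norm x powr (a - ?n)) \<partial>lborel) =
      ennreal (?n * unit_ball_vol ?n * (b powr a / a))"
    using a by (simp add: indicator_def ennreal_mult' flip: times_divide_eq_right)
  show ?thesis
    by (rule has_bochner_integral_nn_integral[OF _ _ _ *])
       (use a in \<open>auto intro!: borel_measurable_times borel_measurable_indicator\<close>)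
qed

lemma unit_sphere_area_eq:
  assumes "n > 0" shows "unit_sphere_area n = n * unit_ball_vol n"
proof -
  have "real n / 2 \<notin> \<int>\<^sub>\<le>\<^sub>0"
    using assms by (intro notI) (auto elim!: nonpos_Ints_cases)
  then have *: "Gamma (real n / 2 + 1) = real n / 2 * Gamma (real n / 2)"
    by (rule Gamma_plus1)
  show ?thesis using assms
    unfolding unit_sphere_area_def unit_ball_vol_def * by (simp add: field_simps)
qed

subsection \<open>Sums over the integer lattice\<close>

lemma countable_int_lattice: "countable (int_lattice :: (real^'n) set)"
proof -
  have "int_lattice \<subseteq> range (\<lambda>f::'n \<Rightarrow> int. \<chi> i. real_of_int (f i))"
  proof
    fix m :: "real^'n" assume "m \<in> int_lattice"
    then have "m = (\<chi> i. real_of_int \<lfloor>m $ i\<rfloor>)"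
      by (auto simp: int_lattice_def vec_eq_iff)
    then show "m \<in> range (\<lambda>f::'n \<Rightarrow> int. \<chi> i. real_of_int (f i))" by (rule range_eqI[where x="\<lambda>i. \<lfloor>m $ i\<rfloor>"])
  qed
  moreover have "countable (UNIV :: ('n \<Rightarrow> int) set)"
    by (rule countableI_type)
  ultimately show ?thesis
    by (meson countable_image countable_subset)
qed

lemma int_lattice_zero: "0 \<in> int_lattice"
  by (simp add: int_lattice_def)

text \<open>Sums over the lattice are written as integrals over counting measure, so that exchanging
  a sum with an integral is Fubini's theorem for two sigma-finite measures.\<close>

abbreviation lattice_measure :: "(real^'n) measure" where
  "lattice_measure \<equiv> count_space int_lattice"

lemma sigma_finite_lattice: "sigma_finite_measure (lattice_measure :: (real^'n) measure)"
  by (rule sigma_finite_measure_count_space_countable[OF countable_int_lattice])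

interpretation lattice: sigma_finite_measure "lattice_measure :: (real^'n) measure"
  by (rule sigma_finite_lattice)

interpretation lattice_lborel: pair_sigma_finite "lattice_measure :: (real^'n) measure" "lborel :: (real^'n) measure" ..

lemma measurable_lattice_pair:
  assumes "\<And>m. m \<in> int_lattice \<Longrightarrow> f m \<in> M \<rightarrow>\<^sub>M N"
  shows "(\<lambda>(m, x). f m x) \<in> (lattice_measure \<Otimes>\<^sub>M M) \<rightarrow>\<^sub>M N"
  using assms by (intro measurable_pair_measure_countable1 countable_int_lattice) auto

lemma bij_betw_lattice_translate:
  assumes "k \<in> int_lattice"
  shows "bij_betw (\<lambda>m. k + m) int_lattice int_lattice"
  by (rule bij_betwI[where g="\<lambda>m. m - k"]) (use assms in \<open>auto simp: int_lattice_def\<close>)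

lemma lattice_integral_translate:
  fixes f :: "real^'n \<Rightarrow> 'b::{banach, second_countable_topology}"
  assumes "k \<in> int_lattice"
  shows "(LINT m|lattice_measure. f (k + m)) = (LINT m|lattice_measure. f m)"
  using integral_bij_count_space[OF bij_betw_lattice_translate[OF assms], of f] by simp

text \<open>Half-open, so that the integer translates partition the space exactly and not merely up
  to null sets.\<close>

definition unit_cell :: "(real^'n) set" where
  "unit_cell = {x. \<forall>i. 0 \<le> x $ i \<and> x $ i < 1}"

lemma unit_cell_borel [measurable]: "unit_cell \<in> sets borel"
  unfolding unit_cell_def by measurable

lemma unique_lattice_translate:
  "\<exists>!m. m \<in> int_lattice \<and> x + m \<in> unit_cell"
proof (rule ex1I[of _ "\<chi> i. - real_of_int \<lfloor>x $ i\<rfloor>"], goal_cases)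
  case 1
  show ?case by (auto simp: int_lattice_def unit_cell_def) linarith+
next
  case (2 m)
  have "m $ i = - real_of_int \<lfloor>x $ i\<rfloor>" for i
  proof -
    have "m $ i \<in> \<int>" using 2 by (auto simp: int_lattice_def)
    then obtain z where z: "m $ i = of_int z" by (auto elim: Ints_cases)
    moreover have "0 \<le> x $ i + m $ i" "x $ i + m $ i < 1"
      using 2 by (auto simp: unit_cell_def)
    ultimately have "\<lfloor>x $ i\<rfloor> = - z" by linarith
    with z show ?thesis by simp
  qed
  then show ?case by (simp add: vec_eq_iff)
qed

lemma lattice_sum_unit_cell:
  "(\<integral>\<^sup>+m. indicator unit_cell (x + m :: real^'n) \<partial>lattice_measure) = (1::ennreal)"
proof -
  from unique_lattice_translate[of x]
  obtain m0 where m0: "m0 \<in> int_lattice" "x + m0 \<in> unit_cell"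
    and unique: "\<And>m. m \<in> int_lattice \<Longrightarrow> x + m \<in> unit_cell \<Longrightarrow> m = m0" by metis
  have "(\<integral>\<^sup>+m. indicator unit_cell (x + m) \<partial>lattice_measure)
      = (\<integral>\<^sup>+m. indicator {m0} m \<partial>lattice_measure)"
  proof (rule nn_integral_cong)
    fix m :: "real^'n" assume "m \<in> space lattice_measure"
    then have "x + m \<in> unit_cell \<longleftrightarrow> m \<in> {m0}"
      using m0(2) unique[of m] by auto
    then show "indicator unit_cell (x + m) = (indicator {m0} m :: ennreal)"
      unfolding indicator_def by (simp only:)
  qed
  also have "\<dots> = emeasure lattice_measure {m0}"
    using m0 by (intro nn_integral_indicator) auto
  also have "\<dots> = 1"
    using m0 by (subst emeasure_count_space) auto
  finally show ?thesis .
qed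

lemma lattice_integral_unit_cell:
  "(LINT m|lattice_measure. indicator unit_cell (x + m)) = (1::real)"
  by (subst integral_eq_nn_integral)
     (simp_all add: lattice_sum_unit_cell ennreal_indicator)

text \<open>Unfolding: insert the partition of unity formed by the translates of the cell, exchange
  sum and integral, and move the translation from the cell to f.\<close>

lemma nn_integral_tiling:
  fixes f :: "real^'n \<Rightarrow> ennreal"
  assumes [measurable]: "f \<in> borel_measurable borel"
  shows "(\<integral>\<^sup>+x. f x \<partial>lborel) =
    (\<integral>\<^sup>+x. indicator unit_cell x * (\<integral>\<^sup>+m. f (x - m) \<partial>lattice_measure) \<partial>lborel)"
proof -
  have [measurable]: "(\<lambda>(m, x). indicator unit_cell (x + m) * f x) \<in> borel_measurable (lattice_measure \<Otimes>\<^sub>M lborel)"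
    by (rule measurable_lattice_pair) measurable
  have [measurable]: "(\<lambda>(m, x). indicator unit_cell x * f (x - m)) \<in> borel_measurable (lattice_measure \<Otimes>\<^sub>M lborel)"
    by (rule measurable_lattice_pair) measurable
  have "(\<integral>\<^sup>+x. f x \<partial>lborel) = (\<integral>\<^sup>+x. (\<integral>\<^sup>+m. indicator unit_cell (x + m) * f x \<partial>lattice_measure) \<partial>lborel)"
    by (simp add: nn_integral_multc lattice_sum_unit_cell)
  also have "\<dots> = (\<integral>\<^sup>+m. (\<integral>\<^sup>+x. indicator unit_cell (x + m) * f x \<partial>lborel) \<partial>lattice_measure)"
    by (rule lattice_lborel.Fubini') measurable
  also have "\<dots> = (\<integral>\<^sup>+m. (\<integral>\<^sup>+x. indicator unit_cell x * f (x - m) \<partial>lborel) \<partial>lattice_measure)"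
    using nn_integral_lborel_translate[of "\<lambda>x. indicator unit_cell (x + m) * f x" m for m]
    by simp
  also have "\<dots> = (\<integral>\<^sup>+x. (\<integral>\<^sup>+m. indicator unit_cell x * f (x - m) \<partial>lattice_measure) \<partial>lborel)"
    by (rule lattice_lborel.Fubini'[symmetric]) measurable
  finally show ?thesis
    by (simp add: nn_integral_cmult)
qed

text \<open>The same unfolding for vector-valued f. Both exchanges need integrability on the
  product; for the folded integrand \<open>i2\<close> this is the nonnegative version applied to the
  norm of f.\<close>

lemma integral_tiling:
  fixes f :: "real^'n \<Rightarrow> 'b::{banach, second_countable_topology}"
  assumes f: "integrable lborel f"
  shows "(LINT x|lborel. f x) =
    (LINT x|lborel. indicator unit_cell x *\<^sub>R (LINT m|lattice_measure. f (x - m)))"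
    and "integrable lborel (\<lambda>x. indicator unit_cell x *\<^sub>R (LINT m|lattice_measure. f (x - m)))"
proof -
  have [measurable]: "f \<in> borel_measurable borel"
    using borel_measurable_integrable[OF f] by simp
  have m1: "(\<lambda>(m, x). indicator unit_cell (x + m) *\<^sub>R f x) \<in> borel_measurable (lattice_measure \<Otimes>\<^sub>M lborel)"
    by (rule measurable_lattice_pair) measurable
  have m2: "(\<lambda>(m, x). indicator unit_cell x *\<^sub>R f (x - m)) \<in> borel_measurable (lattice_measure \<Otimes>\<^sub>M lborel)"
    by (rule measurable_lattice_pair) measurable
  have fin: "(\<integral>\<^sup>+x. norm (f x) \<partial>lborel) < \<infinity>"
    using f by (simp add: integrable_iff_bounded)
  have i1: "integrable (lattice_measure \<Otimes>\<^sub>M lborel) (\<lambda>(m, x). indicator unit_cell (x + m) *\<^sub>R f x)"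
  proof (rule integrableI_bounded[OF m1])
    have "(\<integral>\<^sup>+z. norm (case z of (m, x) \<Rightarrow> indicator unit_cell (x + m) *\<^sub>R f x) \<partial>(lattice_measure \<Otimes>\<^sub>M lborel))
       = (\<integral>\<^sup>+x. (\<integral>\<^sup>+m. indicator unit_cell (x + m) * ennreal (norm (f x)) \<partial>lattice_measure) \<partial>lborel)"
      by (subst lattice_lborel.nn_integral_snd[symmetric])
         (use m1 in \<open>auto intro!: nn_integral_cong simp: indicator_def\<close>)
    then show "(\<integral>\<^sup>+z. norm (case z of (m, x) \<Rightarrow> indicator unit_cell (x + m) *\<^sub>R f x) \<partial>(lattice_measure \<Otimes>\<^sub>M lborel)) < \<infinity>"
      using fin by (simp add: nn_integral_multc lattice_sum_unit_cell)
  qed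
  have i2: "integrable (lattice_measure \<Otimes>\<^sub>M lborel) (\<lambda>(m, x). indicator unit_cell x *\<^sub>R f (x - m))"
  proof (rule integrableI_bounded[OF m2])
    have "(\<integral>\<^sup>+z. norm (case z of (m, x) \<Rightarrow> indicator unit_cell x *\<^sub>R f (x - m)) \<partial>(lattice_measure \<Otimes>\<^sub>M lborel))
       = (\<integral>\<^sup>+x. (\<integral>\<^sup>+m. indicator unit_cell x * ennreal (norm (f (x - m))) \<partial>lattice_measure) \<partial>lborel)"
      by (subst lattice_lborel.nn_integral_snd[symmetric])
         (use m2 in \<open>auto intro!: nn_integral_cong simp: indicator_def\<close>)
    also have "\<dots> = (\<integral>\<^sup>+x. norm (f x) \<partial>lborel)"
      by (subst nn_integral_tiling) (auto simp: nn_integral_cmult)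
    finally show "(\<integral>\<^sup>+z. norm (case z of (m, x) \<Rightarrow> indicator unit_cell x *\<^sub>R f (x - m)) \<partial>(lattice_measure \<Otimes>\<^sub>M lborel)) < \<infinity>"
      using fin by simp
  qed
  have "(LINT x|lborel. f x) = (LINT x|lborel. (LINT m|lattice_measure. indicator unit_cell (x + m) *\<^sub>R f x))"
  proof (rule Bochner_Integration.integral_cong[OF refl])
    fix x :: "real^'n"
    have "integrable lattice_measure (\<lambda>m. indicator unit_cell (x + m) :: real)"
      by (rule integrableI_bounded) (simp_all add: lattice_sum_unit_cell ennreal_indicator)
    then show "f x = (LINT m|lattice_measure. indicator unit_cell (x + m) *\<^sub>R f x)"
      by (simp add: lattice_integral_unit_cell)
  qed
  also have "\<dots> = (LINT m|lattice_measure. (LINT x|lborel. indicator unit_cell (x + m) *\<^sub>R f x))"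
    by (rule lattice_lborel.Fubini_integral[OF i1])
  also have "\<dots> = (LINT m|lattice_measure. (LINT x|lborel. indicator unit_cell x *\<^sub>R f (x - m)))"
    using lborel_translate[of "\<lambda>x. indicator unit_cell (x + m) *\<^sub>R f x" m for m]
    by simp
  also have "\<dots> = (LINT x|lborel. (LINT m|lattice_measure. indicator unit_cell x *\<^sub>R f (x - m)))"
    by (rule lattice_lborel.Fubini_integral[OF i2, symmetric])
  finally show "(LINT x|lborel. f x) =
    (LINT x|lborel. indicator unit_cell x *\<^sub>R (LINT m|lattice_measure. f (x - m)))"
    by simp
  have "integrable lborel (\<lambda>x. LINT m|lattice_measure. indicator unit_cell x *\<^sub>R f (x - m))"
    using lattice_lborel.integrable_snd[OF i2] by simp
  then show "integrable lborel (\<lambda>x. indicator unit_cell x *\<^sub>R (LINT m|lattice_measure. f (x - m)))"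
    by simp
qed

lemma AE_unit_cell_box: "AE x in lborel. x \<in> unit_cell \<longleftrightarrow> x \<in> box 0 (1 :: real^'n)"
proof -
  have "emeasure lborel (cbox 0 (1 :: real^'n) - box 0 1) = 0"
    by (subst emeasure_Diff) (auto simp: emeasure_lborel_box_eq emeasure_lborel_cbox_eq box_subset_cbox)
  then have "AE x in lborel. x \<notin> cbox 0 (1 :: real^'n) - box 0 1"
    by (intro AE_not_in) (auto simp: null_sets_def)
  then show ?thesis
    by eventually_elim (auto simp: unit_cell_def mem_box_cart less_imp_le)
qed

lemma emeasure_unit_cell: "emeasure lborel (unit_cell :: (real^'n) set) = 1"
proof -
  have "emeasure lborel (unit_cell :: (real^'n) set) = emeasure lborel (box 0 (1 :: real^'n))"
    using AE_unit_cell_box by (intro emeasure_eq_AE) auto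
  also have "\<dots> = 1"
  proof -
    have "1 \<bullet> b = 1" if "b \<in> Basis" for b :: "real^'n"
      using that by (auto simp: Basis_vec_def inner_axis)
    then show ?thesis
      by (simp add: emeasure_lborel_box_eq prod.neutral)
  qed
  finally show ?thesis .
qed

subsection \<open>Rapidly decreasing functions and the kernel\<close>

lemma measurable_lattice_pair2:
  assumes "\<And>m. m \<in> int_lattice \<Longrightarrow> f m \<in> M \<rightarrow>\<^sub>M N"
  shows "(\<lambda>(x, m). f m x) \<in> (M \<Otimes>\<^sub>M lattice_measure) \<rightarrow>\<^sub>M N"
  using measurable_lattice_pair[of f M N] assms
  by (subst measurable_pair_swap_iff) (auto simp: case_prod_unfold)

lemma borel_measurable_cnj [measurable (raw)]:
  "f \<in> borel_measurable M \<Longrightarrow> (\<lambda>x. cnj (f x)) \<in> borel_measurable M"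
  by (rule borel_measurable_continuous_on[where f=cnj]) (auto intro!: continuous_intros)

text \<open>Peetre's inequality: 1 + |x + y| \<le> (1 + R)(1 + |x|), so moving the base point by a
  bounded amount costs only a constant factor.\<close>

lemma decay_power_shift:
  fixes x y :: "'a::real_normed_vector"
  assumes "norm y \<le> R"
  shows "1 / (1 + norm x) ^ p \<le> (1 + R) ^ p / (1 + norm (x + y)) ^ p"
proof -
  have R: "0 \<le> R" using assms norm_ge_zero[of y] by linarith
  have "1 + norm (x + y) \<le> 1 + norm x + R"
    using norm_triangle_ineq[of x y] assms by linarith
  also have "\<dots> \<le> (1 + R) * (1 + norm x)"
    using R by (simp add: algebra_simps)
  finally have "(1 + norm (x + y)) ^ p \<le> (1 + R) ^ p * (1 + norm x) ^ p"
    by (simp add: power_mono flip: power_mult_distrib)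
  moreover have "0 < 1 + norm x" "0 < 1 + norm (x + y)"
    by (auto intro: add_pos_nonneg)
  ultimately show ?thesis
    by (simp add: field_simps)
qed

text \<open>Comparison of a sum with an integral. Each summand is, up to the factor from
  \<open>decay_power_shift\<close>, at most its shift by any w in the unit cell; averaging over w
  unfolds the sum to an integral over the whole space, which does not depend on x.\<close>

lemma lattice_sum_decay:
  "\<exists>B\<ge>0. \<forall>x::real^'n. (\<integral>\<^sup>+m. ennreal (1 / (1 + norm (x - m)) ^ (CARD('n) + 1)) \<partial>lattice_measure) \<le> ennreal B"
proof -
  let ?p = "CARD('n) + 1"
  let ?g = "\<lambda>x::real^'n. 1 / (1 + norm x) ^ ?p"
  let ?K = "(1 + real CARD('n)) ^ ?p"
  let ?I = "LINT x|lborel. ?g x"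
  have int: "integrable lborel ?g"
    using integrable_inverse_norm_power[where 'a="real^'n"] by simp
  have I: "(\<integral>\<^sup>+x. ennreal (?g x) \<partial>lborel) = ennreal ?I"
    using int by (intro nn_integral_eq_integral) auto
  have "(\<integral>\<^sup>+m. ennreal (?g (x - m)) \<partial>lattice_measure) \<le> ennreal (?K * ?I)" for x :: "real^'n"
  proof -
    let ?h = "\<lambda>w. ennreal (?g (w + x))"
    have cell: "norm w \<le> real CARD('n)" if "w \<in> unit_cell" for w :: "real^'n"
    proof -
      have "norm w \<le> (\<Sum>i\<in>UNIV. \<bar>w $ i\<bar>)" by (rule norm_le_l1_cart)
      also have "\<dots> \<le> (\<Sum>i\<in>(UNIV::'n set). 1)"
        using that by (intro sum_mono) (auto simp: unit_cell_def intro: less_imp_le)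
      finally show ?thesis by simp
    qed
    \<comment> \<open>The cell has volume one, so a quantity independent of w equals its average
      over the cell.\<close>
    have "(\<integral>\<^sup>+m. ennreal (?g (x - m)) \<partial>lattice_measure) =
      (\<integral>\<^sup>+(w::real^'n). indicator unit_cell w * (\<integral>\<^sup>+m. ennreal (?g (x - m)) \<partial>lattice_measure) \<partial>lborel)"
      by (simp add: nn_integral_multc emeasure_unit_cell)
    also have "\<dots> \<le> (\<integral>\<^sup>+w. ennreal ?K * (indicator unit_cell w * (\<integral>\<^sup>+m. ?h (w - m) \<partial>lattice_measure)) \<partial>lborel)"
    proof (rule nn_integral_mono)
      fix w :: "real^'n"
      have "(\<integral>\<^sup>+m. ennreal (?g (x - m)) \<partial>lattice_measure) \<le> (\<integral>\<^sup>+m. ennreal ?K * ?h (w - m) \<partial>lattice_measure)"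
        if "w \<in> unit_cell"
      proof (rule nn_integral_mono)
        fix m :: "real^'n"
        have "?g (x - m) \<le> ?K * ?g (w - m + x)"
          using decay_power_shift[OF cell[OF that], of "x - m" ?p] by (simp add: algebra_simps)
        then show "ennreal (?g (x - m)) \<le> ennreal ?K * ?h (w - m)"
          by (simp add: ennreal_mult[symmetric] ennreal_leI)
      qed
      then show "indicator unit_cell w * (\<integral>\<^sup>+m. ennreal (?g (x - m)) \<partial>lattice_measure)
        \<le> ennreal ?K * (indicator unit_cell w * (\<integral>\<^sup>+m. ?h (w - m) \<partial>lattice_measure))"
        by (cases "w \<in> unit_cell") (auto simp: nn_integral_cmult)
    qed
    also have "\<dots> = ennreal ?K * (\<integral>\<^sup>+w. indicator unit_cell w * (\<integral>\<^sup>+m. ?h (w - m) \<partial>lattice_measure) \<partial>lborel)"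
    proof (rule nn_integral_cmult)
      have [measurable]: "(\<lambda>(w, m). ?h (w - m)) \<in> borel_measurable (lborel \<Otimes>\<^sub>M lattice_measure)"
        by (rule measurable_lattice_pair2) simp
      show "(\<lambda>w. indicator unit_cell w * (\<integral>\<^sup>+m. ?h (w - m) \<partial>lattice_measure)) \<in> borel_measurable lborel"
        by measurable
    qed
    also have "\<dots> = ennreal ?K * (\<integral>\<^sup>+w. ?h w \<partial>lborel)"
      by (subst nn_integral_tiling[of ?h]) auto
    also have "\<dots> = ennreal ?K * ennreal ?I"
      using nn_integral_lborel_translate[of "\<lambda>w. ennreal (?g w)" "- x"] I by simp
    finally show ?thesis by (simp add: ennreal_mult)
  qed
  moreover have "0 \<le> ?K * ?I" by (intro mult_nonneg_nonneg integral_nonneg_AE) auto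
  ultimately show ?thesis by blast
qed

text \<open>The powers of 1 + |x| in \<open>decay\<close> pay for the convergence of lattice sums
  and leave \<open>E\<close> intact for the integral against the measure. Monotonicity lets
  \<open>E\<close> at a far point be replaced by \<open>E\<close> at a lower bound for its
  norm.\<close>

locale rapidly_decreasing =
  fixes \<phi> :: "real^'n \<Rightarrow> complex" and E :: "real \<Rightarrow> real"
  assumes continuous_phi: "continuous_on UNIV \<phi>"
    and continuous_E: "continuous_on UNIV E"
    and E_nonneg: "\<And>t. 0 \<le> E t" and E_le_1: "\<And>t. E t \<le> 1"
    and E_antimono: "\<And>s t. 0 \<le> s \<Longrightarrow> s \<le> t \<Longrightarrow> E t \<le> E s"
    and decay: "\<And>N. \<exists>C. \<forall>x. cmod (\<phi> x) \<le> C * E (norm x) / (1 + norm x) ^ N"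
begin

lemma phi_measurable [measurable]: "\<phi> \<in> borel_measurable borel"
  using continuous_phi by (rule borel_measurable_continuous_onI)

lemma E_measurable [measurable]: "E \<in> borel_measurable borel"
  using continuous_E by (rule borel_measurable_continuous_onI)

lemma decay_bound:
  obtains C where "C \<ge> 0" "\<And>x. cmod (\<phi> x) \<le> C * E (norm x) / (1 + norm x) ^ N"
proof -
  obtain C where C: "\<And>x. cmod (\<phi> x) \<le> C * E (norm x) / (1 + norm x) ^ N"
    using decay by blast
  have "cmod (\<phi> x) \<le> max C 0 * E (norm x) / (1 + norm x) ^ N" for x
    by (rule order_trans[OF C]) (auto intro!: divide_right_mono mult_right_mono simp: E_nonneg)
  then show ?thesis using that[of "max C 0"] by simp
qed

lemma decay_bound':
  obtains C where "C \<ge> 0" "\<And>x. cmod (\<phi> x) \<le> C / (1 + norm x) ^ N"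
proof -
  obtain C where C: "C \<ge> 0" "\<And>x. cmod (\<phi> x) \<le> C * E (norm x) / (1 + norm x) ^ N"
    using decay_bound by blast
  have "cmod (\<phi> x) \<le> C / (1 + norm x) ^ N" for x
    by (rule order_trans[OF C(2)])
       (use C(1) E_le_1 in \<open>auto intro!: divide_right_mono mult_left_le\<close>)
  then show ?thesis using that C(1) by blast
qed

lemma integrable_phi: "integrable lborel \<phi>"
proof -
  obtain C where C: "C \<ge> 0" "\<And>x. cmod (\<phi> x) \<le> C / (1 + norm x) ^ (CARD('n) + 1)"
    using decay_bound' by blast
  show ?thesis
    by (rule Bochner_Integration.integrable_bound[OF integrable_mult_right[OF integrable_inverse_norm_power[where 'a="real^'n"], of C]])
       (use C in auto)
qed

definition periodization :: "real^'n \<Rightarrow> complex" where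
  "periodization x = (LINT m|lattice_measure. \<phi> (x - m))"

abbreviation phi_abs :: "real^'n \<Rightarrow> ennreal" where
  "phi_abs x \<equiv> ennreal (cmod (\<phi> x))"

abbreviation abs_sum :: "real^'n \<Rightarrow> ennreal" where
  "abs_sum x \<equiv> (\<integral>\<^sup>+m. phi_abs (x - m) \<partial>lattice_measure)"

abbreviation abs_kernel :: "real^'n \<Rightarrow> real^'n \<Rightarrow> ennreal" where
  "abs_kernel x y \<equiv> (\<integral>\<^sup>+m. ennreal (cmod (\<phi> (x - m)) * cmod (\<phi> (y - m))) \<partial>lattice_measure)"

abbreviation decay_factor :: "nat \<Rightarrow> real^'n \<Rightarrow> real^'n \<Rightarrow> real" where
  "decay_factor N x y \<equiv> E (norm (x - y) / 2) / (1 + norm (x - y) / 2) ^ N"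

text \<open>The conjugate of the inner product of the indicator of A with a translate of
  \<open>\<phi>\<close>. In this form the coefficients over A and over its complement add up to the
  integral of \<open>\<phi>\<close> itself.\<close>

abbreviation coefficient :: "(real^'n) set \<Rightarrow> real^'n \<Rightarrow> complex" where
  "coefficient A m \<equiv> (LINT x|lborel. indicator A x *\<^sub>R \<phi> (x - m))"

lemma lattice_sum_phi:
  obtains C where "C \<ge> 0" "\<And>x. abs_sum x \<le> ennreal C"
proof -
  obtain C where C: "C \<ge> 0" "\<And>x. cmod (\<phi> x) \<le> C / (1 + norm x) ^ (CARD('n) + 1)"
    using decay_bound' by blast
  obtain B where B: "B \<ge> 0"
    "\<And>x::real^'n. (\<integral>\<^sup>+m. ennreal (1 / (1 + norm (x - m)) ^ (CARD('n) + 1)) \<partial>lattice_measure) \<le> ennreal B"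
    using lattice_sum_decay by blast
  have "abs_sum x \<le> ennreal (C * B)" for x
  proof -
    have "abs_sum x
       \<le> (\<integral>\<^sup>+m. ennreal C * ennreal (1 / (1 + norm (x - m)) ^ (CARD('n) + 1)) \<partial>lattice_measure)"
      using C by (intro nn_integral_mono) (auto simp: ennreal_mult[symmetric] intro!: ennreal_leI)
    also have "\<dots> \<le> ennreal C * ennreal B"
      by (subst nn_integral_cmult) (auto intro!: mult_left_mono B[simplified])
    finally show ?thesis using C(1) B(1) by (simp add: ennreal_mult)
  qed
  then show ?thesis using that[of "C * B"] C(1) B(1) by simp
qed

lemma norm_lattice_integral_le:
  fixes f :: "real^'n \<Rightarrow> complex"
  assumes "(\<integral>\<^sup>+m. ennreal (cmod (f m)) \<partial>lattice_measure) \<le> ennreal c" "c \<ge> 0"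
  shows "cmod (LINT m|lattice_measure. f m) \<le> c"
proof -
  have "ennreal (cmod (LINT m|lattice_measure. f m)) \<le> (\<integral>\<^sup>+m. ennreal (cmod (f m)) \<partial>lattice_measure)"
    using assms by (intro integral_norm_bound_ennreal integrableI_bounded) (auto intro: le_less_trans)
  then have "ennreal (cmod (LINT m|lattice_measure. f m)) \<le> ennreal c"
    using assms(1) by (rule order_trans)
  then show ?thesis using assms(2) by (simp add: ennreal_le_iff)
qed

lemma periodization_measurable [measurable]: "periodization \<in> borel_measurable borel"
proof -
  have [measurable]: "(\<lambda>(x, m). \<phi> (x - m)) \<in> borel_measurable (borel \<Otimes>\<^sub>M lattice_measure)"
    by (rule measurable_lattice_pair2) simp
  show ?thesis unfolding periodization_def by measurable
qed

lemma periodization_bounded: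
  obtains C where "C \<ge> 0" "\<And>x. cmod (periodization x) \<le> C"
  using lattice_sum_phi norm_lattice_integral_le unfolding periodization_def by metis

lemma periodization_periodic:
  assumes "k \<in> int_lattice" shows "periodization (x - k) = periodization x"
  using lattice_integral_translate[OF assms, of "\<lambda>m. \<phi> (x - m)"]
  by (simp add: periodization_def algebra_simps)

text \<open>Dominated convergence on the lattice: the points of a convergent sequence stay within a
  fixed distance R of x, so \<open>decay_power_shift\<close> yields one summable majorant for all of
  them.\<close>

lemma isCont_periodization: "isCont periodization x"
proof (unfold continuous_at_sequentially comp_def, intro allI impI)
  fix u :: "nat \<Rightarrow> real^'n" assume u: "u \<longlonglongrightarrow> x"
  obtain C where C: "C \<ge> 0" "\<And>x. cmod (\<phi> x) \<le> C / (1 + norm x) ^ (CARD('n) + 1)"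
    using decay_bound' by blast
  obtain B where B: "(\<integral>\<^sup>+m. ennreal (1 / (1 + norm (x - m)) ^ (CARD('n) + 1)) \<partial>lattice_measure) \<le> ennreal B"
    using lattice_sum_decay by blast
  have "bounded (range (\<lambda>i. x - u i))"
    by (rule convergent_imp_bounded[of _ "x - x"]) (intro tendsto_intros u)
  then obtain R where R: "\<And>i. norm (x - u i) \<le> R"
    unfolding bounded_iff by auto
  have "R \<ge> 0" using R[of 0] norm_ge_zero order_trans by blast
  show "(\<lambda>i. periodization (u i)) \<longlonglongrightarrow> periodization x"
    unfolding periodization_def
  proof (rule integral_dominated_convergence)
    have "integrable lattice_measure (\<lambda>m. 1 / (1 + norm (x - m)) ^ (CARD('n) + 1))"
      using B by (intro integrableI_bounded) (auto intro: le_less_trans)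
    then show "integrable lattice_measure (\<lambda>m. C * (1 + R) ^ (CARD('n) + 1) * (1 / (1 + norm (x - m)) ^ (CARD('n) + 1)))"
      by (rule integrable_mult_right)
    show "AE m in lattice_measure. (\<lambda>i. \<phi> (u i - m)) \<longlonglongrightarrow> \<phi> (x - m)"
      using continuous_phi u
      by (intro AE_I2 continuous_on_tendsto_compose[OF continuous_phi]) (auto intro!: tendsto_intros)
    show "AE m in lattice_measure. cmod (\<phi> (u i - m)) \<le>
       C * (1 + R) ^ (CARD('n) + 1) * (1 / (1 + norm (x - m)) ^ (CARD('n) + 1))" for i
    proof (intro AE_I2)
      fix m
      have "cmod (\<phi> (u i - m)) \<le> C * (1 / (1 + norm (u i - m)) ^ (CARD('n) + 1))"
        using C(2)[of "u i - m"] by simp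
      also have "\<dots> \<le> C * ((1 + R) ^ (CARD('n) + 1) / (1 + norm (u i - m + (x - u i))) ^ (CARD('n) + 1))"
        by (intro mult_left_mono decay_power_shift R C)
      finally show "cmod (\<phi> (u i - m)) \<le>
         C * (1 + R) ^ (CARD('n) + 1) * (1 / (1 + norm (x - m)) ^ (CARD('n) + 1))"
        by (simp add: algebra_simps)
    qed
  qed simp_all
qed

text \<open>One of \<open>x - m\<close> and \<open>y - m\<close> has norm at least \<open>norm (x - y) / 2\<close>; the decay of \<open>\<phi>\<close> at
  that point gives the factor in front, the decay at the other one makes the series converge.\<close>

lemma lattice_sum_kernel:
  "\<exists>C\<ge>0. \<forall>x y. abs_kernel x y
       \<le> ennreal (C * decay_factor N x y)"
proof -
  obtain A where A: "A \<ge> 0" "\<And>x. cmod (\<phi> x) \<le> A * E (norm x) / (1 + norm x) ^ N"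
    using decay_bound by blast
  obtain S where S: "S \<ge> 0" "\<And>x. abs_sum x \<le> ennreal S"
    using lattice_sum_phi by blast
  have "abs_kernel x y
       \<le> ennreal ((A * (2 * S)) * decay_factor N x y)" for x y
  proof -
    let ?d = "norm (x - y) / 2"
    let ?D = "E ?d / (1 + ?d) ^ N"
    have D: "?D \<ge> 0" by (simp add: E_nonneg)
    have far: "cmod (\<phi> z) \<le> A * ?D" if "?d \<le> norm z" for z
    proof -
      have "cmod (\<phi> z) \<le> A * (E (norm z) / (1 + norm z) ^ N)" using A(2)[of z] by simp
      also have "\<dots> \<le> A * ?D"
        using that A(1) by (intro mult_left_mono frac_le E_antimono power_mono E_nonneg zero_less_power) (auto intro: add_pos_nonneg)
      finally show ?thesis .
    qed
    \<comment> \<open>Which of the two points is far depends on m. With the sum of both factors on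
      the right the bound takes the same form in either case and can be summed over m.\<close>
    have "cmod (\<phi> (x - m)) * cmod (\<phi> (y - m)) \<le> A * ?D * (cmod (\<phi> (x - m)) + cmod (\<phi> (y - m)))" for m
    proof (cases "?d \<le> norm (x - m)")
      case True
      have "cmod (\<phi> (x - m)) * cmod (\<phi> (y - m)) \<le> A * ?D * cmod (\<phi> (y - m))"
        by (intro mult_right_mono far True) simp
      also have "\<dots> \<le> A * ?D * (cmod (\<phi> (x - m)) + cmod (\<phi> (y - m)))"
        by (intro mult_left_mono mult_nonneg_nonneg D A(1)) auto
      finally show ?thesis .
    next
      case False
      have "norm (x - y) \<le> norm (x - m) + norm (y - m)"
        using norm_triangle_ineq4[of "x - m" "y - m"] by simp
      then have "?d \<le> norm (y - m)" using False by linarith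
      then have "cmod (\<phi> (x - m)) * cmod (\<phi> (y - m)) \<le> cmod (\<phi> (x - m)) * (A * ?D)"
        by (intro mult_left_mono far) auto
      also have "\<dots> = A * ?D * cmod (\<phi> (x - m))" by (rule mult.commute)
      also have "\<dots> \<le> A * ?D * (cmod (\<phi> (x - m)) + cmod (\<phi> (y - m)))"
        by (intro mult_left_mono mult_nonneg_nonneg D A(1)) auto
      finally show ?thesis .
    qed
    then have "ennreal (cmod (\<phi> (x - m)) * cmod (\<phi> (y - m)))
        \<le> ennreal (A * ?D) * (phi_abs (x - m) + phi_abs (y - m))" for m
      using ennreal_mult[OF mult_nonneg_nonneg[OF A(1) D], of "cmod (\<phi> (x - m)) + cmod (\<phi> (y - m))"]
      by (simp only: ennreal_plus norm_ge_zero add_nonneg_nonneg) (metis ennreal_leI)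
    then have "abs_kernel x y
      \<le> (\<integral>\<^sup>+m. ennreal (A * ?D) * (phi_abs (x - m) + phi_abs (y - m)) \<partial>lattice_measure)"
      by (intro nn_integral_mono)
    also have "\<dots> = ennreal (A * ?D) * (abs_sum x
        + abs_sum y)"
      by (simp add: nn_integral_cmult nn_integral_add)
    also have "\<dots> \<le> ennreal (A * ?D) * (ennreal S + ennreal S)"
      by (intro mult_left_mono add_mono S) simp
    also have "\<dots> = ennreal ((A * (2 * S)) * ?D)"
    proof -
      have "ennreal S + ennreal S = ennreal (2 * S)"
        using ennreal_plus[OF S(1) S(1)] by (simp only: mult_2)
      moreover have "ennreal (A * ?D) * ennreal (2 * S) = ennreal (A * ?D * (2 * S))"
        using A(1) S(1) by (intro ennreal_mult[symmetric] mult_nonneg_nonneg D) auto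
      moreover have "A * ?D * (2 * S) = A * (2 * S) * ?D" by (simp only: mult.assoc mult.commute[of ?D])
      ultimately show ?thesis by (simp only:)
    qed
    finally show ?thesis .
  qed
  moreover have "0 \<le> A * (2 * S)" using A(1) S(1) by simp
  ultimately show ?thesis by blast
qed

lemma integrable_lattice_kernel:
  "integrable lattice_measure (\<lambda>m. \<phi> (x - m) * cnj (\<phi> (y - m)))"
proof (rule integrableI_bounded)
  obtain C where "C \<ge> 0"
    "\<And>x y. abs_kernel x y
       \<le> ennreal (C * decay_factor 0 x y)"
    using lattice_sum_kernel[of 0] by blast
  from this(2) show "(\<integral>\<^sup>+m. ennreal (cmod (\<phi> (x - m) * cnj (\<phi> (y - m)))) \<partial>lattice_measure) < \<infinity>"
    unfolding norm_mult complex_mod_cnj by (rule le_less_trans) simp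
qed simp

text \<open>Absolute convergence identifies the unconditional sum with an integral over counting
  measure, the form to which Fubini and the norm bounds apply.\<close>

lemma q0_kernel_eq: "q0_kernel \<phi> x y = (LINT m|lattice_measure. \<phi> (x - m) * cnj (\<phi> (y - m)))"
proof -
  have "Infinite_Set_Sum.abs_summable_on (\<lambda>m. \<phi> (x - m) * cnj (\<phi> (y - m))) int_lattice"
    using integrable_lattice_kernel by (simp add: Infinite_Set_Sum.abs_summable_on_def)
  from infsetsum_infsum[OF this] show ?thesis
    by (simp add: q0_kernel_def infsetsum_def)
qed

lemma q0_kernel_bound:
  "\<exists>C\<ge>0. \<forall>x y. cmod (q0_kernel \<phi> x y) \<le> C * decay_factor N x y"
proof -
  obtain C where C: "C \<ge> 0"
    "\<And>x y. abs_kernel x y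
       \<le> ennreal (C * decay_factor N x y)"
    using lattice_sum_kernel[of N] by blast
  have "cmod (q0_kernel \<phi> x y) \<le> C * decay_factor N x y" for x y
    unfolding q0_kernel_eq
    by (rule norm_lattice_integral_le) (use C in \<open>auto simp: norm_mult E_nonneg\<close>)
  with C(1) show ?thesis by blast
qed

lemma q0_kernel_measurable [measurable]:
  assumes [measurable]: "f \<in> borel_measurable M" "g \<in> borel_measurable M"
  shows "(\<lambda>z. q0_kernel \<phi> (f z) (g z)) \<in> borel_measurable M"
proof -
  have [measurable]: "(\<lambda>(z, m). \<phi> (f z - m) * cnj (\<phi> (g z - m))) \<in> borel_measurable (M \<Otimes>\<^sub>M lattice_measure)"
    by (rule measurable_lattice_pair2) simp
  show ?thesis unfolding q0_kernel_eq by measurable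
qed

end

subsection \<open>The integral of the scaling function\<close>

text \<open>Completing the square: with d the Fourier coefficients of f, the squared distance is
  |f|^2 plus the sum of |c i - d i|^2 - |d i|^2. Hence the defect in Bessel's inequality is at most
  the squared distance from f to any combination of the e i.\<close>

lemma finite_projection_bound:
  fixes e :: "'i \<Rightarrow> 'a \<Rightarrow> complex"
  assumes "finite F"
    and ff: "integrable M (\<lambda>x. f x * cnj (f x))"
    and fe: "\<And>i. i \<in> F \<Longrightarrow> integrable M (\<lambda>x. f x * cnj (e i x))"
    and ee: "\<And>i j. i \<in> F \<Longrightarrow> j \<in> F \<Longrightarrow> integrable M (\<lambda>x. e i x * cnj (e j x))"
    and ortho: "\<And>i j. i \<in> F \<Longrightarrow> j \<in> F \<Longrightarrow> (LINT x|M. e i x * cnj (e j x)) = (if i = j then 1 else 0)"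
  shows "(LINT x|M. (cmod (f x))\<^sup>2) - (\<Sum>i\<in>F. (cmod (LINT x|M. f x * cnj (e i x)))\<^sup>2)
    \<le> (LINT x|M. (cmod (f x - (\<Sum>i\<in>F. c i * e i x)))\<^sup>2)"
proof -
  define d where "d i = (LINT x|M. f x * cnj (e i x))" for i
  have sq: "complex_of_real ((cmod z)\<^sup>2) = z * cnj z" for z
    by (rule complex_norm_square)
  have ef: "integrable M (\<lambda>x. e i x * cnj (f x))" "(LINT x|M. e i x * cnj (f x)) = cnj (d i)" if "i \<in> F" for i
  proof -
    have "(\<lambda>x. e i x * cnj (f x)) = (\<lambda>x. cnj (f x * cnj (e i x)))" by (simp add: mult.commute)
    then show "integrable M (\<lambda>x. e i x * cnj (f x))" "(LINT x|M. e i x * cnj (f x)) = cnj (d i)"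
      using fe[OF that] unfolding d_def by (simp_all only: integrable_cnj Bochner_Integration.integral_cnj)
  qed
  have "complex_of_real (LINT x|M. (cmod (f x - (\<Sum>i\<in>F. c i * e i x)))\<^sup>2)
     = (LINT x|M. (f x - (\<Sum>i\<in>F. c i * e i x)) * cnj (f x - (\<Sum>i\<in>F. c i * e i x)))"
    by (simp only: sq flip: integral_complex_of_real)
  also have "\<dots> = (LINT x|M. f x * cnj (f x) - (\<Sum>i\<in>F. cnj (c i) * (f x * cnj (e i x)))
      - (\<Sum>i\<in>F. c i * (e i x * cnj (f x))) + (\<Sum>i\<in>F. \<Sum>j\<in>F. c i * cnj (c j) * (e i x * cnj (e j x))))"
    by (intro Bochner_Integration.integral_cong refl)
       (simp add: algebra_simps sum_product sum_distrib_left sum_distrib_right, rule sum.swap)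
  also have "\<dots> = (LINT x|M. f x * cnj (f x)) - (\<Sum>i\<in>F. cnj (c i) * d i)
      - (\<Sum>i\<in>F. c i * cnj (d i)) + (\<Sum>i\<in>F. \<Sum>j\<in>F. c i * cnj (c j) * (if i = j then 1 else 0))"
  proof (rule has_bochner_integral_integral_eq)
    have "has_bochner_integral M (\<lambda>x. e i x * cnj (e j x)) (if i = j then 1 else 0)"
      if "i \<in> F" "j \<in> F" for i j
      using ee[OF that] ortho[OF that] by (simp add: has_bochner_integral_iff)
    moreover have "has_bochner_integral M (\<lambda>x. f x * cnj (e i x)) (d i)"
      "has_bochner_integral M (\<lambda>x. e i x * cnj (f x)) (cnj (d i))" if "i \<in> F" for i
      using fe[OF that] ef[OF that] by (simp_all add: has_bochner_integral_iff d_def)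
    ultimately show "has_bochner_integral M (\<lambda>x. f x * cnj (f x) - (\<Sum>i\<in>F. cnj (c i) * (f x * cnj (e i x)))
      - (\<Sum>i\<in>F. c i * (e i x * cnj (f x))) + (\<Sum>i\<in>F. \<Sum>j\<in>F. c i * cnj (c j) * (e i x * cnj (e j x))))
      ((LINT x|M. f x * cnj (f x)) - (\<Sum>i\<in>F. cnj (c i) * d i)
      - (\<Sum>i\<in>F. c i * cnj (d i)) + (\<Sum>i\<in>F. \<Sum>j\<in>F. c i * cnj (c j) * (if i = j then 1 else 0)))"
      by (intro has_bochner_integral_add has_bochner_integral_diff has_bochner_integral_sum
          has_bochner_integral_mult_right has_bochner_integral_integrable ff)
  qed
  also have "\<dots> = (LINT x|M. f x * cnj (f x)) + (\<Sum>i\<in>F. (c i - d i) * cnj (c i - d i) - d i * cnj (d i))"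
    using \<open>finite F\<close> by (simp add: algebra_simps sum.distrib sum_subtractf if_distrib cong: if_cong)
  also have "\<dots> = complex_of_real ((LINT x|M. (cmod (f x))\<^sup>2) + (\<Sum>i\<in>F. (cmod (c i - d i))\<^sup>2 - (cmod (d i))\<^sup>2))"
    by (simp only: sq of_real_add of_real_sum of_real_diff flip: integral_complex_of_real)
  finally have "(LINT x|M. (cmod (f x - (\<Sum>i\<in>F. c i * e i x)))\<^sup>2) =
      (LINT x|M. (cmod (f x))\<^sup>2) + (\<Sum>i\<in>F. (cmod (c i - d i))\<^sup>2 - (cmod (d i))\<^sup>2)"
    by (simp only: of_real_eq_iff)
  moreover have "(\<Sum>i\<in>F. - (cmod (d i))\<^sup>2) \<le> (\<Sum>i\<in>F. (cmod (c i - d i))\<^sup>2 - (cmod (d i))\<^sup>2)"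
    by (intro sum_mono) simp
  ultimately show ?thesis unfolding d_def by (simp add: sum_negf)
qed

lemma L2_space_scale:
  fixes f :: "real^'n \<Rightarrow> complex"
  assumes f: "f \<in> L2_space" and c: "c \<noteq> 0"
  shows "(\<lambda>x. f (c *\<^sub>R x)) \<in> L2_space"
    and "(LINT x|lborel. (cmod (f x))\<^sup>2) = \<bar>c\<bar> ^ CARD('n) * (LINT x|lborel. (cmod (f (c *\<^sub>R x)))\<^sup>2)"
proof -
  have [measurable]: "f \<in> borel_measurable borel" using f by (simp add: L2_space_def)
  have "integrable lborel (\<lambda>x. (cmod (f x))\<^sup>2)" using f by (simp add: L2_space_def)
  from integrable_lborel_affine[OF this c, of 0] show "(\<lambda>x. f (c *\<^sub>R x)) \<in> L2_space"
    by (simp add: L2_space_def)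
  show "(LINT x|lborel. (cmod (f x))\<^sup>2) = \<bar>c\<bar> ^ CARD('n) * (LINT x|lborel. (cmod (f (c *\<^sub>R x)))\<^sup>2)"
    using integral_lborel_affine[of "\<lambda>x. (cmod (f x))\<^sup>2" c 0] c by simp
qed

text \<open>From |a + b|^2 \<le> 2|a|^2 + 2|b|^2. It replaces the triangle inequality and avoids
  square roots; the factor 2 is absorbed in the choice of the errors.\<close>

lemma L2_diff_square:
  fixes f g h :: "real^'n \<Rightarrow> complex"
  assumes "(\<lambda>x. f x - g x) \<in> L2_space" "(\<lambda>x. g x - h x) \<in> L2_space"
  shows "(LINT x|lborel. (cmod (f x - h x))\<^sup>2)
    \<le> 2 * (LINT x|lborel. (cmod (f x - g x))\<^sup>2) + 2 * (LINT x|lborel. (cmod (g x - h x))\<^sup>2)"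
proof -
  have i: "integrable lborel (\<lambda>x. (cmod (f x - g x))\<^sup>2)" "integrable lborel (\<lambda>x. (cmod (g x - h x))\<^sup>2)"
    using assms by (auto simp: L2_space_def)
  have "(LINT x|lborel. (cmod (f x - h x))\<^sup>2) \<le>
    (LINT x|lborel. 2 * (cmod (f x - g x))\<^sup>2 + 2 * (cmod (g x - h x))\<^sup>2)"
  proof (rule integral_mono_AE', goal_cases)
    case 1
    show ?case using i by auto
  next
    case 2
    show ?case
    proof (rule AE_I2)
      fix x
      have "cmod (f x - h x) \<le> cmod (f x - g x) + cmod (g x - h x)"
        using norm_triangle_ineq[of "f x - g x" "g x - h x"] by simp
      then have "(cmod (f x - h x))\<^sup>2 \<le> (cmod (f x - g x) + cmod (g x - h x))\<^sup>2"
        by (intro power_mono) auto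
      also have "\<dots> \<le> 2 * (cmod (f x - g x))\<^sup>2 + 2 * (cmod (g x - h x))\<^sup>2"
        using zero_le_power2[of "cmod (f x - g x) - cmod (g x - h x)"]
        by (simp add: power2_eq_square algebra_simps)
      finally show "(cmod (f x - h x))\<^sup>2 \<le> 2 * (cmod (f x - g x))\<^sup>2 + 2 * (cmod (g x - h x))\<^sup>2" .
    qed
  qed auto
  then show ?thesis using i by simp
qed

lemma MRA_scale:
  assumes "MRA V" "f \<in> L2_space"
  shows "f \<in> V 0 \<longleftrightarrow> (\<lambda>x. f (2 ^ j *\<^sub>R x)) \<in> V (int j)"
proof (induction j)
  case (Suc j)
  have "(\<lambda>x. f (2 ^ j *\<^sub>R x)) \<in> L2_space"
    using assms(2) by (rule L2_space_scale) simp
  then have "(\<lambda>x. f (2 ^ j *\<^sub>R x)) \<in> V (int j) \<longleftrightarrow> (\<lambda>x. f (2 ^ j *\<^sub>R 2 *\<^sub>R x)) \<in> V (int j + 1)"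
    using \<open>MRA V\<close> by (simp add: MRA_def)
  with Suc show ?case by (simp add: mult.commute add.commute)
qed simp

lemma MRA_mono:
  assumes "MRA V" "i \<le> j" shows "V i \<subseteq> V j"
  using assms(2)
proof (induction rule: int_ge_induct)
  case (step k)
  then show ?case using \<open>MRA V\<close> by (auto simp: MRA_def)
qed simp

section \<open>Large cubes and integrals of periodic functions over them\<close>

definition cell :: "real \<Rightarrow> (real^'n) set" where
  "cell N = {x. \<forall>i. 0 \<le> x $ i \<and> x $ i < N}"

lemma cell_borel [measurable]: "cell N \<in> sets borel"
  unfolding cell_def by measurable

lemma mem_cell_scale:
  "N > 0 \<Longrightarrow> N *\<^sub>R x \<in> cell N \<longleftrightarrow> x \<in> unit_cell"
  by (simp add: cell_def unit_cell_def zero_le_mult_iff mult_less_cancel_left1 not_less)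

lemma indicator_cell_scale:
  assumes "N > 0"
  shows "indicator (cell N) (N *\<^sub>R x) = indicator unit_cell x"
  by (simp add: indicator_def mem_cell_scale[OF assms])

lemma emeasure_cell:
  assumes "N > 0"
  shows "emeasure lborel (cell N :: (real^'n) set) = ennreal (N ^ CARD('n))"
proof -
  have "emeasure lborel (cell N :: (real^'n) set) = (\<integral>\<^sup>+x. indicator (cell N) (x::real^'n) \<partial>lborel)"
    by simp
  also have "\<dots> = ennreal (N ^ CARD('n)) * (\<integral>\<^sup>+x. indicator unit_cell (x::real^'n) \<partial>lborel)"
    using nn_integral_lborel_affine[of "indicator (cell N) :: real^'n \<Rightarrow> ennreal" N 0] assms
    by (simp add: indicator_cell_scale del: nn_integral_indicator)
  finally show ?thesis by (simp add: emeasure_unit_cell)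
qed

lemma measure_cell:
  "N > 0 \<Longrightarrow> measure lborel (cell N :: (real^'n) set) = N ^ CARD('n)"
  by (simp add: measure_def emeasure_cell)

lemma integrable_indicator_cell: "N > 0 \<Longrightarrow> integrable lborel (indicator (cell N) :: real^'n \<Rightarrow> real)"
  using emeasure_cell[of N, where 'n='n] by (intro integrable_real_indicator) auto

text \<open>The side is an integer and both cubes are half-open, so the condition depends on m alone
  and not on the position of x in the unit cell. Hence the number of admissible m in
  \<open>integral_cell_periodic\<close> is a constant.\<close>

lemma cell_lattice_translate:
  fixes N :: nat
  assumes "x \<in> unit_cell" "m \<in> int_lattice"
  shows "x - m \<in> cell (real N) \<longleftrightarrow> (\<forall>i. - real N < m $ i \<and> m $ i \<le> 0)"
proof -
  have "(0 \<le> x $ i - m $ i \<and> x $ i - m $ i < real N) \<longleftrightarrow> (- real N < m $ i \<and> m $ i \<le> 0)" for i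
  proof -
    obtain z where z: "m $ i = of_int z"
      using assms(2) by (auto simp: int_lattice_def elim: Ints_cases)
    have "0 \<le> x $ i" "x $ i < 1" using assms(1) by (auto simp: unit_cell_def)
    moreover have "real_of_int z < 1 \<longleftrightarrow> z \<le> 0" "- real N < real_of_int z \<longleftrightarrow> 1 - int N \<le> z"
      by linarith+
    moreover have "1 - int N \<le> z \<longleftrightarrow> 1 - real N \<le> real_of_int z" by linarith
    ultimately show ?thesis unfolding z by auto
  qed
  then show ?thesis by (simp add: cell_def)
qed

text \<open>The number of translates of the unit cell in \<open>cell N\<close> is not computed: it is the same
  for every periodic function, so it is read off the constant function \<open>1\<close>.\<close>

lemma integral_cell_periodic:
  fixes p :: "real^'n \<Rightarrow> complex" and N :: nat
  assumes [measurable]: "p \<in> borel_measurable borel"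
    and bounded: "\<And>x. cmod (p x) \<le> C"
    and periodic: "\<And>x m. m \<in> int_lattice \<Longrightarrow> p (x - m) = p x"
    and N: "N > 0"
  shows "(LINT x|lborel. indicator (cell (real N)) x *\<^sub>R p x) =
     of_nat (N ^ CARD('n)) * (LINT x|lborel. indicator unit_cell x *\<^sub>R p x)"
proof -
  define K where "K = (LINT m|(lattice_measure :: (real^'n) measure). indicator {m. \<forall>i. - real N < m $ i \<and> m $ i \<le> 0} m :: real)"
  have *: "(LINT x|lborel. indicator (cell (real N)) x *\<^sub>R p x) = complex_of_real K * (LINT x|lborel. indicator unit_cell x *\<^sub>R p x)"
    if [measurable]: "p \<in> borel_measurable borel" and bounded: "\<And>x. cmod (p x) \<le> C"
      and periodic: "\<And>x m. m \<in> int_lattice \<Longrightarrow> p (x - m) = p x" for p :: "real^'n \<Rightarrow> complex" and C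
  proof -
    have "integrable lborel (\<lambda>x. indicator (cell (real N)) x *\<^sub>R p x)"
      by (rule Bochner_Integration.integrable_bound[OF integrable_mult_left[OF integrable_indicator_cell[of "real N"], of C]])
         (use N bounded in \<open>auto simp: indicator_def intro: order_trans[OF _ abs_ge_self]\<close>)
    then have "(LINT x|lborel. indicator (cell (real N)) x *\<^sub>R p x) = (LINT x|lborel. indicator unit_cell x *\<^sub>R
        (LINT m|lattice_measure. indicator (cell (real N)) (x - m) *\<^sub>R p (x - m)))"
      by (rule integral_tiling)
    also have "\<dots> = (LINT x|lborel. complex_of_real K * (indicator unit_cell x *\<^sub>R p x))"
    proof (rule Bochner_Integration.integral_cong[OF refl])
      fix x :: "real^'n"
      have "(LINT m|lattice_measure. indicator (cell (real N)) (x - m) *\<^sub>R p (x - m)) = complex_of_real K * p x"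
        if "x \<in> unit_cell"
      proof -
        have "(LINT m|lattice_measure. indicator (cell (real N)) (x - m) *\<^sub>R p (x - m)) =
          (LINT m|lattice_measure. complex_of_real (indicator {m::real^'n. \<forall>i. - real N < m $ i \<and> m $ i \<le> 0} m) * p x)"
          using cell_lattice_translate[OF that, of _ N]
          by (intro Bochner_Integration.integral_cong) (auto simp: periodic indicator_def)
        then show ?thesis by (simp add: K_def)
      qed
      then show "indicator unit_cell x *\<^sub>R (LINT m|lattice_measure. indicator (cell (real N)) (x - m) *\<^sub>R p (x - m))
         = complex_of_real K * (indicator unit_cell x *\<^sub>R p x)"
        by (cases "x \<in> unit_cell") auto
    qed
    finally show ?thesis by (simp only: integral_mult_right_zero)
  qed
  have "complex_of_real (real N ^ CARD('n)) = complex_of_real K"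
  proof -
    have "measure lborel (cell (real N) :: (real^'n) set) = real N ^ CARD('n)"
      using N by (simp add: measure_cell)
    moreover have "measure lborel (unit_cell :: (real^'n) set) = 1"
      by (simp add: measure_def emeasure_unit_cell)
    ultimately show ?thesis
      using *[of "\<lambda>_. 1" 1] by (simp add: scaleR_conv_of_real)
  qed
  then have "complex_of_real K = of_nat (N ^ CARD('n))"
    by (metis of_nat_power of_real_of_nat_eq)
  with *[OF assms(1) bounded periodic] show ?thesis by simp
qed

lemma L2_space_add:
  fixes f g :: "real^'n \<Rightarrow> complex"
  assumes f: "f \<in> L2_space" and g: "g \<in> L2_space"
  shows "(\<lambda>x. f x + g x) \<in> L2_space"
proof -
  have [measurable]: "f \<in> borel_measurable borel" "g \<in> borel_measurable borel"
    using f g by (simp_all add: L2_space_def)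
  have int: "integrable lborel (\<lambda>x. 2 * (cmod (f x))\<^sup>2 + 2 * (cmod (g x))\<^sup>2)"
    using f g by (simp add: L2_space_def)
  have bound: "(cmod (f x + g x))\<^sup>2 \<le> 2 * (cmod (f x))\<^sup>2 + 2 * (cmod (g x))\<^sup>2" for x
  proof -
    have "(cmod (f x + g x))\<^sup>2 \<le> (cmod (f x) + cmod (g x))\<^sup>2"
      by (intro power_mono norm_triangle_ineq) auto
    also have "\<dots> \<le> 2 * (cmod (f x))\<^sup>2 + 2 * (cmod (g x))\<^sup>2"
      using zero_le_power2[of "cmod (f x) - cmod (g x)"]
      by (simp add: power2_eq_square algebra_simps)
    finally show ?thesis .
  qed
  have "integrable lborel (\<lambda>x. (cmod (f x + g x))\<^sup>2)"
    by (rule Bochner_Integration.integrable_bound[OF int])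
       (use bound in \<open>auto intro!: order_trans[OF _ abs_ge_self]\<close>)
  then show ?thesis by (simp add: L2_space_def)
qed

lemma L2_space_cmult:
  "f \<in> L2_space \<Longrightarrow> (\<lambda>x. c * f x) \<in> L2_space"
  by (auto simp: L2_space_def norm_mult power_mult_distrib)

lemma L2_space_diff:
  "f \<in> L2_space \<Longrightarrow> g \<in> L2_space \<Longrightarrow> (\<lambda>x. f x - g x) \<in> L2_space"
  using L2_space_add[of f "\<lambda>x. - 1 * g x"] L2_space_cmult[of g "- 1"] by simp

lemma L2_space_translate:
  "f \<in> L2_space \<Longrightarrow> (\<lambda>x. f (x - m)) \<in> L2_space"
  using integrable_lborel_translate[of "\<lambda>x. (cmod (f x))\<^sup>2" m] by (auto simp: L2_space_def)

lemma L2_space_sum: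
  "(\<And>i. i \<in> F \<Longrightarrow> f i \<in> L2_space) \<Longrightarrow> (\<lambda>x. \<Sum>i\<in>F. f i x) \<in> L2_space"
  by (induction F rule: infinite_finite_induct) (auto simp: L2_space_def intro!: L2_space_add[unfolded L2_space_def, simplified])

lemma L2_norm_less:
  assumes "L2_norm f < sqrt e" shows "(LINT x|lborel. (cmod (f x))\<^sup>2) < e"
  using assms by (simp add: L2_norm_def)

text \<open>The integrable profile that dominates the kernel, up to a constant, once
  \<open>E\<close> is bounded by 1. The half is the one in \<open>decay_factor\<close>.\<close>

definition tail_kernel :: "real^'n \<Rightarrow> real" where
  "tail_kernel z = 1 / (1 + norm z / 2) ^ (CARD('n) + 1)"

lemma tail_kernel_measurable [measurable]: "tail_kernel \<in> borel_measurable borel"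
  unfolding tail_kernel_def by measurable

lemma tail_kernel_nonneg: "0 \<le> tail_kernel z"
  by (simp add: tail_kernel_def)

lemma integrable_tail_kernel: "integrable lborel (tail_kernel :: real^'n \<Rightarrow> real)"
  using integrable_lborel_affine[OF integrable_inverse_norm_power[where 'a="real^'n"], of "1/2" 0]
  by (simp add: tail_kernel_def[abs_def])

text \<open>The interaction of the cube of side N with its complement through the tail kernel,
  divided by the volume of the cube and rescaled to the unit cell. The type argument carries the
  dimension, which N does not determine.\<close>

definition cell_leak :: "'n::finite itself \<Rightarrow> real \<Rightarrow> ennreal" where
  "cell_leak _ N = (\<integral>\<^sup>+x. indicator unit_cell x *
     (\<integral>\<^sup>+z. indicator (- unit_cell) (x - (1 / N) *\<^sub>R z) * ennreal (tail_kernel (z::real^'n)) \<partial>lborel) \<partial>lborel)"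

lemma cell_leak_eq:
  assumes N: "N > 0"
  shows "(\<integral>\<^sup>+x. indicator (cell N) x * (\<integral>\<^sup>+y. indicator (- cell N) y * ennreal (tail_kernel (x - y :: real^'n)) \<partial>lborel) \<partial>lborel)
    = ennreal (N ^ CARD('n)) * cell_leak TYPE('n) N"
proof -
  have "(\<integral>\<^sup>+y. indicator (- cell N) y * ennreal (tail_kernel (x - y)) \<partial>lborel) =
    (\<integral>\<^sup>+z. indicator (- cell N) (x - z) * ennreal (tail_kernel z) \<partial>lborel)" for x :: "real^'n"
    by (subst nn_integral_lborel_affine[of _ "-1" x]) auto
  then have "(\<integral>\<^sup>+x. indicator (cell N) x * (\<integral>\<^sup>+y. indicator (- cell N) y * ennreal (tail_kernel (x - y :: real^'n)) \<partial>lborel) \<partial>lborel)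
    = (\<integral>\<^sup>+x. indicator (cell N) x * (\<integral>\<^sup>+z. indicator (- cell N) (x - z) * ennreal (tail_kernel (z::real^'n)) \<partial>lborel) \<partial>lborel)"
    by simp
  also have "\<dots> = ennreal (N ^ CARD('n)) * (\<integral>\<^sup>+x. indicator (cell N) (N *\<^sub>R x) *
      (\<integral>\<^sup>+z. indicator (- cell N) (N *\<^sub>R x - z) * ennreal (tail_kernel (z::real^'n)) \<partial>lborel) \<partial>lborel)"
    using N by (subst nn_integral_lborel_affine[of _ N 0]) auto
  also have "(\<integral>\<^sup>+x. indicator (cell N) (N *\<^sub>R x) *
      (\<integral>\<^sup>+z. indicator (- cell N) (N *\<^sub>R x - z) * ennreal (tail_kernel (z::real^'n)) \<partial>lborel) \<partial>lborel) = cell_leak TYPE('n) N"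
  proof -
    have "indicator (- cell N) (N *\<^sub>R x - z) = (indicator (- unit_cell) (x - (1 / N) *\<^sub>R z) :: ennreal)" for x z :: "real^'n"
    proof -
      have "N *\<^sub>R x - z = N *\<^sub>R (x - (1 / N) *\<^sub>R z)"
        using N by (simp add: algebra_simps)
      then show ?thesis
        by (simp add: indicator_def mem_cell_scale[OF N] del: scaleR_left_diff_distrib scaleR_right_diff_distrib)
    qed
    then show ?thesis
      unfolding cell_leak_def by (simp add: indicator_cell_scale[OF N])
  qed
  finally show ?thesis .
qed

text \<open>Surface against volume: for x inside the open cube and z fixed, x - z / 2^j eventually
  stays in the cube, so the inner integrand vanishes. Dominated convergence applies first in z, then
  in x. Powers of two are the dilations available in the multiresolution analysis.\<close>

lemma cell_leak_tendsto: "(\<lambda>j. cell_leak TYPE('n::finite) (2 ^ j)) \<longlonglongrightarrow> 0"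
proof -
  define h where "h j x = (\<integral>\<^sup>+z. indicator (- unit_cell) (x - (1 / 2 ^ j) *\<^sub>R z) * ennreal (tail_kernel (z::real^'n)) \<partial>lborel)"
    for j :: nat and x :: "real^'n"
  have h_meas [measurable]: "h j \<in> borel_measurable borel" for j
    unfolding h_def by measurable
  have fin: "(\<integral>\<^sup>+z. ennreal (tail_kernel (z::real^'n)) \<partial>lborel) < \<infinity>"
    using integrable_tail_kernel[where 'n='n] by (simp add: integrable_iff_bounded tail_kernel_nonneg)
  have h_le: "h j x \<le> (\<integral>\<^sup>+z. ennreal (tail_kernel (z::real^'n)) \<partial>lborel)" for j x
    unfolding h_def by (intro nn_integral_mono) (auto simp: indicator_def)
  have h_lim: "(\<lambda>j. h j x) \<longlonglongrightarrow> 0" if x: "x \<in> box 0 1" for x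
  proof -
    have "(\<lambda>j. h j x) \<longlonglongrightarrow> (\<integral>\<^sup>+(z::real^'n). 0 \<partial>lborel)"
      unfolding h_def
    proof (rule nn_integral_dominated_convergence)
      show "AE z in lborel. (\<lambda>j. indicator (- unit_cell) (x - (1 / 2 ^ j) *\<^sub>R z) * ennreal (tail_kernel (z::real^'n))) \<longlonglongrightarrow> 0"
      proof (rule AE_I2)
        fix z :: "real^'n"
        have "(\<lambda>j. x - (1 / 2 ^ j) *\<^sub>R z) \<longlonglongrightarrow> x - 0 *\<^sub>R z"
          by (intro tendsto_intros) (use LIMSEQ_inverse_realpow_zero[of 2] in \<open>simp add: inverse_eq_divide\<close>)
        then have "\<forall>\<^sub>F j in sequentially. x - (1 / 2 ^ j) *\<^sub>R z \<in> box 0 1"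
          using x by (intro topological_tendstoD) (auto simp: open_box)
        then have "\<forall>\<^sub>F j in sequentially. indicator (- unit_cell) (x - (1 / 2 ^ j) *\<^sub>R z) * ennreal (tail_kernel z) = 0"
          by eventually_elim (auto simp: unit_cell_def mem_box_cart less_imp_le)
        then show "(\<lambda>j. indicator (- unit_cell) (x - (1 / 2 ^ j) *\<^sub>R z) * ennreal (tail_kernel z)) \<longlonglongrightarrow> 0"
          by (rule tendsto_eventually)
      qed
      show "AE z in lborel. indicator (- unit_cell) (x - (1 / 2 ^ j) *\<^sub>R z) * ennreal (tail_kernel z) \<le> ennreal (tail_kernel z)" for j
        by (rule AE_I2) (auto simp: indicator_def)
    qed (use fin in auto)
    then show ?thesis by simp
  qed
  have "(\<lambda>j. \<integral>\<^sup>+x. indicator unit_cell x * h j x \<partial>lborel) \<longlonglongrightarrow> (\<integral>\<^sup>+(x::real^'n). 0 \<partial>lborel)"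
  proof (rule nn_integral_dominated_convergence)
    show "AE x in lborel. (\<lambda>j. indicator unit_cell x * h j x) \<longlonglongrightarrow> 0"
      using AE_unit_cell_box
    proof eventually_elim
      case (elim x)
      show ?case
        using h_lim[of x] elim by (cases "x \<in> unit_cell") auto
    qed
    show "AE x in lborel. indicator unit_cell x * h j x \<le>
      indicator unit_cell x * (\<integral>\<^sup>+z. ennreal (tail_kernel (z::real^'n)) \<partial>lborel)" for j
      using h_le by (intro AE_I2) (auto simp: indicator_def)
    show "(\<integral>\<^sup>+x. indicator unit_cell (x::real^'n) * (\<integral>\<^sup>+z. ennreal (tail_kernel (z::real^'n)) \<partial>lborel) \<partial>lborel) < \<infinity>"
      using fin by (simp add: nn_integral_multc emeasure_unit_cell)
  qed auto
  then show ?thesis unfolding cell_leak_def h_def by simp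
qed

section \<open>Lattice coefficients of indicators of large cubes\<close>

context rapidly_decreasing begin

lemma phi_bounded: "\<exists>C\<ge>0. \<forall>x. cmod (\<phi> x) \<le> C"
  using decay_bound'[of 0] by (metis div_by_1 power_0)

lemma integrable_bounded_mult_phi:
  fixes g :: "real^'n \<Rightarrow> complex"
  assumes [measurable]: "g \<in> borel_measurable borel" and "\<And>x. cmod (g x) \<le> C"
  shows "integrable lborel (\<lambda>x. g x * \<phi> (x - m))"
proof (rule Bochner_Integration.integrable_bound)
  show "integrable lborel (\<lambda>x. complex_of_real C * \<phi> (x - m))"
    by (intro integrable_mult_right integrable_lborel_translate integrable_phi)
  have "C \<ge> 0" using assms(2)[of undefined] norm_ge_zero order_trans by blast
  then show "AE x in lborel. cmod (g x * \<phi> (x - m)) \<le> cmod (complex_of_real C * \<phi> (x - m))"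
    by (intro AE_I2) (simp add: norm_mult mult_right_mono assms(2))
qed measurable

lemma integrable_bounded_mult_phi_cnj:
  fixes g :: "real^'n \<Rightarrow> complex"
  assumes [measurable]: "g \<in> borel_measurable borel" and "\<And>x. cmod (g x) \<le> C"
  shows "integrable lborel (\<lambda>x. g x * cnj (\<phi> (x - m)))"
proof -
  have "integrable lborel (\<lambda>x. cnj (g x) * \<phi> (x - m))"
    using assms(2) by (intro integrable_bounded_mult_phi) auto
  then have "integrable lborel (\<lambda>x. cnj (cnj (g x) * \<phi> (x - m)))"
    by (simp only: integrable_cnj)
  then show ?thesis by simp
qed

text \<open>By Tonelli the lattice sum moves inside both integrals, where it becomes
  \<open>abs_kernel\<close>. Taking for A a large cube and for B its complement bounds the products
  of their coefficients by the leak through the boundary.\<close>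

lemma lattice_sum_split_kernel:
  "\<exists>C\<ge>0. \<forall>A\<in>sets borel. \<forall>B\<in>sets borel.
    (\<integral>\<^sup>+m. (\<integral>\<^sup>+x. indicator A x * phi_abs (x - m) \<partial>lborel)
        * (\<integral>\<^sup>+y. indicator B y * phi_abs (y - m) \<partial>lborel) \<partial>lattice_measure)
    \<le> ennreal C * (\<integral>\<^sup>+x. indicator A x * (\<integral>\<^sup>+y. indicator B y * ennreal (tail_kernel (x - y)) \<partial>lborel) \<partial>lborel)"
proof -
  obtain C where C: "C \<ge> 0"
    "\<And>x y. abs_kernel x y
       \<le> ennreal (C * decay_factor (CARD('n) + 1) x y)"
    using lattice_sum_kernel[of "CARD('n) + 1"] by blast
  have C': "(\<integral>\<^sup>+m. phi_abs (x - m) * phi_abs (y - m) \<partial>lattice_measure)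
      \<le> ennreal C * ennreal (tail_kernel (x - y))" for x y
  proof -
    have "E (norm (x - y) / 2) / (1 + norm (x - y) / 2) ^ (CARD('n) + 1) \<le> tail_kernel (x - y)"
      unfolding tail_kernel_def by (intro divide_right_mono E_le_1) auto
    then have "C * decay_factor (CARD('n) + 1) x y \<le> C * tail_kernel (x - y)"
      using C(1) by (rule mult_left_mono)
    from order_trans[OF C(2) ennreal_leI[OF this]] C(1) show ?thesis
      by (simp add: ennreal_mult tail_kernel_nonneg)
  qed
  have "(\<integral>\<^sup>+m. (\<integral>\<^sup>+x. indicator A x * phi_abs (x - m) \<partial>lborel)
        * (\<integral>\<^sup>+y. indicator B y * phi_abs (y - m) \<partial>lborel) \<partial>lattice_measure)
    \<le> ennreal C * (\<integral>\<^sup>+x. indicator A x * (\<integral>\<^sup>+y. indicator B y * ennreal (tail_kernel (x - y)) \<partial>lborel) \<partial>lborel)"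
    if [measurable]: "A \<in> sets borel" "B \<in> sets borel" for A B
  proof -
    have [measurable]: "(\<lambda>(m, x). indicator A x * phi_abs (x - m) *
        (\<integral>\<^sup>+y. indicator B y * phi_abs (y - m) \<partial>lborel)) \<in> borel_measurable (lattice_measure \<Otimes>\<^sub>M lborel)"
      by (rule measurable_lattice_pair) measurable
    have [measurable]: "(\<lambda>(m, y). indicator A x * (indicator B y * (phi_abs (x - m) * phi_abs (y - m))))
        \<in> borel_measurable (lattice_measure \<Otimes>\<^sub>M lborel)" for x
      by (rule measurable_lattice_pair) measurable
    have "(\<integral>\<^sup>+m. (\<integral>\<^sup>+x. indicator A x * phi_abs (x - m) \<partial>lborel)
        * (\<integral>\<^sup>+y. indicator B y * phi_abs (y - m) \<partial>lborel) \<partial>lattice_measure)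
      = (\<integral>\<^sup>+m. (\<integral>\<^sup>+x. indicator A x * phi_abs (x - m) *
        (\<integral>\<^sup>+y. indicator B y * phi_abs (y - m) \<partial>lborel) \<partial>lborel) \<partial>lattice_measure)"
      by (simp add: nn_integral_multc)
    also have "\<dots> = (\<integral>\<^sup>+x. (\<integral>\<^sup>+m. indicator A x * phi_abs (x - m) *
        (\<integral>\<^sup>+y. indicator B y * phi_abs (y - m) \<partial>lborel) \<partial>lattice_measure) \<partial>lborel)"
      by (rule lattice_lborel.Fubini'[symmetric]) measurable
    also have "\<dots> = (\<integral>\<^sup>+x. (\<integral>\<^sup>+m. (\<integral>\<^sup>+y. indicator A x * (indicator B y *
        (phi_abs (x - m) * phi_abs (y - m))) \<partial>lborel) \<partial>lattice_measure) \<partial>lborel)"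
      by (intro nn_integral_cong) (simp add: nn_integral_cmult[symmetric] mult_ac)
    also have "\<dots> = (\<integral>\<^sup>+x. (\<integral>\<^sup>+y. (\<integral>\<^sup>+m. indicator A x * (indicator B y *
        (phi_abs (x - m) * phi_abs (y - m))) \<partial>lattice_measure) \<partial>lborel) \<partial>lborel)"
      by (intro nn_integral_cong lattice_lborel.Fubini'[symmetric]) measurable
    also have "\<dots> = (\<integral>\<^sup>+x. (\<integral>\<^sup>+y. indicator A x * (indicator B y *
        (\<integral>\<^sup>+m. phi_abs (x - m) * phi_abs (y - m) \<partial>lattice_measure)) \<partial>lborel) \<partial>lborel)"
      by (simp add: nn_integral_cmult)
    also have "\<dots> \<le> (\<integral>\<^sup>+x. (\<integral>\<^sup>+y. indicator A x * (indicator B y * (ennreal C * ennreal (tail_kernel (x - y)))) \<partial>lborel) \<partial>lborel)"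
      by (intro nn_integral_mono mult_left_mono C') auto
    also have "\<dots> = (\<integral>\<^sup>+x. ennreal C * (indicator A x * (\<integral>\<^sup>+y. indicator B y * ennreal (tail_kernel (x - y)) \<partial>lborel)) \<partial>lborel)"
      by (intro nn_integral_cong) (simp add: nn_integral_cmult[symmetric] mult_ac)
    also have "\<dots> = ennreal C * (\<integral>\<^sup>+x. indicator A x * (\<integral>\<^sup>+y. indicator B y * ennreal (tail_kernel (x - y)) \<partial>lborel) \<partial>lborel)"
      by (rule nn_integral_cmult) measurable
    finally show ?thesis .
  qed
  with C(1) show ?thesis by blast
qed

end

context rapidly_decreasing begin

abbreviation mean :: complex where
  "mean \<equiv> LINT x|lborel. \<phi> x"

lemma integrable_pair_bounded:
  fixes g :: "real^'n \<Rightarrow> complex"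
  assumes g: "integrable lborel g"
  shows "integrable (lattice_measure \<Otimes>\<^sub>M lborel) (\<lambda>(m, x). g x * \<phi> (x - m))"
proof -
  have [measurable]: "g \<in> borel_measurable borel"
    using borel_measurable_integrable[OF g] by simp
  have meas [measurable]: "(\<lambda>(m, x). g x * \<phi> (x - m)) \<in> borel_measurable (lattice_measure \<Otimes>\<^sub>M lborel)"
    by (rule measurable_lattice_pair) measurable
  obtain S where S: "S \<ge> 0" "\<And>x. abs_sum x \<le> ennreal S"
    using lattice_sum_phi by blast
  have "(\<integral>\<^sup>+z. ennreal (cmod (case z of (m, x) \<Rightarrow> g x * \<phi> (x - m))) \<partial>(lattice_measure \<Otimes>\<^sub>M lborel))
     = (\<integral>\<^sup>+x. (\<integral>\<^sup>+m. ennreal (cmod (g x)) * phi_abs (x - m) \<partial>lattice_measure) \<partial>lborel)"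
    by (subst lattice_lborel.nn_integral_snd[symmetric])
       (auto intro!: nn_integral_cong simp: norm_mult ennreal_mult)
  also have "\<dots> \<le> (\<integral>\<^sup>+x. ennreal (cmod (g x)) * ennreal S \<partial>lborel)"
    by (intro nn_integral_mono) (auto simp: nn_integral_cmult intro!: mult_left_mono S)
  also have "\<dots> < \<infinity>"
    using g by (simp add: nn_integral_multc integrable_iff_bounded ennreal_mult_less_top)
  finally show ?thesis
    by (intro integrableI_bounded) auto
qed

text \<open>The uniform bound on \<open>abs_sum\<close> justifies Fubini. For g the indicator of a
  cube, the left-hand side is the sum of all its coefficients, and periodicity makes the right-hand
  side computable.\<close>

lemma lattice_integral_swap:
  fixes g :: "real^'n \<Rightarrow> complex"
  assumes g: "integrable lborel g"
  shows "integrable lattice_measure (\<lambda>m. LINT x|lborel. g x * \<phi> (x - m))"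
    and "(LINT m|lattice_measure. LINT x|lborel. g x * \<phi> (x - m)) = (LINT x|lborel. g x * periodization x)"
proof -
  show "integrable lattice_measure (\<lambda>m. LINT x|lborel. g x * \<phi> (x - m))"
    using lattice_lborel.integrable_fst[OF integrable_pair_bounded[OF g]] by simp
  show "(LINT m|lattice_measure. LINT x|lborel. g x * \<phi> (x - m)) = (LINT x|lborel. g x * periodization x)"
    using lattice_lborel.Fubini_integral[OF integrable_pair_bounded[OF g]]
    by (simp add: periodization_def)
qed

lemma cell_integral_periodization:
  "(LINT x|lborel. indicator unit_cell x *\<^sub>R periodization x) = mean"
  unfolding periodization_def by (rule integral_tiling(1)[symmetric, OF integrable_phi])

text \<open>Let \<open>u m\<close> be the coefficient over the large cell and \<open>e m\<close> the one over its complement. Since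
  \<open>u m + e m = mean\<close>, the main part of \<open>\<Sum> (cmod (u m))\<^sup>2\<close> is \<open>Re (cnj mean * \<Sum> u m)\<close>, and the error
  \<open>\<Sum> cmod (u m) * cmod (e m)\<close> is what the kernel carries across the boundary of the cell.\<close>

lemma sum_coefficients_le:
  "\<exists>C\<ge>0. \<forall>N F. 0 < N \<longrightarrow> finite F \<longrightarrow> F \<subseteq> int_lattice \<longrightarrow>
     ennreal (\<Sum>m\<in>F. (cmod (coefficient (cell (real N)) m))\<^sup>2)
       \<le> ennreal (real N ^ CARD('n)) * (ennreal ((cmod mean)\<^sup>2) + ennreal C * cell_leak TYPE('n) (real N))"
proof -
  obtain C where C: "C \<ge> 0" "\<And>A B. A \<in> sets borel \<Longrightarrow> B \<in> sets borel \<Longrightarrow>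
    (\<integral>\<^sup>+m. (\<integral>\<^sup>+x. indicator A x * phi_abs (x - m) \<partial>lborel)
        * (\<integral>\<^sup>+y. indicator B y * phi_abs (y - m) \<partial>lborel) \<partial>lattice_measure)
    \<le> ennreal C * (\<integral>\<^sup>+x. indicator A x * (\<integral>\<^sup>+y. indicator B y * ennreal (tail_kernel (x - y)) \<partial>lborel) \<partial>lborel)"
    using lattice_sum_split_kernel by blast
  have "ennreal (\<Sum>m\<in>F. (cmod (coefficient (cell (real N)) m))\<^sup>2)
       \<le> ennreal (real N ^ CARD('n)) * (ennreal ((cmod mean)\<^sup>2) + ennreal C * cell_leak TYPE('n) (real N))"
    if N: "0 < N" and F: "finite F" "F \<subseteq> int_lattice" for N F
  \<comment> \<open>The leak is not yet known to be finite at this N. If the bound is infinite there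
    is nothing to prove; otherwise its error term is finite, with 0 * \<infinity> = 0 covering C =
    0, and the products of coefficients are summable.\<close>
  proof (cases "cell_leak TYPE('n) (real N) = \<infinity> \<and> C > 0")
    case True
    then show ?thesis using N by (simp add: ennreal_mult_top ennreal_mult_eq_top_iff ennreal_top_mult)
  next
    case False
    define u where "u m = coefficient (cell (real N)) m" for m
    define e where "e m = coefficient (- cell (real N)) m" for m
    have int: "integrable lborel (\<lambda>x. indicator A x *\<^sub>R \<phi> (x - m))" if "A \<in> sets borel" for A m
      using that by (intro integrable_mult_indicator integrable_lborel_translate integrable_phi) auto
    have ue: "u m + e m = mean" for m
    proof -
      have "u m + e m = (LINT x|lborel. indicator (cell (real N)) x *\<^sub>R \<phi> (x - m) + indicator (- cell (real N)) x *\<^sub>R \<phi> (x - m))"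
        unfolding u_def e_def by (intro Bochner_Integration.integral_add[symmetric] int) auto
      also have "\<dots> = (LINT x|lborel. \<phi> (x - m))"
        by (intro Bochner_Integration.integral_cong) (auto simp: indicator_def)
      finally show ?thesis by (simp add: lborel_translate)
    qed
    have g: "integrable lborel (\<lambda>x. complex_of_real (indicator (cell (real N)) (x::real^'n)))"
      using N integrable_indicator_cell[of "real N"] by (intro integrable_of_real) auto
    have u_int: "integrable lattice_measure u"
      using lattice_integral_swap(1)[OF g] unfolding u_def by (simp add: scaleR_conv_of_real)
    obtain S where S: "\<And>x. cmod (periodization x) \<le> S"
      using periodization_bounded by blast
    \<comment> \<open>The sum of the coefficients is the integral of the periodization over the
      cube, that is, over N^n copies of the unit cell.\<close>
    have u_sum: "(LINT m|lattice_measure. u m) = of_nat (N ^ CARD('n)) * mean"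
      using lattice_integral_swap(2)[OF g]
        integral_cell_periodic[OF periodization_measurable S periodization_periodic N]
      unfolding u_def by (simp add: scaleR_conv_of_real cell_integral_periodization[unfolded scaleR_conv_of_real])
    have norm_le: "ennreal (cmod (coefficient A m)) \<le>
        (\<integral>\<^sup>+x. indicator A x * phi_abs (x - m) \<partial>lborel)" if "A \<in> sets borel" for A m
    proof -
      have "ennreal (cmod (coefficient A m)) \<le>
        (\<integral>\<^sup>+x. ennreal (cmod (indicator A x *\<^sub>R \<phi> (x - m))) \<partial>lborel)"
        by (rule integral_norm_bound_ennreal[OF int[OF that]])
      also have "\<dots> = (\<integral>\<^sup>+x. indicator A x * phi_abs (x - m) \<partial>lborel)"
        by (intro nn_integral_cong) (auto simp: indicator_def)
      finally show ?thesis .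
    qed
    have ue_le: "(\<integral>\<^sup>+m. ennreal (cmod (u m) * cmod (e m)) \<partial>lattice_measure)
        \<le> ennreal (real N ^ CARD('n)) * (ennreal C * cell_leak TYPE('n) (real N))"
    proof -
      have "(\<integral>\<^sup>+m. ennreal (cmod (u m) * cmod (e m)) \<partial>lattice_measure) \<le>
        (\<integral>\<^sup>+m. (\<integral>\<^sup>+x. indicator (cell (real N)) x * phi_abs (x - m) \<partial>lborel)
        * (\<integral>\<^sup>+y. indicator (- cell (real N)) y * phi_abs (y - m) \<partial>lborel) \<partial>lattice_measure)"
        unfolding u_def e_def by (intro nn_integral_mono) (auto simp: ennreal_mult intro!: mult_mono norm_le)
      also have "\<dots> \<le> ennreal C * (\<integral>\<^sup>+x. indicator (cell (real N)) x *
          (\<integral>\<^sup>+y. indicator (- cell (real N)) y * ennreal (tail_kernel (x - y :: real^'n)) \<partial>lborel) \<partial>lborel)"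
        using C(2)[of "cell (real N)" "- cell (real N)"] by simp
      also have "\<dots> = ennreal C * (ennreal (real N ^ CARD('n)) * cell_leak TYPE('n) (real N))"
        using N by (subst cell_leak_eq) auto
      finally show ?thesis by (simp only: mult.left_commute)
    qed
    have ue_int: "integrable lattice_measure (\<lambda>m. cmod (u m) * cmod (e m))"
    proof (rule integrableI_bounded)
      have "ennreal (real N ^ CARD('n)) * (ennreal C * cell_leak TYPE('n) (real N)) < \<infinity>"
        using False C(1) by (cases "C = 0") (auto simp: ennreal_mult_less_top less_top)
      then show "(\<integral>\<^sup>+m. ennreal (norm (cmod (u m) * cmod (e m))) \<partial>lattice_measure) < \<infinity>"
        using ue_le by (simp add: norm_mult le_less_trans)
    qed simp
    have sq: "(cmod (u m))\<^sup>2 \<le> Re (cnj mean * u m) + cmod (u m) * cmod (e m)" for m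
    proof -
      have "complex_of_real ((cmod (u m))\<^sup>2) = u m * cnj (mean - e m)"
        using ue[of m] by (subst complex_norm_square) (metis add_diff_cancel_right')
      then have "(cmod (u m))\<^sup>2 = Re (u m * cnj (mean - e m))"
        by (metis Re_complex_of_real)
      also have "\<dots> = Re (cnj mean * u m) - Re (u m * cnj (e m))"
        by (simp add: algebra_simps)
      also have "\<dots> \<le> Re (cnj mean * u m) + cmod (u m * cnj (e m))"
        using abs_Re_le_cmod[of "u m * cnj (e m)"] by linarith
      finally show ?thesis by (simp only: norm_mult complex_mod_cnj)
    qed
    have rhs_int: "integrable lattice_measure (\<lambda>m. Re (cnj mean * u m) + cmod (u m) * cmod (e m))"
      by (intro Bochner_Integration.integrable_add ue_int integrable_Re integrable_mult_right u_int)
    have "(\<Sum>m\<in>F. (cmod (u m))\<^sup>2) \<le> (\<Sum>m\<in>F. Re (cnj mean * u m) + cmod (u m) * cmod (e m))"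
      by (intro sum_mono sq)
    also have "\<dots> \<le> (LINT m|lattice_measure. Re (cnj mean * u m) + cmod (u m) * cmod (e m))"
      (is "sum ?h F \<le> _")
    proof -
      \<comment> \<open>The majorant dominates a square, so its sum over F is at most its sum over
        the whole lattice.\<close>
      have nonneg: "0 \<le> ?h m" for m using sq[of m] zero_le_power2 order_trans by blast
      have "sum ?h F = (LINT m|lattice_measure. indicator F m * ?h m)"
      proof -
        have "sum ?h F = (\<Sum>m | m \<in> int_lattice \<and> indicator F m * ?h m \<noteq> 0. indicator F m * ?h m)"
          using F by (intro sum.mono_neutral_cong_right) (auto simp: indicator_def)
        also have "\<dots> = (LINT m|lattice_measure. indicator F m * ?h m)"
          using F by (intro lebesgue_integral_count_space_finite_support[symmetric])
            (auto intro!: finite_subset[OF _ F(1)] simp: indicator_def)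
        finally show ?thesis .
      qed
      also have "\<dots> \<le> (LINT m|lattice_measure. ?h m)"
        by (rule integral_mono_AE'[OF rhs_int]; intro AE_I2; use nonneg in \<open>simp add: indicator_def\<close>)
      finally show ?thesis .
    qed
    also have "\<dots> = Re (cnj mean * (LINT m|lattice_measure. u m)) + (LINT m|lattice_measure. cmod (u m) * cmod (e m))"
      by (simp add: Bochner_Integration.integral_add ue_int integrable_Re integrable_mult_right u_int integral_Re del: complex_Re_le_cmod times_complex.sel)
    also have "Re (cnj mean * (LINT m|lattice_measure. u m)) = real N ^ CARD('n) * (cmod mean)\<^sup>2"
    proof -
      have "cnj mean * (LINT m|lattice_measure. u m) = complex_of_real (real N ^ CARD('n) * (cmod mean)\<^sup>2)"
        unfolding u_sum of_real_mult complex_norm_square by simp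
      then show ?thesis by (metis Re_complex_of_real)
    qed
    finally have "ennreal (\<Sum>m\<in>F. (cmod (u m))\<^sup>2) \<le>
       ennreal (real N ^ CARD('n) * (cmod mean)\<^sup>2 + (LINT m|lattice_measure. cmod (u m) * cmod (e m)))"
      by (rule ennreal_leI)
    also have "\<dots> = ennreal (real N ^ CARD('n) * (cmod mean)\<^sup>2) + (\<integral>\<^sup>+m. ennreal (cmod (u m) * cmod (e m)) \<partial>lattice_measure)"
      using nn_integral_eq_integral[OF ue_int] by (subst ennreal_plus) auto
    also have "\<dots> \<le> ennreal (real N ^ CARD('n) * (cmod mean)\<^sup>2) + ennreal (real N ^ CARD('n)) * (ennreal C * cell_leak TYPE('n) (real N))"
      by (intro add_left_mono ue_le)
    also have "\<dots> = ennreal (real N ^ CARD('n)) * (ennreal ((cmod mean)\<^sup>2) + ennreal C * cell_leak TYPE('n) (real N))"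
      by (simp add: ennreal_mult distrib_left)
    finally show ?thesis unfolding u_def .
  qed
  with C(1) show ?thesis by blast
qed

end

subsection \<open>Regular multiresolution analyses\<close>

locale regular_scaling = rapidly_decreasing \<phi> E
  for \<phi> :: "real^'n \<Rightarrow> complex" and E +
  fixes V :: "int \<Rightarrow> (real^'n \<Rightarrow> complex) set"
  assumes MRA: "MRA V" and scaling: "scaling_function V \<phi>"
begin

lemma orthonormal:
  assumes "m \<in> int_lattice" "k \<in> int_lattice"
  shows "(LINT x|lborel. \<phi> (x - m) * cnj (\<phi> (x - k))) = (if m = k then 1 else 0)"
  using scaling assms
  by (simp add: scaling_function_def translates_orthonormal_basis_def L2_inner_def)

lemma phi_L2: "\<phi> \<in> L2_space"
  using scaling by (simp add: scaling_function_def)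

text \<open>Dilation by 2^j carries an approximation g of the unit cube in V_j to one of the cube of
  side 2^j in V_0, and the squared error grows exactly like the volume. Only then is the dilated
  function replaced by a finite combination of translates.\<close>

lemma cell_approximation:
  assumes e: "e > 0"
  obtains j F c where "j \<ge> J" "finite F" "F \<subseteq> int_lattice"
    "(LINT x|lborel. (cmod (complex_of_real (indicator (cell (2 ^ j)) x) - (\<Sum>m\<in>F. c m * \<phi> (x - m))))\<^sup>2)
      \<le> e * (2 ^ j) ^ CARD('n)"
proof -
  let ?f = "\<lambda>N x::real^'n. complex_of_real (indicator (cell N) x)"
  have f_L2: "?f N \<in> L2_space" if "N > 0" for N
  proof -
    have "(\<lambda>x. (cmod (?f N x))\<^sup>2) = (indicator (cell N) :: real^'n \<Rightarrow> real)"
      by (auto simp: indicator_def fun_eq_iff)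
    then show ?thesis using integrable_indicator_cell[OF that] by (simp add: L2_space_def)
  qed
  have cl: "L2_closure (\<Union>j. V j) = L2_space" "\<And>j. V j \<subseteq> L2_space"
    using MRA by (auto simp: MRA_def L2_closed_subspace_def)
  \<comment> \<open>Both squared errors are doubled by \<open>L2_diff_square\<close>. The first
    contributes e / 2 times the volume of the cube, the second e / 2, which is no more since the
    volume is at least 1.\<close>
  have "sqrt (e / 4) > 0" using e by simp
  moreover have "?f 1 \<in> L2_closure (\<Union>j. V j)"
    unfolding cl(1) by (rule f_L2) simp
  ultimately have "\<exists>g\<in>\<Union>j. V j. L2_norm (\<lambda>x. ?f 1 x - g x) < sqrt (e / 4)"
    unfolding L2_closure_def by (simp only: mem_Collect_eq)
  then obtain i g where g: "g \<in> V i" "L2_norm (\<lambda>x. ?f 1 x - g x) < sqrt (e / 4)"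
    by (elim bexE UN_E) (rule that)
  \<comment> \<open>The level i may be negative or below J; the inclusions between the V_j allow it
    to be raised.\<close>
  define j where "j = max J (nat i)"
  define g' where "g' = (\<lambda>x. g ((1 / 2 ^ j) *\<^sub>R x))"
  have "g \<in> V (int j)" using MRA_mono[OF MRA, of i "int j"] g(1) unfolding j_def by (simp add: subset_iff)
  then have g_L2: "g \<in> L2_space" using cl(2) by blast
  then have g'_L2: "g' \<in> L2_space" unfolding g'_def by (rule L2_space_scale) simp
  have "(\<lambda>x. g' (2 ^ j *\<^sub>R x)) = g" by (simp add: g'_def)
  then have "g' \<in> V 0" using MRA_scale[OF MRA g'_L2, of j] \<open>g \<in> V (int j)\<close> by simp
  moreover have "V 0 = L2_closure {(\<lambda>x. \<Sum>m\<in>F. c m * \<phi> (x - m)) | F c. finite F \<and> F \<subseteq> int_lattice}"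
    using scaling by (simp add: scaling_function_def translates_orthonormal_basis_def)
  ultimately obtain F c where F: "finite F" "F \<subseteq> int_lattice"
    and Fc: "L2_norm (\<lambda>x. g' x - (\<Sum>m\<in>F. c m * \<phi> (x - m))) < sqrt (e / 4)"
  proof -
    let ?S = "{(\<lambda>x. \<Sum>m\<in>F. c m * \<phi> (x - m)) | F c. finite F \<and> F \<subseteq> int_lattice}"
    assume "g' \<in> V 0" "V 0 = L2_closure ?S"
    then have "g' \<in> L2_closure ?S" by (simp only:)
    then obtain h where "h \<in> ?S" "L2_norm (\<lambda>x. g' x - h x) < sqrt (e / 4)"
      using \<open>sqrt (e / 4) > 0\<close> unfolding L2_closure_def mem_Collect_eq by blast
    with that show ?thesis by blast
  qed
  have h_L2: "(\<lambda>x. \<Sum>m\<in>F. c m * \<phi> (x - m)) \<in> L2_space"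
    by (intro L2_space_sum L2_space_cmult L2_space_translate phi_L2)
  have fg: "(LINT x|lborel. (cmod (?f (2 ^ j) x - g' x))\<^sup>2) = (2 ^ j) ^ CARD('n) * (LINT x|lborel. (cmod (?f 1 x - g x))\<^sup>2)"
  proof -
    have "?f (2 ^ j) (2 ^ j *\<^sub>R x) = ?f 1 x" for x
      by (simp add: indicator_cell_scale) (simp add: indicator_def cell_def unit_cell_def)
    then show ?thesis
      using L2_space_scale(2)[OF L2_space_diff[OF f_L2[of "2 ^ j"] g'_L2], of "2 ^ j"]
      by (simp add: g'_def)
  qed
  have "(LINT x|lborel. (cmod (?f (2 ^ j) x - (\<Sum>m\<in>F. c m * \<phi> (x - m))))\<^sup>2) \<le>
     2 * (LINT x|lborel. (cmod (?f (2 ^ j) x - g' x))\<^sup>2) +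
     2 * (LINT x|lborel. (cmod (g' x - (\<Sum>m\<in>F. c m * \<phi> (x - m))))\<^sup>2)"
    by (intro L2_diff_square L2_space_diff f_L2 g'_L2 h_L2) auto
  also have "\<dots> \<le> 2 * ((2 ^ j) ^ CARD('n) * (e / 4)) + 2 * (e / 4)"
    unfolding fg using L2_norm_less[OF g(2)] L2_norm_less[OF Fc]
    by (intro add_mono mult_left_mono) auto
  also have "\<dots> \<le> e * (2 ^ j) ^ CARD('n)"
  proof -
    have "(1::real) \<le> (2 ^ j) ^ CARD('n)" by (simp add: one_le_power)
    then have "2 * (e / 4) \<le> 2 * (e / 4) * (2 ^ j) ^ CARD('n)" using e by (simp add: mult_le_cancel_left1)
    then show ?thesis by (simp add: algebra_simps)
  qed
  finally show ?thesis
    using that[of j F c] F by (simp add: j_def)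
qed

text \<open>Bessel's defect for the indicator of a large cube is at most e / 2 times its volume L,
  so the squared coefficients sum to at least (1 - e/2) L; by \<open>sum_coefficients_le\<close>
  they sum to at most L (|mean|^2 + e/2). Dividing by L leaves the claim up to e.\<close>

lemma mean_ge_1: "1 \<le> (cmod mean)\<^sup>2"
proof (rule field_le_epsilon)
  fix e :: real assume e: "e > 0"
  obtain C where C: "C \<ge> 0" "\<And>N F. 0 < N \<Longrightarrow> finite F \<Longrightarrow> F \<subseteq> int_lattice \<Longrightarrow>
     ennreal (\<Sum>m\<in>F. (cmod (coefficient (cell (real N)) m))\<^sup>2)
       \<le> ennreal (real N ^ CARD('n)) * (ennreal ((cmod mean)\<^sup>2) + ennreal C * cell_leak TYPE('n) (real N))"
    using sum_coefficients_le by blast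
  have "(\<lambda>j. ennreal C * cell_leak TYPE('n) (2 ^ j)) \<longlonglongrightarrow> ennreal C * 0"
    by (intro ennreal_tendsto_cmult cell_leak_tendsto) simp
  then have "\<forall>\<^sub>F j in sequentially. ennreal C * cell_leak TYPE('n) (2 ^ j) < ennreal (e / 2)"
    using e by (intro order_tendstoD) auto
  then obtain J where J: "\<And>j. j \<ge> J \<Longrightarrow> ennreal C * cell_leak TYPE('n) (2 ^ j) < ennreal (e / 2)"
    unfolding eventually_sequentially by blast
  from e have "e / 2 > 0" by simp
  then obtain j F c where j: "j \<ge> J" and F: "finite F" "F \<subseteq> int_lattice"
    and approx: "(LINT x|lborel. (cmod (complex_of_real (indicator (cell (2 ^ j)) x) - (\<Sum>m\<in>F. c m * \<phi> (x - m))))\<^sup>2)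
      \<le> e / 2 * (2 ^ j) ^ CARD('n)"
    by (rule cell_approximation)
  define N :: nat where "N = 2 ^ j"
  have N: "N > 0" "real N = 2 ^ j" by (simp_all add: N_def)
  let ?f = "\<lambda>x::real^'n. complex_of_real (indicator (cell (real N)) x)"
  let ?L = "real N ^ CARD('n)"
  have L: "?L > 0" using N(1) by simp
  obtain B where B: "\<And>x. cmod (\<phi> x) \<le> B" using phi_bounded by blast
  have ff: "?f x * cnj (?f x) = ?f x" "(cmod (?f x))\<^sup>2 = indicator (cell (real N)) x" for x
    by (auto simp: indicator_def)
  have "(LINT x|lborel. (cmod (?f x))\<^sup>2) - (\<Sum>m\<in>F. (cmod (LINT x|lborel. ?f x * cnj (\<phi> (x - m))))\<^sup>2)
    \<le> (LINT x|lborel. (cmod (?f x - (\<Sum>m\<in>F. c m * \<phi> (x - m))))\<^sup>2)"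
  proof (rule finite_projection_bound[where e="\<lambda>m x. \<phi> (x - m)"])
    show "integrable lborel (\<lambda>x. ?f x * cnj (?f x))"
      unfolding ff using N(1) integrable_indicator_cell[of "real N"] by (intro integrable_of_real) auto
    show "integrable lborel (\<lambda>x. ?f x * cnj (\<phi> (x - m)))" for m
      by (rule integrable_bounded_mult_phi_cnj[where C=1]) (auto simp: indicator_def)
    show "integrable lborel (\<lambda>x. \<phi> (x - m) * cnj (\<phi> (x - k)))" for m k
      by (rule integrable_bounded_mult_phi_cnj[where C=B]) (auto simp: B)
    show "(LINT x|lborel. \<phi> (x - m) * cnj (\<phi> (x - k))) = (if m = k then 1 else 0)"
      if "m \<in> F" "k \<in> F" for m k
      using F(2) that by (intro orthonormal) auto
  qed (rule F(1))
  moreover have "(LINT x|lborel. (cmod (?f x))\<^sup>2) = ?L"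
    unfolding ff using measure_cell[of "real N", where 'n='n] N(1) by simp
  moreover have "cmod (LINT x|lborel. ?f x * cnj (\<phi> (x - m))) = cmod (coefficient (cell (real N)) m)" for m
  proof -
    have "(LINT x|lborel. ?f x * cnj (\<phi> (x - m))) = (LINT x|lborel. cnj (indicator (cell (real N)) x *\<^sub>R \<phi> (x - m)))"
      by (simp add: scaleR_conv_of_real)
    then show ?thesis by (simp only: Bochner_Integration.integral_cnj complex_mod_cnj)
  qed
  ultimately have 1: "?L - e / 2 * ?L \<le> (\<Sum>m\<in>F. (cmod (coefficient (cell (real N)) m))\<^sup>2)"
    using approx by (simp add: N(2))
  have "ennreal (\<Sum>m\<in>F. (cmod (coefficient (cell (real N)) m))\<^sup>2)
     \<le> ennreal ?L * (ennreal ((cmod mean)\<^sup>2) + ennreal (e / 2))"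
    using J[OF j] by (intro order_trans[OF C(2)[OF N(1) F]] mult_left_mono add_left_mono)
      (auto simp: N(2) less_imp_le)
  also have "\<dots> = ennreal (?L * ((cmod mean)\<^sup>2 + e / 2))"
    using L e by (subst ennreal_mult) auto
  finally have "(\<Sum>m\<in>F. (cmod (coefficient (cell (real N)) m))\<^sup>2) \<le> ?L * ((cmod mean)\<^sup>2 + e / 2)"
    using L e by (subst (asm) ennreal_le_iff) auto
  with 1 have "?L * (1 - e / 2) \<le> ?L * ((cmod mean)\<^sup>2 + e / 2)"
    by (simp add: algebra_simps)
  then show "1 \<le> (cmod mean)\<^sup>2 + e"
    using L by (simp add: mult_le_cancel_left_pos)
qed

end

section \<open>The periodization is constant and the kernel has integral one\<close>

context regular_scaling begin

abbreviation cell_square :: "real^'n \<Rightarrow> complex" where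
  "cell_square x \<equiv> indicator unit_cell x *\<^sub>R (periodization x * cnj (periodization x))"

abbreviation cell_deviation :: "real^'n \<Rightarrow> real" where
  "cell_deviation x \<equiv> indicator unit_cell x *\<^sub>R (cmod (periodization x - mean))\<^sup>2"

text \<open>Unfolding one of the two periodizations turns the integral over the cell into the
  lattice sum of the inner products of the translates of \<open>\<phi>\<close> with
  \<open>\<phi>\<close>, and only m = 0 contributes.\<close>

lemma cell_integral_periodization_square:
  "(LINT x|lborel. cell_square x) = 1"
  and integrable_cell_periodization_square:
  "integrable lborel (\<lambda>x. cell_square x)"
proof -
  obtain S where S: "\<And>x. cmod (periodization x) \<le> S"
    using periodization_bounded by blast
  have int: "integrable lborel (\<lambda>x. periodization x * cnj (\<phi> x))"
    using integrable_bounded_mult_phi_cnj[OF periodization_measurable S, of 0] by simp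
  have fold: "(LINT m|lattice_measure. periodization (x - m) * cnj (\<phi> (x - m))) = periodization x * cnj (periodization x)" for x
  proof -
    have "(LINT m|lattice_measure. periodization (x - m) * cnj (\<phi> (x - m))) =
      (LINT m|lattice_measure. periodization x * cnj (\<phi> (x - m)))"
      by (intro Bochner_Integration.integral_cong) (auto simp: periodization_periodic)
    then show ?thesis by (simp add: periodization_def)
  qed
  have cnj_phi: "integrable lborel (\<lambda>x. cnj (\<phi> x))"
    using integrable_phi by (simp only: integrable_cnj)
  have "(LINT x|lborel. cell_square x) =
      (LINT x|lborel. periodization x * cnj (\<phi> x))"
    using integral_tiling(1)[OF int] by (simp only: fold)
  also have "\<dots> = (LINT x|lborel. cnj (\<phi> x) * periodization x)"
    by (simp only: mult.commute)
  also have "\<dots> = (LINT m|lattice_measure. LINT x|lborel. cnj (\<phi> x) * \<phi> (x - m))"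
    by (rule lattice_integral_swap(2)[OF cnj_phi, symmetric])
  also have "\<dots> = (LINT m|(lattice_measure :: (real^'n) measure). (if m = 0 then 1 else (0::complex)))"
    using orthonormal[OF _ int_lattice_zero]
    by (intro Bochner_Integration.integral_cong) (auto simp: mult.commute)
  also have "\<dots> = (\<Sum>m | m \<in> int_lattice \<and> (if m = 0 then 1 else 0 :: complex) \<noteq> 0. if m = (0::real^'n) then 1 else 0)"
    by (rule lebesgue_integral_count_space_finite_support) simp
  also have "{m::real^'n. m \<in> int_lattice \<and> (if m = 0 then 1 else 0 :: complex) \<noteq> 0} = {0}"
    using int_lattice_zero by auto
  finally show "(LINT x|lborel. cell_square x) = 1"
    by simp
  show "integrable lborel (\<lambda>x. cell_square x)"
    using integral_tiling(2)[OF int] by (simp only: fold)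
qed

text \<open>The variance identity on a cell of volume one: mean square minus squared modulus of the
  mean. As the left-hand side is nonnegative, it supplies the upper bound that complements
  \<open>mean_ge_1\<close>.\<close>

lemma cell_integral_deviation:
  "(LINT x|lborel. cell_deviation x) = 1 - (cmod mean)\<^sup>2"
  and integrable_cell_deviation:
  "integrable lborel (\<lambda>x. cell_deviation x)"
proof -
  let ?p = "\<lambda>x. indicator unit_cell x *\<^sub>R periodization x"
  have p: "has_bochner_integral lborel ?p mean"
    using cell_integral_periodization integral_tiling(2)[OF integrable_phi]
    by (simp add: has_bochner_integral_iff periodization_def)
  have one: "has_bochner_integral lborel (\<lambda>x::real^'n. complex_of_real (indicator unit_cell x)) 1"
    using has_bochner_integral_of_real[OF has_bochner_integral_real_indicator[of unit_cell "lborel :: (real^'n) measure"]]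
    by (simp add: emeasure_unit_cell measure_def)
  have sq: "has_bochner_integral lborel (\<lambda>x. cell_square x) 1"
    using cell_integral_periodization_square integrable_cell_periodization_square
    by (simp add: has_bochner_integral_iff)
  have "has_bochner_integral lborel (\<lambda>x. cell_square x
      - cnj mean * ?p x - mean * cnj (?p x) + mean * cnj mean * complex_of_real (indicator unit_cell x))
      (1 - cnj mean * mean - mean * cnj mean + mean * cnj mean * 1)"
    by (intro has_bochner_integral_add has_bochner_integral_diff has_bochner_integral_mult_right
        has_bochner_integral_cnj sq p one)
  moreover have "cell_square x
      - cnj mean * ?p x - mean * cnj (?p x) + mean * cnj mean * complex_of_real (indicator unit_cell x)
      = complex_of_real (cell_deviation x)" for x
    unfolding real_scaleR_def of_real_mult complex_norm_square
    by (simp add: indicator_def algebra_simps)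
  moreover have "1 - cnj mean * mean - mean * cnj mean + mean * cnj mean * 1 = complex_of_real (1 - (cmod mean)\<^sup>2)"
    unfolding of_real_diff complex_norm_square by simp
  ultimately have h: "has_bochner_integral lborel (\<lambda>x. complex_of_real (cell_deviation x))
      (complex_of_real (1 - (cmod mean)\<^sup>2))"
    by (simp only:)
  then have "has_bochner_integral lborel (\<lambda>x. Re (complex_of_real (cell_deviation x)))
      (Re (complex_of_real (1 - (cmod mean)\<^sup>2)))"
    by (rule has_bochner_integral_Re)
  then show "(LINT x|lborel. cell_deviation x) = 1 - (cmod mean)\<^sup>2"
    "integrable lborel (\<lambda>x. cell_deviation x)"
    by (simp_all only: Re_complex_of_real has_bochner_integral_iff)
qed

lemma cmod_mean: "(cmod mean)\<^sup>2 = 1"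
proof -
  have "0 \<le> (LINT x|lborel. cell_deviation x)"
    by (rule integral_nonneg_AE) auto
  then have "0 \<le> 1 - (cmod mean)\<^sup>2" by (simp only: cell_integral_deviation)
  then show ?thesis using mean_ge_1 by linarith
qed

text \<open>Vanishing variance gives the identity almost everywhere on the cell. On the open cube
  the exceptional set is open and null, hence empty; closure and periodicity extend the identity to
  every point, as is needed for a measure that may charge Lebesgue null sets.\<close>

lemma periodization_eq_mean: "periodization x = mean"
proof -
  have "AE x in lborel. cell_deviation x = 0"
    using integral_nonneg_eq_0_iff_AE[OF integrable_cell_deviation] cell_integral_deviation cmod_mean by simp
  moreover have "box 0 1 \<subseteq> (unit_cell :: (real^'n) set)"
    by (auto simp: unit_cell_def mem_box_cart less_imp_le)
  ultimately have ae: "AE x in lborel. x \<notin> box 0 1 \<inter> {x. periodization x \<noteq> mean}"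
    by (elim eventually_mono) (auto simp: subset_iff)
  have cont: "continuous_on UNIV periodization"
    using isCont_periodization by (simp add: continuous_at_imp_continuous_on)
  have op: "open (box 0 1 \<inter> {x. periodization x \<noteq> mean})"
    by (intro open_Int open_box open_Collect_neq cont continuous_intros)
  have "emeasure lborel (box 0 1 \<inter> {x. periodization x \<noteq> mean}) = 0"
    using ae op by (subst (asm) AE_iff_measurable[OF _ refl]) (auto simp: Int_def)
  then have "negligible (box 0 1 \<inter> {x. periodization x \<noteq> mean})"
    using op by (intro negligible_iff_null_sets[THEN iffD2] null_sets_completionI null_setsI) auto
  with op have "box 0 1 \<subseteq> {x. periodization x = mean}"
    using open_not_negligible by blast
  moreover have "closed {x. periodization x = mean}"
    by (intro closed_Collect_eq cont continuous_intros)
  ultimately have "closure (box 0 1) \<subseteq> {x. periodization x = mean}"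
    by (rule closure_minimal)
  \<comment> \<open>The centre shows that the open cube is nonempty, so that its closure is the
    closed cube.\<close>
  moreover have "(1/2) *\<^sub>R (1::real^'n) \<in> box 0 1" by (simp add: mem_box_cart)
  ultimately have cb: "cbox 0 1 \<subseteq> {x. periodization x = mean}"
    by (metis closure_box empty_iff)
  obtain m where m: "m \<in> int_lattice" "x + m \<in> unit_cell"
    using unique_lattice_translate by blast
  then have "x + m \<in> cbox 0 1" by (auto simp: unit_cell_def mem_box_cart less_imp_le)
  then have "periodization (x + m) = mean" using cb by blast
  then show ?thesis using periodization_periodic[OF m(1), of "x + m"] by simp
qed

text \<open>Fubini gives \<open>mean\<close> times the conjugate of the periodization at y;
  constancy of the periodization removes the dependence on y and leaves |mean|^2.\<close>

lemma integral_q0_kernel: "(LINT x|lborel. q0_kernel \<phi> x y) = 1"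
proof -
  obtain S where S: "S \<ge> 0" "\<And>x. abs_sum x \<le> ennreal S"
    using lattice_sum_phi by blast
  have meas: "(\<lambda>(m, x). \<phi> (x - m) * cnj (\<phi> (y - m))) \<in> borel_measurable (lattice_measure \<Otimes>\<^sub>M lborel)"
    by (rule measurable_lattice_pair) measurable
  have "integrable (lattice_measure \<Otimes>\<^sub>M lborel) (\<lambda>(m, x). \<phi> (x - m) * cnj (\<phi> (y - m)))"
  proof (rule integrableI_bounded[OF meas])
    have "(\<integral>\<^sup>+z. ennreal (cmod (case z of (m, x) \<Rightarrow> \<phi> (x - m) * cnj (\<phi> (y - m)))) \<partial>(lattice_measure \<Otimes>\<^sub>M lborel)) =
      (\<integral>\<^sup>+m. (\<integral>\<^sup>+x. phi_abs (x - m) * phi_abs (y - m) \<partial>lborel) \<partial>lattice_measure)"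
      using meas by (subst lborel.nn_integral_fst[symmetric])
        (auto intro!: nn_integral_cong simp: norm_mult ennreal_mult)
    also have "\<dots> = (\<integral>\<^sup>+x. phi_abs x \<partial>lborel) * abs_sum y"
      using nn_integral_lborel_translate[of "\<lambda>x. phi_abs x"]
      by (simp add: nn_integral_multc nn_integral_cmult)
    also have "\<dots> < \<infinity>"
      using integrable_phi le_less_trans[OF S(2) ennreal_less_top]
      by (auto simp: ennreal_mult_less_top integrable_iff_bounded)
    finally show "(\<integral>\<^sup>+z. ennreal (cmod (case z of (m, x) \<Rightarrow> \<phi> (x - m) * cnj (\<phi> (y - m)))) \<partial>(lattice_measure \<Otimes>\<^sub>M lborel)) < \<infinity>" .
  qed
  then have "(LINT x|lborel. q0_kernel \<phi> x y) = (LINT m|lattice_measure. LINT x|lborel. \<phi> (x - m) * cnj (\<phi> (y - m)))"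
    unfolding q0_kernel_eq by (rule lattice_lborel.Fubini_integral)
  also have "\<dots> = mean * cnj (periodization y)"
    by (simp add: lborel_translate periodization_def)
  also have "\<dots> = 1"
    using cmod_mean by (simp add: periodization_eq_mean complex_norm_square[symmetric])
  finally show ?thesis .
qed

text \<open>The Bochner integral of a non-integrable function is 0 by convention, so the value 1
  forces integrability.\<close>

lemma integrable_q0_kernel: "integrable lborel (\<lambda>x. q0_kernel \<phi> x y)"
  using integral_q0_kernel[of y] not_integrable_integral_eq by fastforce

section \<open>Uniform estimates for the kernel in blow-up coordinates\<close>

abbreviation scaled_kernel :: "real \<Rightarrow> real^'n \<Rightarrow> real^'n \<Rightarrow> real^'n \<Rightarrow> complex" where
  "scaled_kernel w t v x \<equiv>
     complex_of_real (w ^ CARD('n)) * q0_kernel \<phi> (t + w *\<^sub>R x) (t + w *\<^sub>R v)"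

abbreviation scaled_mass :: "real \<Rightarrow> real^'n \<Rightarrow> real^'n \<Rightarrow> (real^'n \<Rightarrow> complex) \<Rightarrow> ennreal" where
  "scaled_mass w t v \<psi> \<equiv> (\<integral>\<^sup>+x. ennreal (cmod (scaled_kernel w t v x * \<psi> x)) \<partial>lborel)"

text \<open>In the application w is 2 powr (1/\<epsilon>) * \<epsilon> and t is 2 powr
  (1/\<epsilon>) times \<open>x0\<close>. The kernel is in general invariant only under common
  integer shifts, so t cannot be normalised to 0; all the estimates that follow are uniform in t
  instead.\<close>

lemma scaled_kernel_integral:
  assumes "w > 0"
  shows "has_bochner_integral lborel (\<lambda>x. complex_of_real (w ^ CARD('n)) * q0_kernel \<phi> (t + w *\<^sub>R x) y) 1"
  using integrable_lborel_affine[OF integrable_q0_kernel, of w t y] assms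
    integral_lborel_affine[of "\<lambda>x. q0_kernel \<phi> x y" w t]
  by (simp add: has_bochner_integral_iff integral_q0_kernel scaleR_conv_of_real)

lemma nn_integral_scaled_tail:
  assumes "w > 0"
  shows "(\<integral>\<^sup>+x. ennreal (w ^ CARD('n) * tail_kernel (w *\<^sub>R (x - v :: real^'n))) \<partial>lborel)
    = ennreal (LINT z|lborel. tail_kernel (z :: real^'n))"
proof -
  have "(\<integral>\<^sup>+x. ennreal (w ^ CARD('n) * tail_kernel (w *\<^sub>R (x - v :: real^'n))) \<partial>lborel)
    = ennreal (w ^ CARD('n)) * (\<integral>\<^sup>+x. ennreal (tail_kernel (- (w *\<^sub>R v) + w *\<^sub>R x)) \<partial>lborel)"
    using assms by (simp add: ennreal_mult tail_kernel_nonneg nn_integral_cmult algebra_simps)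
  also have "\<dots> = (\<integral>\<^sup>+z. ennreal (tail_kernel (z :: real^'n)) \<partial>lborel)"
    using assms nn_integral_lborel_affine[of "\<lambda>z. ennreal (tail_kernel (z :: real^'n))" w "- (w *\<^sub>R v)"] by simp
  also have "\<dots> = ennreal (LINT z|lborel. tail_kernel (z :: real^'n))"
    using integrable_tail_kernel[where 'n='n] by (intro nn_integral_eq_integral) (auto simp: tail_kernel_nonneg)
  finally show ?thesis .
qed

text \<open>The scaled kernel is dominated by w^n times the tail kernel at w(x - v), an approximate
  identity whose mass does not depend on w.\<close>

lemma scaled_kernel_near:
  fixes \<psi> :: "real^'n \<Rightarrow> complex"
  assumes [measurable]: "\<psi> \<in> borel_measurable borel" and bounded: "\<And>x. cmod (\<psi> x) \<le> B"
  shows "\<exists>C\<ge>0. \<forall>w>0. \<forall>t v. scaled_mass w t v \<psi> \<le> ennreal C"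
proof -
  obtain C where C: "C \<ge> 0"
    "\<And>x y. cmod (q0_kernel \<phi> x y) \<le> C * decay_factor (CARD('n) + 1) x y"
    using q0_kernel_bound by blast
  have C': "cmod (q0_kernel \<phi> x y) \<le> C * tail_kernel (x - y)" for x y
    by (rule order_trans[OF C(2)])
       (auto simp: tail_kernel_def intro!: mult_left_mono C(1) divide_right_mono E_le_1 simp del: times_divide_eq_right)
  let ?I = "LINT z|lborel. tail_kernel (z :: real^'n)"
  have B: "B \<ge> 0" using bounded[of undefined] norm_ge_zero order_trans by blast
  have "scaled_mass w t v \<psi>
      \<le> ennreal (C * B * ?I)" if "w > 0" for w t v
  proof -
    have "scaled_mass w t v \<psi>
      \<le> (\<integral>\<^sup>+x. ennreal (C * B) * ennreal (w ^ CARD('n) * tail_kernel (w *\<^sub>R (x - v))) \<partial>lborel)"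
    proof (rule nn_integral_mono)
      fix x
      have "cmod (scaled_kernel w t v x * \<psi> x)
         = w ^ CARD('n) * cmod (q0_kernel \<phi> (t + w *\<^sub>R x) (t + w *\<^sub>R v)) * cmod (\<psi> x)"
        using that by (simp add: norm_mult norm_power)
      also have "\<dots> \<le> w ^ CARD('n) * (C * tail_kernel (w *\<^sub>R (x - v))) * B"
        using C'[of "t + w *\<^sub>R x" "t + w *\<^sub>R v"] that C(1)
        by (intro mult_mono bounded mult_left_mono)
           (auto simp: scaleR_diff_right tail_kernel_nonneg)
      also have "\<dots> = C * B * (w ^ CARD('n) * tail_kernel (w *\<^sub>R (x - v)))" by simp
      finally show "ennreal (cmod (scaled_kernel w t v x * \<psi> x))
        \<le> ennreal (C * B) * ennreal (w ^ CARD('n) * tail_kernel (w *\<^sub>R (x - v)))"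
        using that C(1) B by (subst ennreal_mult[symmetric]) (auto simp: tail_kernel_nonneg intro!: ennreal_leI)
    qed
    also have "\<dots> = ennreal (C * B) * ennreal ?I"
      by (subst nn_integral_cmult) (simp_all only: nn_integral_scaled_tail[OF that], measurable)
    also have "\<dots> = ennreal (C * B * ?I)"
      using C(1) B by (intro ennreal_mult[symmetric] integral_nonneg_AE) (auto simp: tail_kernel_nonneg)
    finally show ?thesis .
  qed
  moreover have "0 \<le> C * B * ?I"
    using C(1) B by (intro mult_nonneg_nonneg integral_nonneg_AE) (auto simp: tail_kernel_nonneg)
  ultimately show ?thesis by blast
qed

text \<open>On the support of \<open>\<psi>\<close>, |x - v| \<ge> |v| / 2, and the kernel bound
  halves this once more: hence the 4. Since w |v| / 4 also exceeds w R / 2, the n + 1 powers of the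
  denominator cancel w^n and leave 1 / w, while \<open>E\<close> keeps the decay in v.\<close>

lemma scaled_kernel_far:
  fixes \<psi> :: "real^'n \<Rightarrow> complex"
  assumes [measurable]: "\<psi> \<in> borel_measurable borel" and bounded: "\<And>x. cmod (\<psi> x) \<le> B"
    and R: "R > 0" and supp: "\<And>x. norm x > R \<Longrightarrow> \<psi> x = 0"
  shows "\<exists>C\<ge>0. \<forall>w>0. \<forall>t v. norm v > 2 * R \<longrightarrow> scaled_mass w t v \<psi> \<le> ennreal (C / w * E (w * norm v / 4))"
proof -
  let ?n = "CARD('n)"
  obtain C where C: "C \<ge> 0"
    "\<And>x y. cmod (q0_kernel \<phi> x y) \<le> C * decay_factor (?n + 1) x y"
    using q0_kernel_bound by blast
  let ?vol = "measure lborel (cball (0::real^'n) R)"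
  define K where "K = C * B * (2 / R) ^ (?n + 1)"
  have B: "B \<ge> 0" using bounded[of undefined] norm_ge_zero order_trans by blast
  have K: "K \<ge> 0" using C(1) B R by (simp add: K_def)
  have "scaled_mass w t v \<psi>
      \<le> ennreal (K * ?vol / w * E (w * norm v / 4))" if w: "w > 0" and v: "norm v > 2 * R" for w t v
  proof -
    have pt: "cmod (scaled_kernel w t v x * \<psi> x)
        \<le> K / w * E (w * norm v / 4)" if x: "norm x \<le> R" for x
    proof -
      have d: "norm v / 2 \<le> norm (x - v)"
        using norm_triangle_ineq2[of v x] x v by (simp add: norm_minus_commute)
      have wd: "w * norm v / 4 \<le> w * norm (x - v) / 2"
        using mult_left_mono[OF d, of w] w by simp
      have "w * R / 2 \<le> w * norm v / 4" using v w by simp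
      then have wR: "w * R / 2 \<le> 1 + w * norm (x - v) / 2" using wd by linarith
      have "cmod (q0_kernel \<phi> (t + w *\<^sub>R x) (t + w *\<^sub>R v)) \<le>
         C * (E (w * norm (x - v) / 2) / (1 + w * norm (x - v) / 2) ^ (?n + 1))"
        using C(2)[of "t + w *\<^sub>R x" "t + w *\<^sub>R v"] w by (simp flip: scaleR_diff_right)
      also have "\<dots> \<le> C * (E (w * norm v / 4) / (w * R / 2) ^ (?n + 1))"
      proof (rule mult_left_mono[OF frac_le C(1)])
        show "E (w * norm (x - v) / 2) \<le> E (w * norm v / 4)"
          using w by (intro E_antimono wd) auto
        show "(w * R / 2) ^ (?n + 1) \<le> (1 + w * norm (x - v) / 2) ^ (?n + 1)"
          using w R by (intro power_mono wR) auto
      qed (use w R in \<open>auto simp: E_nonneg\<close>)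
      finally have q: "cmod (q0_kernel \<phi> (t + w *\<^sub>R x) (t + w *\<^sub>R v)) \<le> C * (E (w * norm v / 4) / (w * R / 2) ^ (?n + 1))" .
      have "cmod (scaled_kernel w t v x * \<psi> x)
         = w ^ ?n * cmod (q0_kernel \<phi> (t + w *\<^sub>R x) (t + w *\<^sub>R v)) * cmod (\<psi> x)"
        using w by (simp add: norm_mult norm_power)
      also have "\<dots> \<le> w ^ ?n * (C * (E (w * norm v / 4) / (w * R / 2) ^ (?n + 1))) * B"
        using w C(1) R by (intro mult_mono bounded mult_left_mono q) (auto simp: E_nonneg)
      also have "\<dots> = K / w * E (w * norm v / 4)"
        using w R by (simp add: K_def field_simps power_mult_distrib power_divide)
      finally show ?thesis .
    qed
    have nn: "0 \<le> K / w * E (w * norm v / 4)" using K w E_nonneg by simp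
    have "scaled_mass w t v \<psi>
      \<le> (\<integral>\<^sup>+x. ennreal (K / w * E (w * norm v / 4)) * indicator (cball (0::real^'n) R) x \<partial>lborel)"
    proof (rule nn_integral_mono)
      fix x :: "real^'n"
      show "ennreal (cmod (scaled_kernel w t v x * \<psi> x))
         \<le> ennreal (K / w * E (w * norm v / 4)) * indicator (cball 0 R) x"
        using pt[of x] supp[of x] by (cases "norm x \<le> R") (auto simp: ennreal_leI)
    qed
    also have "\<dots> = ennreal (K / w * E (w * norm v / 4)) * emeasure lborel (cball (0::real^'n) R)"
      by (rule nn_integral_cmult_indicator) auto
    also have "emeasure lborel (cball (0::real^'n) R) = ennreal ?vol"
      by (intro emeasure_eq_ennreal_measure emeasure_lborel_cball_finite[THEN less_imp_neq, unfolded infinity_ennreal_def])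
    also have "ennreal (K / w * E (w * norm v / 4)) * ennreal ?vol = ennreal (K * ?vol / w * E (w * norm v / 4))"
      using nn by (simp add: ennreal_mult[symmetric] mult_ac)
    finally show ?thesis .
  qed
  moreover have "0 \<le> K * ?vol" using K by simp
  ultimately show ?thesis by blast
qed

text \<open>Because the kernel has mass one, \<psi> v can be moved under the integral, and the
  Lipschitz bound leaves the first absolute moment of the kernel, of size 1 / w. The exponent n + 2
  gives one power to absorb |x - v| and n + 1 for integrability; the 2 comes from |x - v| = (2 / w)
  * \<open>?d\<close>.\<close>

lemma scaled_kernel_approximation:
  fixes \<psi> :: "real^'n \<Rightarrow> complex"
  assumes [measurable]: "\<psi> \<in> borel_measurable borel" and bounded: "\<And>x. cmod (\<psi> x) \<le> B"
    and lipschitz: "\<And>x y. cmod (\<psi> x - \<psi> y) \<le> L * norm (x - y)"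
  shows "\<exists>C\<ge>0. \<forall>w>0. \<forall>t v. cmod ((LINT x|lborel. scaled_kernel w t v x * \<psi> x) - \<psi> v) \<le> C / w"
proof -
  let ?n = "CARD('n)"
  obtain C where C: "C \<ge> 0"
    "\<And>x y. cmod (q0_kernel \<phi> x y) \<le> C * decay_factor (?n + 2) x y"
    using q0_kernel_bound by blast
  obtain C1 where C1: "\<And>w t v. w > 0 \<Longrightarrow> scaled_mass w t v \<psi> \<le> ennreal C1"
    using scaled_kernel_near[OF assms(1) bounded] by blast
  let ?I = "LINT z|lborel. tail_kernel (z :: real^'n)"
  have L: "L \<ge> 0"
  proof -
    have "0 \<le> L * norm ((1::real^'n) - 0)" using lipschitz[of 1 0] norm_ge_zero order_trans by blast
    then show ?thesis by (simp add: zero_le_mult_iff)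
  qed
  have "cmod ((LINT x|lborel. scaled_kernel w t v x * \<psi> x) - \<psi> v) \<le> (2 * C * L * ?I) / w" if w: "w > 0" for w t v
  proof -
    let ?k = "\<lambda>x. scaled_kernel w t v x"
    have k1: "has_bochner_integral lborel ?k 1"
      by (rule scaled_kernel_integral[OF w])
    have int: "integrable lborel (\<lambda>x. ?k x * \<psi> x)"
    proof (rule integrableI_bounded)
      show "(\<integral>\<^sup>+x. ennreal (cmod (?k x * \<psi> x)) \<partial>lborel) < \<infinity>"
        using le_less_trans[OF C1[OF w] ennreal_less_top] by simp
    qed measurable
    have kv: "has_bochner_integral lborel (\<lambda>x. ?k x * \<psi> v) (1 * \<psi> v)"
      by (rule has_bochner_integral_mult_left) (use k1 in auto)
    have "(LINT x|lborel. ?k x * \<psi> x) - \<psi> v = (LINT x|lborel. ?k x * (\<psi> x - \<psi> v))"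
      using Bochner_Integration.integral_diff[OF int, of "\<lambda>x. ?k x * \<psi> v"] kv
      by (simp add: has_bochner_integral_iff right_diff_distrib)
    moreover have "ennreal (cmod (LINT x|lborel. ?k x * (\<psi> x - \<psi> v))) \<le> ennreal ((2 * C * L * ?I) / w)"
    proof -
      have "integrable lborel (\<lambda>x. ?k x * (\<psi> x - \<psi> v))"
        using Bochner_Integration.integrable_diff[OF int, of "\<lambda>x. ?k x * \<psi> v"] kv
        by (simp add: has_bochner_integral_iff right_diff_distrib)
      then have "ennreal (cmod (LINT x|lborel. ?k x * (\<psi> x - \<psi> v))) \<le>
         (\<integral>\<^sup>+x. ennreal (cmod (?k x * (\<psi> x - \<psi> v))) \<partial>lborel)"
        by (rule integral_norm_bound_ennreal)
      also have "\<dots> \<le> (\<integral>\<^sup>+x. ennreal (2 * C * L / w) * ennreal (w ^ ?n * tail_kernel (w *\<^sub>R (x - v))) \<partial>lborel)"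
      proof (rule nn_integral_mono)
        fix x
        let ?d = "w * norm (x - v) / 2"
        have d: "?d \<ge> 0" using w by simp
        have "cmod (q0_kernel \<phi> (t + w *\<^sub>R x) (t + w *\<^sub>R v)) \<le> C * (E ?d / (1 + ?d) ^ (?n + 2))"
          using C(2)[of "t + w *\<^sub>R x" "t + w *\<^sub>R v"] w by (simp flip: scaleR_diff_right)
        also have "\<dots> \<le> C * (1 / (1 + ?d) ^ (?n + 2))"
          using d by (intro mult_left_mono divide_right_mono E_le_1 C(1)) auto
        finally have "cmod (?k x * (\<psi> x - \<psi> v)) \<le> w ^ ?n * (C * (1 / (1 + ?d) ^ (?n + 2))) * (L * norm (x - v))"
          unfolding norm_mult using w C(1) d
          by (intro mult_mono lipschitz) (auto simp: norm_power)
        also have "\<dots> = 2 * C * L / w * (w ^ ?n * (?d / (1 + ?d) ^ (?n + 2)))"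
          using w by (simp add: field_simps)
        also have "\<dots> \<le> 2 * C * L / w * (w ^ ?n * tail_kernel (w *\<^sub>R (x - v)))"
        proof -
          have "?d / (1 + ?d) ^ (?n + 2) \<le> (1 + ?d) / (1 + ?d) ^ (?n + 2)"
            using d by (intro divide_right_mono) auto
          also have "\<dots> = 1 / (1 + ?d) ^ (?n + 1)" proof -
            have "(1 + ?d) ^ (?n + 2) = (1 + ?d) * (1 + ?d) ^ (?n + 1)" by simp
            then show ?thesis using d by (simp only: divide_divide_eq_left[symmetric] divide_self_if) simp
          qed
          also have "\<dots> = tail_kernel (w *\<^sub>R (x - v))" using w by (simp add: tail_kernel_def)
          finally show ?thesis using w C(1) L by (intro mult_left_mono) auto
        qed
        finally show "ennreal (cmod (?k x * (\<psi> x - \<psi> v))) \<le> ennreal (2 * C * L / w) * ennreal (w ^ ?n * tail_kernel (w *\<^sub>R (x - v)))"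
          using w C(1) L by (subst ennreal_mult[symmetric]) (auto simp: tail_kernel_nonneg intro!: ennreal_leI)
      qed
      also have "\<dots> = ennreal (2 * C * L / w) * ennreal ?I"
        by (subst nn_integral_cmult) (simp_all only: nn_integral_scaled_tail[OF w], measurable)
      also have "\<dots> = ennreal ((2 * C * L / w) * ?I)"
        using w C(1) L by (intro ennreal_mult[symmetric] integral_nonneg_AE) (auto simp: tail_kernel_nonneg)
      finally show ?thesis by simp
    qed
    moreover have "0 \<le> (2 * C * L * ?I) / w"
      using w C(1) L by (intro divide_nonneg_nonneg mult_nonneg_nonneg integral_nonneg_AE) (auto simp: tail_kernel_nonneg)
    ultimately show ?thesis by (simp only: ennreal_le_iff)
  qed
  moreover have "0 \<le> 2 * C * L * ?I"
    using C(1) L by (intro mult_nonneg_nonneg integral_nonneg_AE) (auto simp: tail_kernel_nonneg)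
  ultimately show ?thesis by blast
qed

end

section \<open>Comparing the smeared measure with the measure itself\<close>

abbreviation (input) blowup ::
    "(real^'n \<Rightarrow> complex) \<Rightarrow> (real^'n) measure \<Rightarrow> real \<Rightarrow> real^'n \<Rightarrow> real \<Rightarrow> real^'n \<Rightarrow> complex" where
  "blowup \<phi> \<mu> \<alpha> x0 \<epsilon> \<equiv>
     (\<lambda>x. q_operator \<phi> (1 / \<epsilon>) \<mu> (x0 + \<epsilon> *\<^sub>R x) / complex_of_real (\<epsilon> powr (\<alpha> - real CARD('n))))"

lemma radon_measure_sigma_finite:
  assumes "radon_measure \<mu>" shows "sigma_finite_measure \<mu>"
proof
  have sets: "sets \<mu> = sets borel" and fin: "\<And>K. compact K \<Longrightarrow> emeasure \<mu> K < \<infinity>"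
    using assms by (auto simp: radon_measure_def)
  have "(\<Union>k::nat. cball 0 (real k)) = (UNIV :: (real^'n) set)"
  proof -
    have "\<exists>k::nat. x \<in> cball 0 (real k)" for x :: "real^'n"
      using real_arch_simple[of "norm x"] by simp
    then show ?thesis by auto
  qed
  then show "\<exists>A. countable A \<and> A \<subseteq> sets \<mu> \<and> \<Union> A = space \<mu> \<and> (\<forall>a\<in>A. emeasure \<mu> a \<noteq> \<infinity>)"
    using sets fin[OF compact_cball] sets_eq_imp_space_eq[OF sets]
    by (intro exI[of _ "range (\<lambda>k::nat. cball 0 (real k))"]) (auto simp: less_top)
qed

context regular_scaling begin

text \<open>By Fubini the pairing is \<epsilon> powr (-\<alpha>) times the integral of
  \<open>I y\<close> against \<mu>, and \<open>I y\<close> is compared with \<psi> at the blown-up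
  point \<open>v y\<close>. Near the origin the approximation estimate applies; far away \<psi>
  vanishes and the far estimate bounds \<open>I y\<close>. For \<epsilon> \<le> 1 the near zone lies
  in a fixed ball around \<open>x0\<close>, so both errors are at most a constant over w times one
  integrable function.\<close>

lemma pairing_error_bound:
  fixes \<mu> :: "(real^'n) measure" and \<psi> :: "real^'n \<Rightarrow> complex"
  assumes radon: "radon_measure \<mu>"
    and E_int: "(\<integral>\<^sup>+y. ennreal (E (t0 * norm (y - x0))) \<partial>\<mu>) < \<infinity>" and t0: "t0 > 0"
    and [measurable]: "\<psi> \<in> borel_measurable borel" and bounded: "\<And>x. cmod (\<psi> x) \<le> B"
    and lipschitz: "\<And>x y. cmod (\<psi> x - \<psi> y) \<le> L * norm (x - y)"
    and R: "R > 0" and supp: "\<And>x. norm x > R \<Longrightarrow> \<psi> x = 0"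
  shows "\<exists>D. \<forall>\<epsilon>. 0 < \<epsilon> \<and> \<epsilon> \<le> 1 \<and> 4 * t0 \<le> 2 powr (1 / \<epsilon>) \<longrightarrow>
    cmod (pairing (blowup \<phi> \<mu> \<alpha> x0 \<epsilon>) \<psi>
      - complex_of_real (\<epsilon> powr - \<alpha>) * (LINT y|\<mu>. \<psi> ((1 / \<epsilon>) *\<^sub>R (y - x0))))
      \<le> D * (\<epsilon> powr - \<alpha> / (2 powr (1 / \<epsilon>) * \<epsilon>))"
proof -
  let ?n = "CARD('n)"
  have sets_mu [measurable_cong]: "sets \<mu> = sets borel" and fin: "\<And>K. compact K \<Longrightarrow> emeasure \<mu> K < \<infinity>"
    using radon by (auto simp: radon_measure_def)
  interpret mu: sigma_finite_measure \<mu> by (rule radon_measure_sigma_finite[OF radon])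
  interpret P: pair_sigma_finite "lborel :: (real^'n) measure" \<mu> ..
  obtain C1 where C1: "C1 \<ge> 0" "\<And>w t v. w > 0 \<Longrightarrow> scaled_mass w t v \<psi> \<le> ennreal C1"
    using scaled_kernel_near[OF assms(4) bounded] by blast
  obtain C2 where C2: "C2 \<ge> 0" "\<And>w t v. w > 0 \<Longrightarrow> norm v > 2 * R \<Longrightarrow> scaled_mass w t v \<psi> \<le> ennreal (C2 / w * E (w * norm v / 4))"
    using scaled_kernel_far[OF assms(4) bounded R supp] by blast
  obtain C3 where C3: "C3 \<ge> 0" "\<And>w t v. w > 0 \<Longrightarrow> cmod ((LINT x|lborel. scaled_kernel w t v x * \<psi> x) - \<psi> v) \<le> C3 / w"
    using scaled_kernel_approximation[OF assms(4) bounded lipschitz] by blast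
  define C where "C = max C2 C3"
  define ball2 where "ball2 = cball x0 (2 * R)"
  define e where "e y = E (t0 * norm (y - x0))" for y
  have [measurable]: "ball2 \<in> sets borel" "e \<in> borel_measurable borel"
    unfolding ball2_def e_def by measurable
  have e_nonneg: "0 \<le> e y" for y by (simp add: e_def E_nonneg)
  have e_int: "integrable \<mu> e"
    using E_int by (intro integrableI_bounded) (auto simp: e_def E_nonneg)
  have ball_int: "integrable \<mu> (indicator ball2 :: _ \<Rightarrow> real)"
    using fin[of ball2] by (intro integrable_real_indicator) (auto simp: ball2_def)
  define T where "T = (LINT y|\<mu>. indicator ball2 y + e y)"
  have "cmod (pairing (blowup \<phi> \<mu> \<alpha> x0 \<epsilon>) \<psi>
      - complex_of_real (\<epsilon> powr - \<alpha>) * (LINT y|\<mu>. \<psi> ((1 / \<epsilon>) *\<^sub>R (y - x0))))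
      \<le> C * T * (\<epsilon> powr - \<alpha> / (2 powr (1 / \<epsilon>) * \<epsilon>))"
    if eps: "0 < \<epsilon>" "\<epsilon> \<le> 1" "4 * t0 \<le> 2 powr (1 / \<epsilon>)" for \<epsilon>
  proof -
    define c where "c = 2 powr (1 / \<epsilon>)"
    define w where "w = c * \<epsilon>"
    define v where "v y = (1 / \<epsilon>) *\<^sub>R (y - x0)" for y
    have c: "c > 0" and w: "w > 0" using eps by (auto simp: c_def w_def)
    have [measurable]: "v \<in> borel_measurable borel" unfolding v_def by measurable
    define k where "k x y = scaled_kernel w (c *\<^sub>R x0) (v y) x" for x y
    \<comment> \<open>Bookkeeping of powers: c^n / \<epsilon> powr (\<alpha> - n) = \<epsilon> powr
      (-\<alpha>) * (c * \<epsilon>)^n, and c * \<epsilon> is w.\<close>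
    have k_eq: "q_kernel \<phi> (1 / \<epsilon>) (x0 + \<epsilon> *\<^sub>R x) y / complex_of_real (\<epsilon> powr (\<alpha> - real ?n))
        = complex_of_real (\<epsilon> powr - \<alpha>) * k x y" for x y
    proof -
      have "2 powr (real ?n * (1 / \<epsilon>)) = c ^ ?n"
        using c unfolding c_def by (subst powr_realpow[symmetric]) (auto simp: powr_powr mult.commute)
      moreover have "complex_of_real (\<epsilon> powr \<alpha>) = complex_of_real \<epsilon> ^ ?n * complex_of_real (\<epsilon> powr (\<alpha> - real ?n))"
        using eps by (simp add: powr_diff powr_realpow)
      moreover have "c *\<^sub>R y = c *\<^sub>R x0 + w *\<^sub>R v y"
        using eps by (simp add: w_def v_def scaleR_diff_right)
      ultimately show ?thesis
        using eps unfolding q_kernel_def k_def w_def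
        by (simp add: c_def[symmetric] powr_minus field_simps scaleR_add_right power_mult_distrib)
    qed
    have norm_v: "norm (v y) = norm (y - x0) / \<epsilon>" for y
      using eps by (simp add: v_def)
    have near: "y \<in> ball2" if "\<not> norm (v y) > 2 * R" for y
    proof -
      have "norm (y - x0) \<le> 2 * R * \<epsilon>" using that eps by (simp add: norm_v field_simps)
      also have "\<dots> \<le> 2 * R" using eps R by (simp add: mult_left_le)
      finally show ?thesis by (simp add: ball2_def dist_norm norm_minus_commute)
    qed
    \<comment> \<open>Since w |v y| is c |y - x0|, the threshold 4 * t0 \<le> c is what compares the
      weight of the far estimate with the integrable one.\<close>
    have E_le: "E (w * norm (v y) / 4) \<le> e y" for y
    proof -
      have "t0 * norm (y - x0) \<le> c / 4 * norm (y - x0)"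
        using eps(3) by (intro mult_right_mono) (auto simp: c_def)
      also have "\<dots> = w * norm (v y) / 4" using eps by (simp add: norm_v w_def)
      finally show ?thesis unfolding e_def using t0 by (intro E_antimono) auto
    qed
    \<comment> \<open>The majorant has finite integral against \<mu>: a compact ball plus the
      weight. This is the absolute bound required by Fubini.\<close>
    have k_abs: "(\<integral>\<^sup>+x. ennreal (cmod (k x y * \<psi> x)) \<partial>lborel) \<le> ennreal C1 * indicator ball2 y + ennreal (C2 / w) * ennreal (e y)" for y
    proof (cases "norm (v y) > 2 * R")
      case True
      have "(\<integral>\<^sup>+x. ennreal (cmod (k x y * \<psi> x)) \<partial>lborel) \<le> ennreal (C2 / w * E (w * norm (v y) / 4))"
        unfolding k_def by (rule C2(2)[OF w True])
      also have "\<dots> \<le> ennreal (C2 / w * e y)"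
        using C2(1) w by (intro ennreal_leI mult_left_mono E_le) auto
      also have "\<dots> = ennreal (C2 / w) * ennreal (e y)"
        using C2(1) w e_nonneg by (intro ennreal_mult) auto
      finally show ?thesis by (rule order_trans) simp
    next
      case False
      have "(\<integral>\<^sup>+x. ennreal (cmod (k x y * \<psi> x)) \<partial>lborel) \<le> ennreal C1 * indicator ball2 y"
        unfolding k_def using C1(2)[OF w] near[OF False] by simp
      then show ?thesis by (rule order_trans) simp
    qed
    have k_meas [measurable]: "(\<lambda>(x, y). k x y * \<psi> x) \<in> borel_measurable (lborel \<Otimes>\<^sub>M \<mu>)"
      unfolding k_def by measurable
    have k_int: "integrable (lborel \<Otimes>\<^sub>M \<mu>) (\<lambda>(x, y). k x y * \<psi> x)"
    proof (rule integrableI_bounded[OF k_meas])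
      have "(\<integral>\<^sup>+z. ennreal (cmod (case z of (x, y) \<Rightarrow> k x y * \<psi> x)) \<partial>(lborel \<Otimes>\<^sub>M \<mu>)) =
         (\<integral>\<^sup>+y. (\<integral>\<^sup>+x. ennreal (cmod (k x y * \<psi> x)) \<partial>lborel) \<partial>\<mu>)"
        by (subst P.nn_integral_snd[symmetric]) auto
      also have "\<dots> \<le> (\<integral>\<^sup>+y. ennreal C1 * indicator ball2 y + ennreal (C2 / w) * ennreal (e y) \<partial>\<mu>)"
        by (intro nn_integral_mono k_abs)
      also have "\<dots> = ennreal C1 * emeasure \<mu> ball2 + ennreal (C2 / w) * (\<integral>\<^sup>+y. ennreal (e y) \<partial>\<mu>)"
        by (simp add: nn_integral_add nn_integral_cmult nn_integral_cmult_indicator sets_mu)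
      also have "\<dots> < \<infinity>"
        using fin[of ball2] E_int by (auto simp: ball2_def e_def ennreal_mult_less_top)
      finally show "(\<integral>\<^sup>+z. ennreal (cmod (case z of (x, y) \<Rightarrow> k x y * \<psi> x)) \<partial>(lborel \<Otimes>\<^sub>M \<mu>)) < \<infinity>" .
    qed
    define I where "I y = (LINT x|lborel. k x y * \<psi> x)" for y
    have I_int: "integrable \<mu> I"
      using P.integrable_snd[OF k_int] by (simp add: I_def[abs_def])
    have "pairing (blowup \<phi> \<mu> \<alpha> x0 \<epsilon>) \<psi>
       = (LINT x|lborel. complex_of_real (\<epsilon> powr - \<alpha>) * (LINT y|\<mu>. k x y * \<psi> x))"
      unfolding pairing_def q_operator_def
    proof (intro Bochner_Integration.integral_cong refl)
      fix x
      have "(LINT y|\<mu>. q_kernel \<phi> (1 / \<epsilon>) (x0 + \<epsilon> *\<^sub>R x) y) / complex_of_real (\<epsilon> powr (\<alpha> - real ?n))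
        = (LINT y|\<mu>. q_kernel \<phi> (1 / \<epsilon>) (x0 + \<epsilon> *\<^sub>R x) y / complex_of_real (\<epsilon> powr (\<alpha> - real ?n)))"
        by (rule integral_divide_zero[symmetric])
      then show "(LINT y|\<mu>. q_kernel \<phi> (1 / \<epsilon>) (x0 + \<epsilon> *\<^sub>R x) y) / complex_of_real (\<epsilon> powr (\<alpha> - real ?n)) * \<psi> x
         = complex_of_real (\<epsilon> powr - \<alpha>) * (LINT y|\<mu>. k x y * \<psi> x)"
        by (simp add: k_eq)
    qed
    also have "\<dots> = complex_of_real (\<epsilon> powr - \<alpha>) * (LINT y|\<mu>. I y)"
      using P.Fubini_integral[OF k_int] by (simp add: I_def)
    finally have pairing_eq: "pairing (blowup \<phi> \<mu> \<alpha> x0 \<epsilon>) \<psi>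
       = complex_of_real (\<epsilon> powr - \<alpha>) * (LINT y|\<mu>. I y)" .
    have psi_int: "integrable \<mu> (\<lambda>y. \<psi> (v y))"
    proof (rule Bochner_Integration.integrable_bound[OF integrable_mult_right[OF ball_int, of B]])
      show "AE y in \<mu>. cmod (\<psi> (v y)) \<le> norm (B * indicator ball2 y)"
      proof (rule AE_I2)
        fix y
        show "cmod (\<psi> (v y)) \<le> norm (B * indicator ball2 y)"
          using bounded[of "v y"] supp[of "v y"] near[of y] R
          by (cases "norm (v y) > 2 * R") (auto intro: order_trans[OF _ abs_ge_self])
      qed
    qed measurable
    have diff: "cmod (I y - \<psi> (v y)) \<le> C / w * (indicator ball2 y + e y)" for y
    proof (cases "norm (v y) > 2 * R")
      case True
      have "ennreal (cmod (I y)) \<le> (\<integral>\<^sup>+x. ennreal (cmod (k x y * \<psi> x)) \<partial>lborel)"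
        unfolding I_def
      proof (rule integral_norm_bound_ennreal, rule integrableI_bounded)
        show "(\<integral>\<^sup>+x. ennreal (cmod (k x y * \<psi> x)) \<partial>lborel) < \<infinity>"
          unfolding k_def using le_less_trans[OF C1(2)[OF w] ennreal_less_top] by simp
      qed (simp add: k_def)
      also have "\<dots> \<le> ennreal (C2 / w * E (w * norm (v y) / 4))"
        unfolding k_def by (rule C2(2)[OF w True])
      finally have "cmod (I y) \<le> C2 / w * E (w * norm (v y) / 4)"
        using C2(1) w E_nonneg by (subst (asm) ennreal_le_iff) auto
      also have "\<dots> \<le> C / w * e y"
        using C2(1) w by (intro mult_mono E_le divide_right_mono) (auto simp: C_def E_nonneg)
      also have "\<dots> \<le> C / w * (indicator ball2 y + e y)"
        using C2(1) w by (intro mult_left_mono) (auto simp: C_def)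
      finally show ?thesis using True R supp[of "v y"] by simp
    next
      case False
      have "cmod (I y - \<psi> (v y)) \<le> C3 / w"
        unfolding I_def k_def by (rule C3(2)[OF w])
      also have "\<dots> \<le> C / w * 1" using w by (simp add: C_def divide_right_mono)
      also have "\<dots> \<le> C / w * (indicator ball2 y + e y)"
        using near[OF False] C2(1) w e_nonneg by (intro mult_left_mono) (auto simp: C_def)
      finally show ?thesis .
    qed
    have "cmod ((LINT y|\<mu>. I y) - (LINT y|\<mu>. \<psi> (v y))) = cmod (LINT y|\<mu>. I y - \<psi> (v y))"
      by (simp add: Bochner_Integration.integral_diff I_int psi_int)
    also have "\<dots> \<le> (LINT y|\<mu>. C / w * (indicator ball2 y + e y))"
      by (intro order_trans[OF integral_norm_bound integral_mono] integrable_norm diff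
          Bochner_Integration.integrable_diff Bochner_Integration.integrable_add integrable_mult_right
          I_int psi_int ball_int e_int)
    also have "\<dots> = C * T / w" by (simp add: T_def)
    finally have main: "cmod ((LINT y|\<mu>. I y) - (LINT y|\<mu>. \<psi> (v y))) \<le> C * T / w" .
    have "cmod (complex_of_real (\<epsilon> powr - \<alpha>) * (LINT y|\<mu>. I y) - complex_of_real (\<epsilon> powr - \<alpha>) * (LINT y|\<mu>. \<psi> (v y)))
       = \<epsilon> powr - \<alpha> * cmod ((LINT y|\<mu>. I y) - (LINT y|\<mu>. \<psi> (v y)))"
      by (simp add: norm_mult flip: right_diff_distrib)
    also have "\<dots> \<le> \<epsilon> powr - \<alpha> * (C * T / w)"
      by (intro mult_left_mono main) simp
    finally show ?thesis
      unfolding pairing_eq v_def[symmetric] by (simp add: w_def c_def mult_ac)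
  qed
  then show ?thesis by blast
qed

lemma pairing_asymptotics:
  fixes \<mu> :: "(real^'n) measure" and \<psi> :: "real^'n \<Rightarrow> complex"
  assumes "radon_measure \<mu>"
    and "(\<integral>\<^sup>+y. ennreal (E (t0 * norm (y - x0))) \<partial>\<mu>) < \<infinity>" and "t0 > 0"
    and "\<psi> \<in> borel_measurable borel" and "\<And>x. cmod (\<psi> x) \<le> B"
    and "\<And>x y. cmod (\<psi> x - \<psi> y) \<le> L * norm (x - y)"
    and "R > 0" and "\<And>x. norm x > R \<Longrightarrow> \<psi> x = 0"
  shows "((\<lambda>\<epsilon>. pairing (blowup \<phi> \<mu> \<alpha> x0 \<epsilon>) \<psi>
      - complex_of_real (\<epsilon> powr - \<alpha>) * (LINT y|\<mu>. \<psi> ((1 / \<epsilon>) *\<^sub>R (y - x0)))) \<longlongrightarrow> 0) (at_right 0)"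
proof -
  obtain D where D: "\<And>\<epsilon>. 0 < \<epsilon> \<Longrightarrow> \<epsilon> \<le> 1 \<Longrightarrow> 4 * t0 \<le> 2 powr (1 / \<epsilon>) \<Longrightarrow>
    cmod (pairing (blowup \<phi> \<mu> \<alpha> x0 \<epsilon>) \<psi>
      - complex_of_real (\<epsilon> powr - \<alpha>) * (LINT y|\<mu>. \<psi> ((1 / \<epsilon>) *\<^sub>R (y - x0))))
      \<le> D * (\<epsilon> powr - \<alpha> / (2 powr (1 / \<epsilon>) * \<epsilon>))"
    using pairing_error_bound[OF assms, of \<alpha>] by blast
  show ?thesis
  proof (rule Lim_null_comparison)
    have "filterlim (\<lambda>\<epsilon>::real. 2 powr (1 / \<epsilon>)) at_top (at_right 0)"
      by real_asymp
    then have "\<forall>\<^sub>F \<epsilon> in at_right 0. 4 * t0 \<le> 2 powr (1 / \<epsilon>)"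
      by (rule filterlim_at_top[THEN iffD1, rule_format])
    moreover have "\<forall>\<^sub>F \<epsilon> in at_right (0::real). 0 < \<epsilon> \<and> \<epsilon> \<le> 1"
      by (rule eventually_at_rightI[of _ 1]) auto
    ultimately show "\<forall>\<^sub>F \<epsilon> in at_right 0.
      norm (pairing (blowup \<phi> \<mu> \<alpha> x0 \<epsilon>) \<psi>
      - complex_of_real (\<epsilon> powr - \<alpha>) * (LINT y|\<mu>. \<psi> ((1 / \<epsilon>) *\<^sub>R (y - x0))))
      \<le> D * (\<epsilon> powr - \<alpha> / (2 powr (1 / \<epsilon>) * \<epsilon>))"
      by eventually_elim (use D in auto)
    have "((\<lambda>\<epsilon>. \<epsilon> powr - \<alpha> / (2 powr (1 / \<epsilon>) * \<epsilon>)) \<longlongrightarrow> 0) (at_right 0)"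
      by real_asymp
    then show "((\<lambda>\<epsilon>. D * (\<epsilon> powr - \<alpha> / (2 powr (1 / \<epsilon>) * \<epsilon>))) \<longlongrightarrow> 0) (at_right 0)"
      by (rule tendsto_mult_right_zero)
  qed
qed

end

subsection \<open>Test functions\<close>

lemma C_space_continuous: "f \<in> C_space r \<Longrightarrow> continuous_on UNIV f"
  by (cases r) auto

lemma C_space_SucI:
  assumes "continuous_on UNIV f"
    and "\<And>i x. ((\<lambda>t::real. f (x + t *\<^sub>R axis i 1)) has_vector_derivative g i x) (at 0)"
    and "\<And>i. g i \<in> C_space r"
  shows "f \<in> C_space (Suc r)"
proof -
  have "partial_deriv i f = g i" for i
    using assms(2) by (auto simp: partial_deriv_def fun_eq_iff vector_derivative_at)
  then show ?thesis
    using assms by (auto intro: differentiableI_vector)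
qed

lemma C_space_SucD:
  assumes "f \<in> C_space (Suc r)"
  shows "((\<lambda>t::real. f (x + t *\<^sub>R axis i 1)) has_vector_derivative partial_deriv i f x) (at 0)"
    and "partial_deriv i f \<in> C_space r"
proof -
  have "(\<lambda>t::real. f (x + t *\<^sub>R axis i 1)) differentiable (at 0)"
    using assms by simp
  then show "((\<lambda>t::real. f (x + t *\<^sub>R axis i 1)) has_vector_derivative partial_deriv i f x) (at 0)"
    unfolding partial_deriv_def by (rule vector_derivative_works[THEN iffD1])
  show "partial_deriv i f \<in> C_space r" using assms by simp
qed

lemma C_space_mono: "f \<in> C_space (Suc r) \<Longrightarrow> f \<in> C_space r"
proof (induction r arbitrary: f)
  case (Suc r)
  have "partial_deriv i f \<in> C_space r" for i
    using Suc.prems by (intro Suc.IH C_space_SucD(2))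
  then show ?case using Suc.prems by simp
qed simp

lemma C_space_const: "(\<lambda>x. c) \<in> C_space r"
proof (induction r arbitrary: c)
  case (Suc r)
  show ?case
    by (rule C_space_SucI[where g="\<lambda>i x. 0"]) (auto intro!: Suc)
qed simp

lemma C_space_add: "f \<in> C_space r \<Longrightarrow> g \<in> C_space r \<Longrightarrow> (\<lambda>x. f x + g x) \<in> C_space r"
proof (induction r arbitrary: f g)
  case (Suc r)
  show ?case
    by (rule C_space_SucI[where g="\<lambda>i x. partial_deriv i f x + partial_deriv i g x"])
       (use Suc.prems in \<open>auto intro!: continuous_on_add Suc.IH C_space_SucD has_vector_derivative_add
          simp del: C_space.simps intro: C_space_continuous\<close>)
qed (auto intro: continuous_on_add)

lemma C_space_mult: "f \<in> C_space r \<Longrightarrow> g \<in> C_space r \<Longrightarrow> (\<lambda>x. f x * g x) \<in> C_space r"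
proof (induction r arbitrary: f g)
  case (Suc r)
  show ?case
  proof (rule C_space_SucI[where g="\<lambda>i x. f x * partial_deriv i g x + partial_deriv i f x * g x"])
    show "continuous_on UNIV (\<lambda>x. f x * g x)"
      using Suc.prems by (intro continuous_on_mult C_space_continuous)
    show "((\<lambda>t. f (x + t *\<^sub>R axis i 1) * g (x + t *\<^sub>R axis i 1)) has_vector_derivative
        f x * partial_deriv i g x + partial_deriv i f x * g x) (at 0)" for i x
      using has_vector_derivative_mult[OF C_space_SucD(1)[OF Suc.prems(1), of x i] C_space_SucD(1)[OF Suc.prems(2), of x i]]
      by simp
    show "(\<lambda>x. f x * partial_deriv i g x + partial_deriv i f x * g x) \<in> C_space r" for i
      by (intro C_space_add Suc.IH C_space_SucD(2) Suc.prems C_space_mono[OF Suc.prems(1)] C_space_mono[OF Suc.prems(2)])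
  qed
qed (auto intro: continuous_on_mult)

lemma C_space_component: "(\<lambda>x::real^'n. complex_of_real (x $ i)) \<in> C_space r"
proof (cases r)
  case (Suc r)
  show ?thesis unfolding Suc
  proof (rule C_space_SucI[where g="\<lambda>j x. complex_of_real (axis j 1 $ i)"])
    show "((\<lambda>t. complex_of_real ((x + t *\<^sub>R axis j 1) $ i)) has_vector_derivative complex_of_real (axis j 1 $ i)) (at 0)"
      for j and x :: "real^'n"
    proof -
      have "((\<lambda>t. x $ i + t * axis j 1 $ i) has_real_derivative axis j 1 $ i) (at 0)"
        by (auto intro!: derivative_eq_intros)
      from has_vector_derivative_of_real[OF this]
      show ?thesis by simp
    qed
  qed (auto intro!: continuous_intros C_space_const)
qed (auto intro!: continuous_intros)

lemma C_space_norm_square: "(\<lambda>x::real^'n. complex_of_real ((norm x)\<^sup>2)) \<in> C_space r"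
proof -
  have "(\<lambda>x. \<Sum>i\<in>F. complex_of_real (x $ i) * complex_of_real (x $ i)) \<in> C_space r" if "finite F" for F :: "'n set"
    using that by induction (auto intro!: C_space_const C_space_add C_space_mult C_space_component)
  from this[OF finite[of UNIV]] show ?thesis
    by (simp add: power2_norm_eq_inner inner_vec_def)
qed

text \<open>At 0 the difference quotient is at most a positive power of the positive part of h, so
  it tends to 0. The exponent starts at 2 because the positive part itself has a corner.\<close>

lemma has_real_derivative_pos_part_power:
  "((\<lambda>s::real. max 0 s ^ (Suc (Suc k))) has_real_derivative real (Suc (Suc k)) * max 0 s ^ Suc k) (at s)"
proof -
  consider "s > 0" | "s < 0" | "s = 0" by linarith
  then show ?thesis
  proof cases
    case 1
    have "((\<lambda>s::real. s ^ (Suc (Suc k))) has_real_derivative real (Suc (Suc k)) * s ^ Suc k) (at s)"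
      using DERIV_pow[of "Suc (Suc k)" s] by simp
    moreover have "\<forall>\<^sub>F x in nhds s. x ^ (Suc (Suc k)) = max 0 x ^ (Suc (Suc k))"
      using eventually_nhds_in_open[OF open_greaterThan, of s 0] 1
      by (auto elim!: eventually_mono simp: max_def)
    ultimately show ?thesis using 1 by (subst (asm) DERIV_cong_ev) auto
  next
    case 2
    have "((\<lambda>s::real. 0) has_real_derivative 0) (at s)" by simp
    moreover have "\<forall>\<^sub>F x in nhds s. 0 = max 0 x ^ (Suc (Suc k))"
      using eventually_nhds_in_open[OF open_lessThan, of s 0] 2
      by (auto elim!: eventually_mono simp: max_def)
    ultimately show ?thesis using 2 by (subst (asm) DERIV_cong_ev) auto
  next
    case 3
    have "((\<lambda>h::real. max 0 h ^ (Suc (Suc k)) / h) \<longlongrightarrow> 0) (at 0)"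
    proof (rule Lim_null_comparison)
      show "\<forall>\<^sub>F h in at 0. norm (max 0 h ^ (Suc (Suc k)) / h) \<le> max 0 h ^ Suc k"
        by (intro always_eventually allI) (auto simp: max_def)
      have "((\<lambda>h::real. max 0 h ^ Suc k) \<longlongrightarrow> max 0 0 ^ Suc k) (at 0)"
        by (intro tendsto_intros)
      then show "((\<lambda>h::real. max 0 h ^ Suc k) \<longlongrightarrow> 0) (at 0)" by simp
    qed
    then show ?thesis using 3 by (simp add: DERIV_def)
  qed
qed

text \<open>Each differentiation lowers the exponent of the truncated power by one and multiplies by
  a derivative of u; the exponent k + 1 > r leaves a continuous factor after r steps.\<close>

lemma C_space_pos_part_power:
  fixes u :: "real^'n \<Rightarrow> real"
  assumes "(\<lambda>x. complex_of_real (u x)) \<in> C_space r" "r \<le> k"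
  shows "(\<lambda>x. complex_of_real (max 0 (u x) ^ Suc k)) \<in> C_space r"
  using assms
proof (induction r arbitrary: k)
  case 0
  have "continuous_on UNIV (\<lambda>x. Re (complex_of_real (u x)))"
    using 0(1) by (intro continuous_on_Re) auto
  then have "continuous_on UNIV u" by simp
  then show ?case by (auto intro!: continuous_intros)
next
  case (Suc r)
  have cont: "continuous_on UNIV u"
    using continuous_on_Re[OF C_space_continuous[OF Suc.prems(1)]] by simp
  obtain k' where k: "k = Suc k'" and rk: "r \<le> k'" using Suc.prems(2) by (cases k) auto
  \<comment> \<open>\<open>C_space\<close> consists of complex-valued functions. The real part
    provides the real derivative needed for the chain rule, and uniqueness of derivatives in
    \<open>du_eq\<close> leads back to \<open>partial_deriv\<close>.\<close>
  define du where "du i x = Re (partial_deriv i (\<lambda>x. complex_of_real (u x)) x)" for i x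
  have du: "((\<lambda>t. u (x + t *\<^sub>R axis i 1)) has_real_derivative du i x) (at 0)" for i x
    using bounded_linear.has_vector_derivative[OF bounded_linear_Re C_space_SucD(1)[OF Suc.prems(1), of x i]]
    by (simp add: du_def has_real_derivative_iff_has_vector_derivative)
  have du_eq: "complex_of_real (du i x) = partial_deriv i (\<lambda>x. complex_of_real (u x)) x" for i x
    using has_vector_derivative_of_real[OF du[of x i]]
      C_space_SucD(1)[OF Suc.prems(1), of x i] by (rule vector_derivative_unique_at)
  show ?case
  proof (rule C_space_SucI[where g="\<lambda>i x. complex_of_real (real (Suc k)) *
      (complex_of_real (max 0 (u x) ^ Suc k') * partial_deriv i (\<lambda>x. complex_of_real (u x)) x)"])
    show "continuous_on UNIV (\<lambda>x. complex_of_real (max 0 (u x) ^ Suc k))"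
      using cont by (intro continuous_intros)
    show "((\<lambda>t. complex_of_real (max 0 (u (x + t *\<^sub>R axis i 1)) ^ Suc k)) has_vector_derivative
       complex_of_real (real (Suc k)) * (complex_of_real (max 0 (u x) ^ Suc k') * partial_deriv i (\<lambda>x. complex_of_real (u x)) x)) (at 0)"
      for i x
    proof -
      have "((\<lambda>t. max 0 (u (x + t *\<^sub>R axis i 1)) ^ Suc k) has_real_derivative
         real (Suc k) * max 0 (u x) ^ Suc k' * du i x) (at 0)"
        using DERIV_chain2[OF has_real_derivative_pos_part_power du[of x i], of k'] by (simp add: k)
      then have "((\<lambda>t. complex_of_real (max 0 (u (x + t *\<^sub>R axis i 1)) ^ Suc k)) has_vector_derivative
         complex_of_real (real (Suc k) * max 0 (u x) ^ Suc k' * du i x)) (at 0)"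
        by (rule has_vector_derivative_of_real)
      then show ?thesis by (simp only: of_real_mult du_eq mult.assoc)
    qed
    show "(\<lambda>x. complex_of_real (real (Suc k)) * (complex_of_real (max 0 (u x) ^ Suc k') *
        partial_deriv i (\<lambda>x. complex_of_real (u x)) x)) \<in> C_space r" for i
      by (intro C_space_mult C_space_const Suc.IH rk C_space_mono[OF Suc.prems(1)] C_space_SucD(2)[OF Suc.prems(1)])
  qed
qed

lemma iter_partial_deriv_compact_support:
  assumes "f \<in> C_space r" "\<And>x. norm x > R \<Longrightarrow> f x = 0" "length w \<le> r"
  shows "continuous_on UNIV (iter_partial_deriv w f)"
    and "\<And>x. norm x > R \<Longrightarrow> iter_partial_deriv w f x = 0"
proof -
  have "continuous_on UNIV (iter_partial_deriv w f) \<and> (\<forall>x. norm x > R \<longrightarrow> iter_partial_deriv w f x = 0)"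
    using assms
  proof (induction w arbitrary: f r)
    case Nil
    then show ?case by (auto intro: C_space_continuous)
  next
    case (Cons i w)
    then obtain r' where r: "r = Suc r'" by (cases r) auto
    have "partial_deriv i f x = 0" if x: "norm x > R" for x
    proof -
      \<comment> \<open>The exterior of the closed ball is open, so f vanishes along a short segment
        through x and its directional derivative there is 0.\<close>
      have "\<forall>\<^sub>F t in nhds (0::real). x + t *\<^sub>R axis i 1 \<in> - cball 0 R"
      proof (rule topological_tendstoD)
        have "((\<lambda>t::real. x + t *\<^sub>R axis i 1) \<longlongrightarrow> x + 0 *\<^sub>R axis i 1) (nhds 0)"
          by (intro tendsto_intros filterlim_ident)
        then show "((\<lambda>t::real. x + t *\<^sub>R axis i 1) \<longlongrightarrow> x) (nhds 0)" by simp
      qed (use x in auto)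
      then have "\<forall>\<^sub>F t in nhds (0::real). f (x + t *\<^sub>R axis i 1) = 0"
        by eventually_elim (auto intro: Cons.prems(2))
      then have "((\<lambda>t. f (x + t *\<^sub>R axis i 1)) has_vector_derivative 0) (at 0)"
        by (subst has_vector_derivative_cong_ev[where g="\<lambda>_. 0"])
           (auto simp: Cons.prems(2)[OF x] elim: eventually_mono)
      then show ?thesis by (simp add: partial_deriv_def vector_derivative_at)
    qed
    then show ?case
      using Cons.IH[OF C_space_SucD(2)[of f r' i]] Cons.prems r by simp
  qed
  then show "continuous_on UNIV (iter_partial_deriv w f)"
    and "\<And>x. norm x > R \<Longrightarrow> iter_partial_deriv w f x = 0" by auto
qed

text \<open>There are finitely many words of length at most r, and each derivative is continuous and
  vanishes outside a compact ball. The weight W stands for that of either family of norms.\<close>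

lemma weighted_derivatives_bounded:
  fixes f :: "real^'n \<Rightarrow> complex"
  assumes f: "f \<in> C_space r" and supp: "\<And>x. norm x > R \<Longrightarrow> f x = 0"
    and W: "\<And>x::real^'n. 0 \<le> W x" "\<And>x::real^'n. norm x \<le> R \<Longrightarrow> W x \<le> K"
  shows "(SUP w\<in>{w. length w \<le> r}. SUP x. ennreal (W x * cmod (iter_partial_deriv w f x))) < \<infinity>"
proof -
  have "\<exists>B\<ge>0. \<forall>x. W x * cmod (iter_partial_deriv w f x) \<le> B" if "length w \<le> r" for w
  proof -
    have s: "continuous_on UNIV (iter_partial_deriv w f)" "\<And>x. norm x > R \<Longrightarrow> iter_partial_deriv w f x = 0"
      using iter_partial_deriv_compact_support[OF f _ that] supp by blast+
    have "compact (iter_partial_deriv w f ` cball 0 R)"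
      by (intro compact_continuous_image continuous_on_subset[OF s(1)]) auto
    then have "bounded (iter_partial_deriv w f ` cball 0 R)" by (rule compact_imp_bounded)
    then obtain B where "\<forall>x\<in>cball 0 R. cmod (iter_partial_deriv w f x) \<le> B"
      unfolding bounded_iff by auto
    then have B: "\<And>x. norm x \<le> R \<Longrightarrow> cmod (iter_partial_deriv w f x) \<le> B"
      by simp
    have "W x * cmod (iter_partial_deriv w f x) \<le> \<bar>K\<bar> * \<bar>B\<bar>" for x
    proof (cases "norm x \<le> R")
      case True
      then show ?thesis using W(2)[OF True] B[OF True] by (intro mult_mono) auto
    next
      case False
      then show ?thesis using s(2)[of x] by simp
    qed
    then show ?thesis by (intro exI[of _ "\<bar>K\<bar> * \<bar>B\<bar>"]) auto
  qed
  then obtain B where B: "\<And>w. length w \<le> r \<Longrightarrow> B w \<ge> 0"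
    "\<And>w x. length w \<le> r \<Longrightarrow> W x * cmod (iter_partial_deriv w f x) \<le> B w"
    by metis
  have fin: "finite {w::'n list. length w \<le> r}"
    using finite_lists_length_le[OF finite[of "UNIV :: 'n set"], of r] by simp
  have "(SUP w\<in>{w. length w \<le> r}. SUP x. ennreal (W x * cmod (iter_partial_deriv w f x)))
     \<le> ennreal (\<Sum>w | length w \<le> r. B w)"
  proof (intro SUP_least ennreal_leI)
    fix w :: "'n list" and x :: "real^'n" assume w: "w \<in> {w. length w \<le> r}"
    have "W x * cmod (iter_partial_deriv w f x) \<le> B w" using w B(2) by simp
    also have "\<dots> \<le> (\<Sum>w | length w \<le> r. B w)"
      using w B(1) fin by (intro member_le_sum) auto
    finally show "W x * cmod (iter_partial_deriv w f x) \<le> (\<Sum>w | length w \<le> r. B w)" .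
  qed
  then show ?thesis by (rule le_less_trans) simp
qed

lemma compact_support_in_S_space:
  fixes f :: "real^'n \<Rightarrow> complex"
  assumes "f \<in> C_space r" "\<And>x. norm x > R \<Longrightarrow> f x = 0"
  shows "f \<in> S_space r"
proof -
  have "rho r l f < \<infinity>" for l
    unfolding rho_def
    by (rule weighted_derivatives_bounded[where R=R and K="(1 + R) ^ l"])
       (use assms in \<open>auto intro: power_mono\<close>)
  then show ?thesis using assms(1) by (simp add: S_space_def)
qed

lemma compact_support_in_K_space:
  fixes f :: "real^'n \<Rightarrow> complex"
  assumes "weight_function M" "f \<in> C_space r" "\<And>x. norm x > R \<Longrightarrow> f x = 0"
  shows "f \<in> K_space M r"
proof -
  have le: "M (norm (real l *\<^sub>R x)) \<le> M (real l * R)" if "norm x \<le> R" for l and x :: "real^'n"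
  proof -
    have "norm (real l *\<^sub>R x) \<le> real l * R" using that by (simp add: mult_left_mono)
    moreover have "mono_on {0..} M" using assms(1) by (simp add: weight_function_def)
    moreover have "0 \<le> norm (real l *\<^sub>R x)" by simp
    ultimately show ?thesis
      by (intro mono_onD[of "{0..}" M]) (auto intro: order_trans[of 0 "norm (real l *\<^sub>R x)"])
  qed
  have "nu M r l f < \<infinity>" for l
    unfolding nu_def
    by (rule weighted_derivatives_bounded[where R=R and K="exp (M (real l * R))", OF assms(2,3)])
       (use le in auto)
  then show ?thesis using assms(2) by (simp add: K_space_def)
qed

text \<open>Runs from 0 at |x| = a to 1 at |x| = b. The square of the norm is a polynomial in the
  coordinates, whereas the norm is not differentiable at the origin.\<close>

abbreviation ramp :: "real \<Rightarrow> real \<Rightarrow> real^'n \<Rightarrow> real" where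
  "ramp a b x \<equiv> ((norm x)\<^sup>2 - a\<^sup>2) / (b\<^sup>2 - a\<^sup>2)"

text \<open>Truncated powers suffice for a cutoff of class \<open>C\<^sup>r\<close>, where only finitely many derivatives are needed.\<close>

definition cutoff :: "nat \<Rightarrow> real \<Rightarrow> real \<Rightarrow> real^'n \<Rightarrow> real" where
  "cutoff r a b x = max 0 (1 - max 0 (ramp a b x) ^ Suc r) ^ Suc r"

lemma cutoff_C_space: "(\<lambda>x::real^'n. complex_of_real (cutoff r a b x)) \<in> C_space r"
proof -
  have "(\<lambda>x::real^'n. complex_of_real (1 / (b\<^sup>2 - a\<^sup>2)) * complex_of_real ((norm x)\<^sup>2) + complex_of_real (- a\<^sup>2 / (b\<^sup>2 - a\<^sup>2))) \<in> C_space r"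
    by (intro C_space_add C_space_mult C_space_const C_space_norm_square)
  then have "(\<lambda>x::real^'n. complex_of_real (ramp a b x)) \<in> C_space r"
    by (simp add: diff_divide_distrib)
  then have "(\<lambda>x::real^'n. complex_of_real (max 0 (ramp a b x) ^ Suc r)) \<in> C_space r"
    by (rule C_space_pos_part_power) simp
  then have "(\<lambda>x::real^'n. 1 + (- 1) * complex_of_real (max 0 (ramp a b x) ^ Suc r)) \<in> C_space r"
    by (intro C_space_add C_space_mult C_space_const)
  then have "(\<lambda>x::real^'n. complex_of_real (1 - max 0 (ramp a b x) ^ Suc r)) \<in> C_space r"
    by simp
  then show ?thesis unfolding cutoff_def by (rule C_space_pos_part_power) simp
qed

context
  fixes a b :: real
  assumes ab: "0 < a" "a < b"
begin

lemma square_gap: "0 < b\<^sup>2 - a\<^sup>2"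
  using ab by (simp add: power_strict_mono)

lemma cutoff_nonneg: "0 \<le> cutoff r a b x"
  by (simp add: cutoff_def)

lemma cutoff_le_1: "cutoff r a b x \<le> 1"
  unfolding cutoff_def by (intro power_le_one) auto

lemma cutoff_eq_1: "norm x \<le> a \<Longrightarrow> cutoff r a b x = 1"
  using square_gap power_mono[of "norm x" a 2]
  by (simp add: cutoff_def max_def divide_nonpos_pos)
     (simp add: field_simps)

lemma cutoff_eq_0:
  assumes "norm x \<ge> b" shows "cutoff r a b x = 0"
proof -
  have "1 \<le> ramp a b x"
    using square_gap power_mono[OF assms, of 2] ab by simp
  then have "1 \<le> max 0 (ramp a b x) ^ Suc r"
    by (intro one_le_power) simp
  then have "max 0 (1 - max 0 (ramp a b x) ^ Suc r) = 0"
    by linarith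
  then show ?thesis unfolding cutoff_def by (simp only: power_0_Suc)
qed

text \<open>With the norm clamped at b, the ramp takes values in [0, 1] after truncation. There the
  power r + 1 is Lipschitz with constant r + 1; it is applied twice, hence the square. The factor 2b
  comes from the difference of the squared norms.\<close>

lemma cutoff_lipschitz:
  fixes x y :: "real^'n"
  shows "\<bar>cutoff r a b x - cutoff r a b y\<bar> \<le> (real (Suc r))\<^sup>2 * (2 * b / (b\<^sup>2 - a\<^sup>2)) * norm (x - y)"
proof -
  \<comment> \<open>Clamping leaves the cutoff unchanged: beyond radius b it is already 0.\<close>
  define m where "m x = min (norm x) b" for x :: "real^'n"
  define s where "s x = max 0 (((m x)\<^sup>2 - a\<^sup>2) / (b\<^sup>2 - a\<^sup>2))" for x :: "real^'n"
  have m: "0 \<le> m x" "m x \<le> b" for x using ab by (auto simp: m_def)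
  have s: "0 \<le> s x" "s x \<le> 1" for x
    using square_gap power_mono[OF m(2) m(1), of x 2] by (auto simp: s_def)
  have pw: "\<bar>p ^ Suc r - q ^ Suc r\<bar> \<le> real (Suc r) * \<bar>p - q\<bar>" if "0 \<le> p" "p \<le> 1" "0 \<le> q" "q \<le> 1" for p q :: real
    using norm_power_diff[of p q "Suc r"] that by (simp add: real_norm_def del: power_Suc of_nat_Suc)
  have eq: "cutoff r a b x = (1 - s x ^ Suc r) ^ Suc r" for x
  proof (cases "norm x \<le> b")
    case True
    then have "cutoff r a b x = max 0 (1 - s x ^ Suc r) ^ Suc r" by (simp add: cutoff_def s_def m_def)
    moreover have "s x ^ Suc r \<le> 1" using s by (intro power_le_one)
    ultimately show ?thesis by (simp add: max_def)
  next
    case False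
    then have "s x = 1" using square_gap by (simp add: s_def m_def)
    then show ?thesis using cutoff_eq_0[of x] False by simp
  qed
  have sp: "0 \<le> 1 - s x ^ Suc r" "1 - s x ^ Suc r \<le> 1" for x
    using s by (auto simp del: power_Suc intro!: power_le_one zero_le_power)
  have "\<bar>cutoff r a b x - cutoff r a b y\<bar> \<le> real (Suc r) * \<bar>(1 - s x ^ Suc r) - (1 - s y ^ Suc r)\<bar>"
    unfolding eq by (rule pw[OF sp sp])
  also have "\<dots> = real (Suc r) * \<bar>s y ^ Suc r - s x ^ Suc r\<bar>" by simp
  also have "\<dots> \<le> real (Suc r) * (real (Suc r) * \<bar>s y - s x\<bar>)"
    by (intro mult_left_mono pw s) auto
  also have "\<bar>s y - s x\<bar> \<le> \<bar>((m y)\<^sup>2 - a\<^sup>2) / (b\<^sup>2 - a\<^sup>2) - ((m x)\<^sup>2 - a\<^sup>2) / (b\<^sup>2 - a\<^sup>2)\<bar>"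
    unfolding s_def by linarith
  also have "\<dots> = \<bar>m y - m x\<bar> * (m y + m x) / (b\<^sup>2 - a\<^sup>2)"
  proof -
    have "((m y)\<^sup>2 - a\<^sup>2) / (b\<^sup>2 - a\<^sup>2) - ((m x)\<^sup>2 - a\<^sup>2) / (b\<^sup>2 - a\<^sup>2) = (m y - m x) * (m y + m x) / (b\<^sup>2 - a\<^sup>2)"
      by (simp add: power2_eq_square algebra_simps flip: diff_divide_distrib)
    then show ?thesis using square_gap m(1)[of x] m(1)[of y] by (simp add: abs_mult)
  qed
  also have "\<dots> \<le> norm (x - y) * (2 * b) / (b\<^sup>2 - a\<^sup>2)"
  proof (intro divide_right_mono mult_mono)
    show "\<bar>m y - m x\<bar> \<le> norm (x - y)"
      using norm_triangle_ineq3[of x y] unfolding m_def by linarith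
    show "m y + m x \<le> 2 * b" using m(2)[of x] m(2)[of y] by simp
  qed (use m square_gap in \<open>auto simp: add_nonneg_nonneg\<close>)
  finally show ?thesis
    by (simp add: power2_eq_square mult_ac mult_left_mono del: of_nat_Suc)
qed

end

subsection \<open>Densities\<close>

lemma continuous_on_cutoff: "continuous_on UNIV (cutoff r a b :: real^'n \<Rightarrow> real)"
  using continuous_on_Re[OF C_space_continuous[OF cutoff_C_space[of r a b, where 'n='n]]] by simp

lemma cutoff_measurable [measurable]: "(cutoff r a b :: real^'n \<Rightarrow> real) \<in> borel_measurable borel"
  by (rule borel_measurable_continuous_onI[OF continuous_on_cutoff])

lemma cutoff_le_indicator:
  assumes "0 < a" "a < b" shows "cutoff r a b x \<le> indicator (ball 0 b) x"
  using cutoff_eq_0[OF assms, of x r] cutoff_le_1[OF assms, of r x] by (auto simp: indicator_def not_less)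

text \<open>The cutoff lies between the indicators of the balls of radius a and b, whose moments are
  the explicit radial integrals.\<close>

lemma cutoff_moment:
  fixes \<alpha> :: real and r :: nat
  defines "J \<equiv> \<lambda>a b. LINT x|lborel. norm (x::real^'n) powr (\<alpha> - CARD('n)) * cutoff r a b x"
  assumes \<alpha>: "\<alpha> > 0" and ab: "0 < a" "a < b"
  shows "unit_sphere_area CARD('n) * (a powr \<alpha> / \<alpha>) \<le> J a b" (is ?lower)
    and "J a b \<le> unit_sphere_area CARD('n) * (b powr \<alpha> / \<alpha>)" (is ?upper)
proof -
  let ?w = "\<lambda>x::real^'n. norm x powr (\<alpha> - CARD('n))"
  have ball: "has_bochner_integral lborel (\<lambda>x. indicator (cball 0 c) x * ?w x)
     (unit_sphere_area CARD('n) * (c powr \<alpha> / \<alpha>))" if "c \<ge> 0" for c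
    using has_bochner_integral_norm_powr[OF \<alpha> that, where 'a="real^'n"] by (simp add: unit_sphere_area_eq)
  have b: "integrable lborel (\<lambda>x. indicator (cball 0 b) x * ?w x)"
    using ball[of b] ab by (auto dest: has_bochner_integral_iff[THEN iffD1])
  have le: "?w x * cutoff r a b x \<le> indicator (cball 0 b) x * ?w x" for x :: "real^'n"
    using cutoff_le_1[OF ab, of r x] cutoff_eq_0[OF ab, of x r]
    by (cases "norm x \<le> b") (auto intro!: mult_left_le)
  have ge: "indicator (cball 0 a) x * ?w x \<le> ?w x * cutoff r a b x" for x :: "real^'n"
    using cutoff_eq_1[OF ab, of x r] cutoff_nonneg[OF ab, of r x]
    by (cases "norm x \<le> a") auto
  have int: "integrable lborel (\<lambda>x. ?w x * cutoff r a b x)"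
    by (rule Bochner_Integration.integrable_bound[OF b])
       (use le in \<open>auto simp: cutoff_nonneg[OF ab] abs_mult\<close>)
  show ?lower ?upper
    unfolding J_def
    using integral_mono[OF _ int ge] integral_mono[OF int b le] ball[of a] ball[of b] ab
    by (auto simp: has_bochner_integral_iff)
qed

abbreviation (input) has_density :: "(real^'n) measure \<Rightarrow> real \<Rightarrow> real^'n \<Rightarrow> complex \<Rightarrow> bool" where
  "has_density \<mu> \<alpha> x0 \<l> \<equiv> alpha_density_point \<mu> \<alpha> x0 \<and>
     complex_of_real (alpha_density \<mu> \<alpha> x0) =
       complex_of_real (unit_sphere_area CARD('n)) * \<l> / complex_of_real (\<alpha> * unit_ball_vol \<alpha>)"

text \<open>The ball of radius \<epsilon> is squeezed between a cutoff falling from 1 to 0 on (a, 1)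
  and one on (1, b). The limits of both are \<open>Re \<l>\<close> times moments that tend to the
  moment of the unit ball as a and b approach 1.\<close>

lemma cutoff_limits_imp_density:
  fixes \<mu> :: "(real^'n) measure" and \<l> :: complex and r :: nat
  assumes \<alpha>: "\<alpha> > 0" and radon: "radon_measure \<mu>"
    and lim: "\<And>a b. 0 < a \<Longrightarrow> a < b \<Longrightarrow>
      ((\<lambda>\<epsilon>. complex_of_real (\<epsilon> powr - \<alpha>) * (LINT y|\<mu>. complex_of_real (cutoff r a b ((1 / \<epsilon>) *\<^sub>R (y - x0)))))
        \<longlongrightarrow> pairing (\<lambda>x::real^'n. \<l> * complex_of_real (norm x powr (\<alpha> - real CARD('n)))) (\<lambda>x. complex_of_real (cutoff r a b x))) (at_right 0)"
  shows "has_density \<mu> \<alpha> x0 \<l>"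
proof -
  have sets_mu [measurable_cong]: "sets \<mu> = sets borel" and fin: "\<And>K. compact K \<Longrightarrow> emeasure \<mu> K < \<infinity>"
    using radon by (auto simp: radon_measure_def)
  define J where "J a b = (LINT x|lborel. norm (x::real^'n) powr (\<alpha> - CARD('n)) * cutoff r a b x)" for a b
  define I where "I c = unit_sphere_area CARD('n) * (c powr \<alpha> / \<alpha>)" for c
  define Q where "Q a b \<epsilon> = \<epsilon> powr - \<alpha> * (LINT y|\<mu>. cutoff r a b ((1 / \<epsilon>) *\<^sub>R (y - x0)))" for a b \<epsilon>
  define \<theta> where "\<theta> \<epsilon> = \<epsilon> powr - \<alpha> * measure \<mu> (ball x0 \<epsilon>)" for \<epsilon>
  have area: "unit_sphere_area CARD('n) > 0"
    by (simp add: unit_sphere_area_eq unit_ball_vol_pos)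
  have J: "I a \<le> J a b" "J a b \<le> I b" if "0 < a" "a < b" for a b
    using cutoff_moment[OF \<alpha> that, where 'n='n and r=r] by (simp_all add: J_def I_def)
  have lim_Q: "((\<lambda>\<epsilon>. complex_of_real (Q a b \<epsilon>)) \<longlongrightarrow> \<l> * complex_of_real (J a b)) (at_right 0)"
    if "0 < a" "a < b" for a b
  proof -
    have "pairing (\<lambda>x::real^'n. \<l> * complex_of_real (norm x powr (\<alpha> - real CARD('n)))) (\<lambda>x. complex_of_real (cutoff r a b x))
      = (LINT x|lborel. \<l> * complex_of_real (norm (x::real^'n) powr (\<alpha> - CARD('n)) * cutoff r a b x))"
      unfolding pairing_def by (simp add: mult.assoc)
    also have "\<dots> = \<l> * complex_of_real (J a b)"
      unfolding J_def by (simp only: integral_mult_right_zero integral_complex_of_real)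
    finally show ?thesis using lim[OF that] unfolding Q_def of_real_mult integral_complex_of_real by (simp only:)
  qed
  have lim_Re: "(Q a b \<longlongrightarrow> Re \<l> * J a b) (at_right 0)" if "0 < a" "a < b" for a b
    using tendsto_Re[OF lim_Q[OF that]] by simp
  have J_pos: "0 < J a b" if "0 < a" "a < b" for a b
  proof -
    have "0 < I a" using that area \<alpha> by (simp add: I_def)
    then show ?thesis using J(1)[OF that] by linarith
  qed
  \<comment> \<open>The quotients are real and the moment is positive, so the limit forces
    \<open>\<l>\<close> to be real.\<close>
  have "((\<lambda>\<epsilon>. 0) \<longlongrightarrow> Im \<l> * J 1 2) (at_right (0::real))"
    using tendsto_Im[OF lim_Q[of 1 2]] by simp
  then have "Im \<l> * J 1 2 = 0"
    using tendsto_unique[OF trivial_limit_at_right_real _ tendsto_const] by metis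
  then have Im: "Im \<l> = 0" using J_pos[of 1 2] by simp
  have Q_nonneg: "0 \<le> Q a b \<epsilon>" if "0 < a" "a < b" for a b \<epsilon>
    unfolding Q_def by (intro mult_nonneg_nonneg integral_nonneg_AE) (auto simp: cutoff_nonneg[OF that])
  \<comment> \<open>A nonnegative measure tested with a nonnegative cutoff. The sign is used below
    to multiply the bounds on J by \<open>Re \<l>\<close>.\<close>
  have "0 \<le> Re \<l> * J 1 2"
    by (rule tendsto_lowerbound[OF lim_Re]) (auto intro!: always_eventually Q_nonneg)
  then have Re: "0 \<le> Re \<l>" using J_pos[of 1 2] by (simp add: zero_le_mult_iff)
  have ball_int: "integrable \<mu> (indicator (ball x0 \<epsilon>) :: _ \<Rightarrow> real)" for \<epsilon>
    using fin[of "cball x0 \<epsilon>"] emeasure_mono[of "ball x0 \<epsilon>" "cball x0 \<epsilon>" \<mu>] sets_mu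
    by (intro integrable_real_indicator) (auto intro: le_less_trans)
  have measure_ball: "(LINT y|\<mu>. indicator (ball x0 \<epsilon>) y) = measure \<mu> (ball x0 \<epsilon>)" for \<epsilon>
    using sets_eq_imp_space_eq[OF sets_mu] by simp
  have mem: "(1 / \<epsilon>) *\<^sub>R (y - x0) \<in> ball 0 b \<longleftrightarrow> y \<in> ball x0 (b * \<epsilon>)" if "\<epsilon> > 0" for y \<epsilon> b
  proof -
    have "norm ((1 / \<epsilon>) *\<^sub>R (y - x0)) = norm (x0 - y) / \<epsilon>"
      using that by (simp only: norm_scaleR norm_minus_commute) simp
    then show ?thesis
      using that by (simp only: mem_ball dist_norm diff_0 norm_minus_cancel pos_divide_less_eq)
  qed
  have cut_int: "integrable \<mu> (\<lambda>y. cutoff r a b ((1 / \<epsilon>) *\<^sub>R (y - x0)))" if "\<epsilon> > 0" "0 < a" "a < b" for a b \<epsilon>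
  proof (rule Bochner_Integration.integrable_bound[OF ball_int[of "b * \<epsilon>"]])
    show "AE y in \<mu>. norm (cutoff r a b ((1 / \<epsilon>) *\<^sub>R (y - x0))) \<le> norm (indicator (ball x0 (b * \<epsilon>)) y :: real)"
    proof (rule AE_I2)
      fix y
      show "norm (cutoff r a b ((1 / \<epsilon>) *\<^sub>R (y - x0))) \<le> norm (indicator (ball x0 (b * \<epsilon>)) y :: real)"
        using cutoff_le_indicator[OF that(2,3), of r "(1 / \<epsilon>) *\<^sub>R (y - x0)"] cutoff_nonneg[OF that(2,3), of r "(1 / \<epsilon>) *\<^sub>R (y - x0)"]
        unfolding indicator_def mem[OF that(1)] by simp
    qed
  qed measurable
  have lower: "Q a 1 \<epsilon> \<le> \<theta> \<epsilon>" if "\<epsilon> > 0" "0 < a" "a < 1" for a \<epsilon>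
  proof -
    have "cutoff r a 1 ((1 / \<epsilon>) *\<^sub>R (y - x0)) \<le> indicator (ball x0 \<epsilon>) y" for y
      using cutoff_le_indicator[OF that(2,3), of r "(1 / \<epsilon>) *\<^sub>R (y - x0)"] mem[OF that(1), of y 1]
      unfolding indicator_def by simp
    then have "(LINT y|\<mu>. cutoff r a 1 ((1 / \<epsilon>) *\<^sub>R (y - x0))) \<le> (LINT y|\<mu>. indicator (ball x0 \<epsilon>) y)"
      by (intro integral_mono cut_int ball_int that)
    then show ?thesis unfolding Q_def \<theta>_def measure_ball by (intro mult_left_mono) auto
  qed
  have upper: "\<theta> \<epsilon> \<le> Q 1 b \<epsilon>" if "\<epsilon> > 0" "1 < b" for b \<epsilon>
  proof -
    have "indicator (ball x0 \<epsilon>) y \<le> cutoff r 1 b ((1 / \<epsilon>) *\<^sub>R (y - x0))" for y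
    proof (cases "y \<in> ball x0 \<epsilon>")
      case True
      then have "(1 / \<epsilon>) *\<^sub>R (y - x0) \<in> ball 0 1" using mem[OF that(1), of y 1] by simp
      then show ?thesis using cutoff_eq_1[of 1 b "(1 / \<epsilon>) *\<^sub>R (y - x0)" r] that by simp
    qed (use that in \<open>simp add: cutoff_nonneg\<close>)
    then have "(LINT y|\<mu>. indicator (ball x0 \<epsilon>) y) \<le> (LINT y|\<mu>. cutoff r 1 b ((1 / \<epsilon>) *\<^sub>R (y - x0)))"
      using that by (intro integral_mono cut_int ball_int) auto
    then show ?thesis unfolding Q_def \<theta>_def measure_ball by (intro mult_left_mono) auto
  qed
  have pos: "\<forall>\<^sub>F \<epsilon> in at_right (0::real). \<epsilon> > 0" by (simp add: eventually_at_right_less)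
  \<comment> \<open>Continuity in the radius provides, for any u on one side of the limit, a cutoff
    radius near 1 whose bound is still on that side of u.\<close>
  have cont: "((\<lambda>c. Re \<l> * I c) \<longlongrightarrow> Re \<l> * I 1) (at 1)"
    unfolding I_def using \<alpha> by (intro tendsto_intros) auto
  have "(\<theta> \<longlongrightarrow> Re \<l> * I 1) (at_right 0)"
  proof (rule order_tendstoI)
    fix u assume u: "u < Re \<l> * I 1"
    have "\<forall>\<^sub>F c in at_left 1. u < Re \<l> * I c"
      using order_tendstoD(1)[OF cont u] by (simp add: eventually_at_split)
    moreover have "\<forall>\<^sub>F c in at_left (1::real). 0 < c \<and> c < 1"
      by (rule eventually_at_leftI[of 0]) auto
    ultimately have "\<forall>\<^sub>F c in at_left 1. u < Re \<l> * I c \<and> 0 < c \<and> c < 1"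
      by (rule eventually_conj)
    from eventually_happens'[OF trivial_limit_at_left_real this]
    obtain a where a: "u < Re \<l> * I a" "0 < a" "a < 1" by blast
    have "u < Re \<l> * J a 1"
      using a(1) mult_left_mono[OF J(1)[OF a(2,3)] Re] by linarith
    from order_tendstoD(1)[OF lim_Re[OF a(2,3)] this] pos
    show "\<forall>\<^sub>F \<epsilon> in at_right 0. u < \<theta> \<epsilon>"
      by eventually_elim (use lower a in \<open>force intro: less_le_trans\<close>)
  next
    fix u assume u: "Re \<l> * I 1 < u"
    have "\<forall>\<^sub>F c in at_right 1. Re \<l> * I c < u"
      using order_tendstoD(2)[OF cont u] by (simp add: eventually_at_split)
    moreover have "\<forall>\<^sub>F c in at_right (1::real). 1 < c"
      by (simp add: eventually_at_right_less)
    ultimately have "\<forall>\<^sub>F c in at_right 1. Re \<l> * I c < u \<and> 1 < c"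
      by (rule eventually_conj)
    from eventually_happens'[OF trivial_limit_at_right_real this]
    obtain b where b: "Re \<l> * I b < u" "1 < b" by blast
    have J_less: "Re \<l> * J 1 b < u"
      using b mult_left_mono[OF J(2)[of 1 b] Re] by linarith
    have "\<forall>\<^sub>F \<epsilon> in at_right 0. Q 1 b \<epsilon> < u"
      using order_tendstoD(2)[OF lim_Re[of 1 b] J_less] b(2) by simp
    with pos show "\<forall>\<^sub>F \<epsilon> in at_right 0. \<theta> \<epsilon> < u"
      by eventually_elim (use upper b in \<open>force intro: le_less_trans\<close>)
  qed
  then have "((\<lambda>\<epsilon>. \<theta> \<epsilon> / unit_ball_vol \<alpha>) \<longlongrightarrow> Re \<l> * I 1 / unit_ball_vol \<alpha>) (at_right 0)"
    by (intro tendsto_divide tendsto_const) (use \<alpha> unit_ball_vol_pos[of \<alpha>] in linarith)+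
  moreover have "(\<lambda>\<epsilon>. \<theta> \<epsilon> / unit_ball_vol \<alpha>) = density_quotient \<mu> \<alpha> x0"
    by (auto simp: fun_eq_iff \<theta>_def density_quotient_def powr_minus field_simps)
  ultimately have dens: "(density_quotient \<mu> \<alpha> x0 \<longlongrightarrow> Re \<l> * I 1 / unit_ball_vol \<alpha>) (at_right 0)"
    by simp
  then have "alpha_density \<mu> \<alpha> x0 = Re \<l> * I 1 / unit_ball_vol \<alpha>"
    unfolding alpha_density_def by (intro tendsto_Lim) auto
  also have "\<dots> = unit_sphere_area CARD('n) * Re \<l> / (\<alpha> * unit_ball_vol \<alpha>)"
    by (simp add: I_def)
  finally have "complex_of_real (alpha_density \<mu> \<alpha> x0) =
     complex_of_real (unit_sphere_area CARD('n)) * complex_of_real (Re \<l>) / complex_of_real (\<alpha> * unit_ball_vol \<alpha>)"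
    by simp
  moreover have "complex_of_real (Re \<l>) = \<l>" using Im by (simp add: complex_eq_iff)
  ultimately show ?thesis using dens by (auto simp: alpha_density_point_def)
qed

context regular_scaling begin

text \<open>Compactly supported functions of class C^r lie in both test spaces, so either weak*
  hypothesis yields the limits assumed here.\<close>

lemma pairing_limits_imp_density:
  fixes \<mu> :: "(real^'n) measure" and \<l> :: complex and r :: nat
  assumes \<alpha>: "\<alpha> > 0" and radon: "radon_measure \<mu>"
    and E_int: "(\<integral>\<^sup>+y. ennreal (E (t0 * norm (y - x0))) \<partial>\<mu>) < \<infinity>" and t0: "t0 > 0"
    and lim: "\<And>\<psi> R. \<psi> \<in> C_space r \<Longrightarrow> (\<And>x. norm x > R \<Longrightarrow> \<psi> x = 0) \<Longrightarrow>
      ((\<lambda>\<epsilon>. pairing (blowup \<phi> \<mu> \<alpha> x0 \<epsilon>) \<psi>)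
        \<longlongrightarrow> pairing (\<lambda>x. \<l> * complex_of_real (norm x powr (\<alpha> - real CARD('n)))) \<psi>) (at_right 0)"
  shows "has_density \<mu> \<alpha> x0 \<l>"
proof (rule cutoff_limits_imp_density[OF \<alpha> radon, where r=r])
  fix a b :: real assume ab: "0 < a" "a < b"
  let ?\<psi> = "\<lambda>x::real^'n. complex_of_real (cutoff r a b x)"
  have supp: "?\<psi> x = 0" if "norm x > b" for x :: "real^'n"
    using cutoff_eq_0[OF ab, of x r] that by simp
  have 1: "((\<lambda>\<epsilon>. pairing (blowup \<phi> \<mu> \<alpha> x0 \<epsilon>) ?\<psi>)
        \<longlongrightarrow> pairing (\<lambda>x. \<l> * complex_of_real (norm x powr (\<alpha> - real CARD('n)))) ?\<psi>) (at_right 0)"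
    by (rule lim[OF cutoff_C_space supp])
  have 2: "((\<lambda>\<epsilon>. pairing (blowup \<phi> \<mu> \<alpha> x0 \<epsilon>) ?\<psi>
      - complex_of_real (\<epsilon> powr - \<alpha>) * (LINT y|\<mu>. ?\<psi> ((1 / \<epsilon>) *\<^sub>R (y - x0)))) \<longlongrightarrow> 0) (at_right 0)"
  proof (rule pairing_asymptotics[OF radon E_int t0, where B=1 and R=b])
    show "cmod (?\<psi> x) \<le> 1" for x
      using cutoff_nonneg[OF ab, of r x] cutoff_le_1[OF ab, of r x] by simp
    show "cmod (?\<psi> x - ?\<psi> y) \<le> (real (Suc r))\<^sup>2 * (2 * b / (b\<^sup>2 - a\<^sup>2)) * norm (x - y)" for x y
      using cutoff_lipschitz[OF ab, of r x y] by (simp only: of_real_diff[symmetric] norm_of_real)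
  qed (use ab supp in auto)
  from tendsto_diff[OF 1 2]
  show "((\<lambda>\<epsilon>. complex_of_real (\<epsilon> powr - \<alpha>) * (LINT y|\<mu>. ?\<psi> ((1 / \<epsilon>) *\<^sub>R (y - x0))))
        \<longlongrightarrow> pairing (\<lambda>x. \<l> * complex_of_real (norm x powr (\<alpha> - real CARD('n)))) ?\<psi>) (at_right 0)"
    by simp
qed

end

section \<open>From the two regularity classes to the weight \<open>E\<close>\<close>

lemma weight_function_growth:
  assumes M: "weight_function M"
  shows "\<exists>C. \<forall>t\<ge>0. exp (- M t) \<le> C / (1 + t) ^ N"
proof -
  have super: "\<And>t s. 0 \<le> t \<Longrightarrow> 0 \<le> s \<Longrightarrow> M t + M s \<le> M (t + s)"
    and mono: "\<And>s t. 0 \<le> s \<Longrightarrow> s \<le> t \<Longrightarrow> M s \<le> M t" and nonneg: "\<And>t. 0 \<le> t \<Longrightarrow> 0 \<le> M t"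
    using M unfolding weight_function_def mono_on_def by auto
  obtain t1 where t1: "0 \<le> t1" "M t1 \<noteq> 0" using M by (auto simp: weight_function_def)
  define m where "m = M t1"
  have m: "m > 0" using t1 nonneg[of t1] by (simp add: m_def)
  have "M 0 = 0" using super[of 0 0] nonneg[of 0] by simp
  then have t1_pos: "t1 > 0" using t1 by (cases "t1 = 0") auto
  \<comment> \<open>Superadditivity iterated along multiples of a point where M is positive; this is
    the source of linear growth.\<close>
  have mult: "real k * m \<le> M (real k * t1)" for k
  proof (induction k)
    case (Suc k)
    then show ?case using super[of "real k * t1" t1] t1_pos by (simp add: m_def algebra_simps)
  qed (use nonneg in auto)
  define c where "c = m / t1"
  have c: "c > 0" using m t1_pos by (simp add: c_def)
  \<comment> \<open>Rounding t / t1 down to the integer k loses at most m; the term c is the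
    difference between c (1 + t) and c t.\<close>
  have linear: "c * (1 + t) - (c + m) \<le> M t" if t: "t \<ge> 0" for t
  proof -
    define k where "k = nat \<lfloor>t / t1\<rfloor>"
    have k: "real k \<le> t / t1" "t / t1 < real k + 1"
      using t t1_pos by (auto simp: k_def)
    have "c * (1 + t) - (c + m) = (t / t1 - 1) * m"
      using t1_pos by (simp add: c_def field_simps)
    also have "\<dots> \<le> real k * m" using k m by (intro mult_right_mono) auto
    also have "\<dots> \<le> M (real k * t1)" by (rule mult)
    also have "\<dots> \<le> M t" using k t1_pos by (intro mono) (auto simp: field_simps)
    finally show ?thesis .
  qed
  have "exp (- M t) \<le> exp (c + m) * (real (Suc N) / c) ^ N / (1 + t) ^ N" if t: "t \<ge> 0" for t
  proof -
    \<comment> \<open>The exponential beats the power: s \<le> exp s raised to the power N. Dividing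
      by N + 1 rather than N keeps the definition meaningful at N = 0.\<close>
    let ?s = "c * (1 + t) / real (Suc N)"
    have s: "0 \<le> ?s" using c t by simp
    have "?s ^ N \<le> exp ?s ^ N"
      using exp_ge_add_one_self[of ?s] s by (intro power_mono) linarith+
    also have "\<dots> = exp (real N * ?s)" by (simp only: exp_of_nat_mult)
    also have "\<dots> \<le> exp (c * (1 + t))"
    proof -
      have "real N * ?s \<le> real (Suc N) * ?s" using s by (intro mult_right_mono) auto
      then show ?thesis by simp
    qed
    finally have "?s ^ N \<le> exp (c * (1 + t))" .
    moreover have "(1 + t) ^ N = ?s ^ N * (real (Suc N) / c) ^ N"
      using c by (simp del: of_nat_Suc flip: power_mult_distrib)
    ultimately have "(1 + t) ^ N \<le> exp (c * (1 + t)) * (real (Suc N) / c) ^ N"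
      using c by (simp add: mult_right_mono del: of_nat_Suc)
    also have "\<dots> \<le> (exp (c + m) * exp (M t)) * (real (Suc N) / c) ^ N"
      using linear[OF t] c by (intro mult_right_mono) (auto simp flip: exp_add)
    finally have "exp (- M t) * (1 + t) ^ N \<le> exp (- M t) * (exp (c + m) * exp (M t) * (real (Suc N) / c) ^ N)"
      by (rule mult_left_mono) simp
    also have "\<dots> = exp (c + m) * (real (Suc N) / c) ^ N"
      by (simp add: exp_minus del: of_nat_Suc)
    finally show ?thesis
      using t by (simp only: pos_le_divide_eq zero_less_power add_pos_nonneg zero_less_one)
  qed
  then show ?thesis by blast
qed

lemma nu_bound:
  assumes "nu M r l \<phi> < \<infinity>"
  shows "\<exists>B. \<forall>x. exp (M (norm (real l *\<^sub>R x))) * cmod (\<phi> x) \<le> B"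
proof -
  have "exp (M (norm (real l *\<^sub>R x))) * cmod (\<phi> x) \<le> enn2real (nu M r l \<phi>)" for x
  proof -
    have "ennreal (exp (M (norm (real l *\<^sub>R x))) * cmod (iter_partial_deriv [] \<phi> x)) \<le> nu M r l \<phi>"
      unfolding nu_def by (rule SUP_upper2[of "[]"], simp, rule SUP_upper) simp
    then show ?thesis
      using assms enn2real_mono by fastforce
  qed
  then show ?thesis by blast
qed

lemma rho_bound:
  assumes "rho r l \<phi> < \<infinity>"
  shows "\<exists>B. \<forall>x. (1 + norm x) ^ l * cmod (\<phi> x) \<le> B"
proof -
  have "(1 + norm x) ^ l * cmod (\<phi> x) \<le> enn2real (rho r l \<phi>)" for x
  proof -
    have "ennreal ((1 + norm x) ^ l * cmod (iter_partial_deriv [] \<phi> x)) \<le> rho r l \<phi>"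
      unfolding rho_def by (rule SUP_upper2[of "[]"], simp, rule SUP_upper) simp
    then show ?thesis using assms enn2real_mono by fastforce
  qed
  then show ?thesis by blast
qed

text \<open>By superadditivity the norm with l = 2 gives the factor exp (-M) twice: one copy is
  \<open>E\<close>, the other absorbs any power of 1 + |x|. The absolute value makes
  \<open>E\<close> continuous on the whole line, although M is controlled only on [0,
  \<infinity>).\<close>

lemma K_space_rapidly_decreasing:
  assumes M: "weight_function M" and \<phi>: "\<phi> \<in> K_space M r"
  shows "rapidly_decreasing \<phi> (\<lambda>t. exp (- M \<bar>t\<bar>))"
proof
  have super: "\<And>t s. 0 \<le> t \<Longrightarrow> 0 \<le> s \<Longrightarrow> M t + M s \<le> M (t + s)"
    and mono: "\<And>s t. 0 \<le> s \<Longrightarrow> s \<le> t \<Longrightarrow> M s \<le> M t" and nonneg: "\<And>t. 0 \<le> t \<Longrightarrow> 0 \<le> M t"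
    and cont: "continuous_on {0..} M"
    using M unfolding weight_function_def mono_on_def by auto
  show "continuous_on UNIV \<phi>" using \<phi> C_space_continuous by (auto simp: K_space_def)
  show "continuous_on UNIV (\<lambda>t. exp (- M \<bar>t\<bar>))"
    by (intro continuous_on_exp continuous_on_minus continuous_on_compose2[OF cont]) (auto intro!: continuous_intros)
  show "exp (- M \<bar>t\<bar>) \<le> 1" for t using nonneg[of "\<bar>t\<bar>"] by simp
  show "exp (- M \<bar>t\<bar>) \<le> exp (- M \<bar>s\<bar>)" if "0 \<le> s" "s \<le> t" for s t
    using mono[OF that] that by simp
  fix N
  obtain B where B: "\<And>x. exp (M (norm (real 2 *\<^sub>R x))) * cmod (\<phi> x) \<le> B"
    using nu_bound[of M r 2 \<phi>] \<phi> by (auto simp: K_space_def)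
  obtain C where C: "\<And>t. t \<ge> 0 \<Longrightarrow> exp (- M t) \<le> C / (1 + t) ^ N"
    using weight_function_growth[OF M] by blast
  have B0: "0 \<le> B" by (rule order_trans[OF _ B[of 0]]) simp
  have "cmod (\<phi> x) \<le> (B * C) * exp (- M \<bar>norm x\<bar>) / (1 + norm x) ^ N" for x
  proof -
    have "exp (M (norm x)) * exp (M (norm x)) \<le> exp (M (norm (real 2 *\<^sub>R x)))"
      using super[of "norm x" "norm x"] by (simp flip: exp_add)
    then have "exp (M (norm x)) * exp (M (norm x)) * cmod (\<phi> x) \<le> B"
      by (intro order_trans[OF mult_right_mono B]) auto
    then have "cmod (\<phi> x) \<le> B * exp (- M (norm x)) * exp (- M (norm x))"
      by (simp add: exp_minus field_simps)
    also have "\<dots> \<le> B * exp (- M (norm x)) * (C / (1 + norm x) ^ N)"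
      using B0 by (intro mult_left_mono C) auto
    finally show ?thesis by (simp add: mult_ac)
  qed
  then show "\<exists>C. \<forall>x. cmod (\<phi> x) \<le> C * exp (- M \<bar>norm x\<bar>) / (1 + norm x) ^ N" by blast
qed simp

text \<open>A dilation cannot change the order of a polynomial weight, so k has to enter
  \<open>E\<close> itself. The norm of order N plus k rounded up supplies both the power N and the
  weight.\<close>

lemma S_space_rapidly_decreasing:
  assumes \<phi>: "\<phi> \<in> S_space r" and k: "k \<ge> 0"
  shows "rapidly_decreasing \<phi> (\<lambda>t. (1 + \<bar>t\<bar>) powr (- k))"
proof
  show "continuous_on UNIV \<phi>" using \<phi> C_space_continuous by (auto simp: S_space_def)
  show "continuous_on UNIV (\<lambda>t::real. (1 + \<bar>t\<bar>) powr (- k))"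
    by (intro continuous_intros) (auto simp: add_nonneg_eq_0_iff)
  show "(1 + \<bar>t\<bar>) powr (- k) \<le> 1" for t :: real
  proof -
    have "1 + \<bar>t\<bar> \<noteq> 0" by linarith
    then show ?thesis using powr_mono[of "- k" 0 "1 + \<bar>t\<bar>"] k by simp
  qed
  show "(1 + \<bar>t\<bar>) powr (- k) \<le> (1 + \<bar>s\<bar>) powr (- k)" if "0 \<le> s" "s \<le> t" for s t :: real
    using that k by (intro powr_mono2') auto
  fix N
  define l where "l = N + nat \<lceil>k\<rceil>"
  obtain B where B: "\<And>x. (1 + norm x) ^ l * cmod (\<phi> x) \<le> B"
    using rho_bound[of r l \<phi>] \<phi> by (auto simp: S_space_def)
  have B0: "0 \<le> B" by (rule order_trans[OF _ B[of 0]]) simp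
  have "cmod (\<phi> x) \<le> B * (1 + \<bar>norm x\<bar>) powr (- k) / (1 + norm x) ^ N" for x
  proof -
    have p: "0 < 1 + norm x" by (simp add: add_pos_nonneg)
    have "(1 + norm x) powr k \<le> (1 + norm x) powr (real (nat \<lceil>k\<rceil>))"
      using k by (intro powr_mono) (auto simp: real_nat_ceiling_ge)
    also have "\<dots> = (1 + norm x) ^ nat \<lceil>k\<rceil>" using p by (rule powr_realpow)
    finally have "(1 + norm x) ^ N * (1 + norm x) powr k * cmod (\<phi> x) \<le> (1 + norm x) ^ l * cmod (\<phi> x)"
      unfolding l_def power_add using p by (intro mult_right_mono mult_left_mono) auto
    then have "(1 + norm x) ^ N * (1 + norm x) powr k * cmod (\<phi> x) \<le> B" using B order_trans by blast
    then show ?thesis using p by (simp add: powr_minus field_simps)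
  qed
  then show "\<exists>C. \<forall>x. cmod (\<phi> x) \<le> C * (1 + \<bar>norm x\<bar>) powr (- k) / (1 + norm x) ^ N" by blast
qed simp

theorem corollary5p7:
  fixes r :: nat and \<alpha> :: real and x0 :: "real^'n" and \<l> :: complex
    and M :: "real \<Rightarrow> real"
    and V :: "int \<Rightarrow> (real^'n \<Rightarrow> complex) set" and \<phi> :: "real^'n \<Rightarrow> complex"
    and \<mu> :: "(real^'n) measure"
  assumes "\<alpha> > 0"
    and "radon_measure \<mu>"
    and "(\<lambda>\<epsilon>. measure \<mu> (ball x0 \<epsilon>)) \<in> O[at_right 0](\<lambda>\<epsilon>. \<epsilon> powr \<alpha>)"
  shows
    "(weight_function M \<and> M_regular_MRA M r V \<phi> \<and>
      (\<exists>k\<ge>0. (\<integral>\<^sup>+ x. ennreal (exp (- M (norm (k *\<^sub>R x)))) \<partial>\<mu>) < \<infinity>) \<and>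
      weak_star_limit_0 (K_space M r) (nu M r)
        (\<lambda>\<epsilon> x. q_operator \<phi> (1 / \<epsilon>) \<mu> (x0 + \<epsilon> *\<^sub>R x) / complex_of_real (\<epsilon> powr (\<alpha> - real CARD('n))))
        (\<lambda>x. \<l> * complex_of_real (norm x powr (\<alpha> - real CARD('n))))
      \<longrightarrow> alpha_density_point \<mu> \<alpha> x0 \<and>
        complex_of_real (alpha_density \<mu> \<alpha> x0) =
          complex_of_real (unit_sphere_area CARD('n)) * \<l> / complex_of_real (\<alpha> * unit_ball_vol \<alpha>))
   \<and> (regular_MRA r V \<phi> \<and>
      (\<exists>k\<ge>0. (\<integral>\<^sup>+ x. ennreal ((1 + norm x) powr (- k)) \<partial>\<mu>) < \<infinity>) \<and>
      weak_star_limit_0 (S_space r) (rho r)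
        (\<lambda>\<epsilon> x. q_operator \<phi> (1 / \<epsilon>) \<mu> (x0 + \<epsilon> *\<^sub>R x) / complex_of_real (\<epsilon> powr (\<alpha> - real CARD('n))))
        (\<lambda>x. \<l> * complex_of_real (norm x powr (\<alpha> - real CARD('n))))
      \<longrightarrow> alpha_density_point \<mu> \<alpha> x0 \<and>
        complex_of_real (alpha_density \<mu> \<alpha> x0) =
          complex_of_real (unit_sphere_area CARD('n)) * \<l> / complex_of_real (\<alpha> * unit_ball_vol \<alpha>))"
proof (intro conjI[of "_ \<longrightarrow> _"] impI; elim conjE exE)
  have sets_mu [measurable_cong]: "sets \<mu> = sets borel" using assms(2) by (simp add: radon_measure_def)
  {
    fix k :: real
    assume M: "weight_function M" and MRA: "M_regular_MRA M r V \<phi>" and k: "0 \<le> k"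
      and int: "(\<integral>\<^sup>+ x. ennreal (exp (- M (norm (k *\<^sub>R x)))) \<partial>\<mu>) < \<infinity>"
      and lim: "weak_star_limit_0 (K_space M r) (nu M r)
        (\<lambda>\<epsilon> x. q_operator \<phi> (1 / \<epsilon>) \<mu> (x0 + \<epsilon> *\<^sub>R x) / complex_of_real (\<epsilon> powr (\<alpha> - real CARD('n))))
        (\<lambda>x. \<l> * complex_of_real (norm x powr (\<alpha> - real CARD('n))))"
    have mono: "\<And>s t. 0 \<le> s \<Longrightarrow> s \<le> t \<Longrightarrow> M s \<le> M t" and cont: "continuous_on {0..} M"
      and sub: "\<And>t s. 0 \<le> t \<Longrightarrow> 0 \<le> s \<Longrightarrow> M (t + s) \<le> M (2 * t) + M (2 * s)"
      using M unfolding weight_function_def mono_on_def by auto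
    interpret rapidly_decreasing \<phi> "\<lambda>t. exp (- M \<bar>t\<bar>)"
      using MRA M by (intro K_space_rapidly_decreasing) (auto simp: M_regular_MRA_def)
    interpret regular_scaling \<phi> "\<lambda>t. exp (- M \<bar>t\<bar>)" V
      using MRA by unfold_locales (auto simp: M_regular_MRA_def)
    \<comment> \<open>Recentring at \<open>x0\<close> uses M (t + s) \<le> M (2t) + M (2s), hence
      the factor 2k; the extra 1 keeps the dilation positive when k = 0.\<close>
    have "(\<integral>\<^sup>+y. ennreal (exp (- M \<bar>(2 * k + 1) * norm (y - x0)\<bar>)) \<partial>\<mu>) \<le>
       (\<integral>\<^sup>+y. ennreal (exp (M (2 * (k * norm x0)))) * ennreal (exp (- M (norm (k *\<^sub>R y)))) \<partial>\<mu>)"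
    proof (rule nn_integral_mono)
      fix y
      have "norm y \<le> norm (y - x0) + norm x0" using norm_triangle_ineq[of "y - x0" x0] by simp
      then have "k * norm y \<le> k * norm (y - x0) + k * norm x0"
        using k by (simp add: mult_left_mono flip: distrib_left)
      then have "M (k * norm y) \<le> M (k * norm (y - x0) + k * norm x0)"
        using k by (intro mono) auto
      also have "\<dots> \<le> M (2 * (k * norm (y - x0))) + M (2 * (k * norm x0))"
        using k by (intro sub) auto
      also have "M (2 * (k * norm (y - x0))) \<le> M ((2 * k + 1) * norm (y - x0))"
        using k by (intro mono) (auto simp: algebra_simps)
      finally have "- M ((2 * k + 1) * norm (y - x0)) \<le> M (2 * (k * norm x0)) + - M (k * norm y)"
        by simp
      then show "ennreal (exp (- M \<bar>(2 * k + 1) * norm (y - x0)\<bar>)) \<le>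
        ennreal (exp (M (2 * (k * norm x0)))) * ennreal (exp (- M (norm (k *\<^sub>R y))))"
        using k by (simp add: abs_mult ennreal_leI flip: ennreal_mult exp_add)
    qed
    also have "\<dots> = ennreal (exp (M (2 * (k * norm x0)))) * (\<integral>\<^sup>+y. ennreal (exp (- M (norm (k *\<^sub>R y)))) \<partial>\<mu>)"
    proof (rule nn_integral_cmult)
      have "continuous_on UNIV (\<lambda>y::real^'n. exp (- M (norm (k *\<^sub>R y))))"
        by (intro continuous_on_exp continuous_on_minus continuous_on_compose2[OF cont]) (auto intro!: continuous_intros)
      then show "(\<lambda>y. ennreal (exp (- M (norm (k *\<^sub>R y))))) \<in> borel_measurable \<mu>"
        using borel_measurable_continuous_onI sets_mu by (auto cong: measurable_cong_sets)
    qed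
    also have "\<dots> < \<infinity>" using int by (simp add: ennreal_mult_less_top)
    finally have fin: "(\<integral>\<^sup>+y. ennreal (exp (- M \<bar>(2 * k + 1) * norm (y - x0)\<bar>)) \<partial>\<mu>) < \<infinity>" .
    show "has_density \<mu> \<alpha> x0 \<l>"
    proof (rule pairing_limits_imp_density[OF assms(1,2) fin, where r=r])
      fix \<psi> :: "real^'n \<Rightarrow> complex" and R :: real
      assume "\<psi> \<in> C_space r" "\<And>x. norm x > R \<Longrightarrow> \<psi> x = 0"
      then have "\<psi> \<in> K_space M r" by (rule compact_support_in_K_space[OF M])
      then show "((\<lambda>\<epsilon>. pairing (blowup \<phi> \<mu> \<alpha> x0 \<epsilon>) \<psi>)
        \<longlongrightarrow> pairing (\<lambda>x. \<l> * complex_of_real (norm x powr (\<alpha> - real CARD('n)))) \<psi>) (at_right 0)"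
        using lim unfolding weak_star_limit_0_def by blast
    qed (use k in auto)
  next
    fix k :: real
    assume MRA: "regular_MRA r V \<phi>" and k: "0 \<le> k"
      and int: "(\<integral>\<^sup>+ x. ennreal ((1 + norm x) powr (- k)) \<partial>\<mu>) < \<infinity>"
      and lim: "weak_star_limit_0 (S_space r) (rho r)
        (\<lambda>\<epsilon> x. q_operator \<phi> (1 / \<epsilon>) \<mu> (x0 + \<epsilon> *\<^sub>R x) / complex_of_real (\<epsilon> powr (\<alpha> - real CARD('n))))
        (\<lambda>x. \<l> * complex_of_real (norm x powr (\<alpha> - real CARD('n))))"
    interpret rapidly_decreasing \<phi> "\<lambda>t. (1 + \<bar>t\<bar>) powr (- k)"
      using MRA k by (intro S_space_rapidly_decreasing) (auto simp: regular_MRA_def)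
    interpret regular_scaling \<phi> "\<lambda>t. (1 + \<bar>t\<bar>) powr (- k)" V
      using MRA by unfold_locales (auto simp: regular_MRA_def)
    \<comment> \<open>Recentring at \<open>x0\<close> is again Peetre's inequality and costs a
      constant only, so the dilation is 1.\<close>
    have "(\<integral>\<^sup>+y. ennreal ((1 + \<bar>1 * norm (y - x0)\<bar>) powr (- k)) \<partial>\<mu>) \<le>
       (\<integral>\<^sup>+y. ennreal ((1 + norm x0) powr k) * ennreal ((1 + norm y) powr (- k)) \<partial>\<mu>)"
    proof (rule nn_integral_mono)
      fix y
      have p: "0 < 1 + norm z" for z :: "real^'n" by (simp add: add_pos_nonneg)
      have "norm y \<le> norm (y - x0) + norm x0" using norm_triangle_ineq[of "y - x0" x0] by simp
      then have "1 + norm y \<le> (1 + norm x0) * (1 + norm (y - x0))"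
      proof -
        have "(1 + norm x0) * (1 + norm (y - x0)) = 1 + norm x0 + norm (y - x0) + norm x0 * norm (y - x0)"
          by (simp add: algebra_simps)
        moreover have "0 \<le> norm x0 * norm (y - x0)" by simp
        ultimately show ?thesis using \<open>norm y \<le> norm (y - x0) + norm x0\<close> by linarith
      qed
      then have "(1 + norm y) powr k \<le> (1 + norm x0) powr k * (1 + norm (y - x0)) powr k"
        using k by (subst powr_mult[symmetric]) (auto intro!: powr_mono2)
      then have "(1 + norm (y - x0)) powr (- k) \<le> (1 + norm x0) powr k * (1 + norm y) powr (- k)"
        using p[of y] p[of "y - x0"] by (simp add: powr_minus field_simps)
      then show "ennreal ((1 + \<bar>1 * norm (y - x0)\<bar>) powr (- k)) \<le>
        ennreal ((1 + norm x0) powr k) * ennreal ((1 + norm y) powr (- k))"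
        by (simp add: ennreal_leI flip: ennreal_mult)
    qed
    also have "\<dots> = ennreal ((1 + norm x0) powr k) * (\<integral>\<^sup>+y. ennreal ((1 + norm y) powr (- k)) \<partial>\<mu>)"
      by (rule nn_integral_cmult) measurable
    also have "\<dots> < \<infinity>" using int by (simp add: ennreal_mult_less_top)
    finally have fin: "(\<integral>\<^sup>+y. ennreal ((1 + \<bar>1 * norm (y - x0)\<bar>) powr (- k)) \<partial>\<mu>) < \<infinity>" .
    show "has_density \<mu> \<alpha> x0 \<l>"
    proof (rule pairing_limits_imp_density[OF assms(1,2) fin, where r=r])
      fix \<psi> :: "real^'n \<Rightarrow> complex" and R :: real
      assume "\<psi> \<in> C_space r" "\<And>x. norm x > R \<Longrightarrow> \<psi> x = 0"
      then have "\<psi> \<in> S_space r" by (rule compact_support_in_S_space)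
      then show "((\<lambda>\<epsilon>. pairing (blowup \<phi> \<mu> \<alpha> x0 \<epsilon>) \<psi>)
        \<longlongrightarrow> pairing (\<lambda>x. \<l> * complex_of_real (norm x powr (\<alpha> - real CARD('n)))) \<psi>) (at_right 0)"
        using lim unfolding weak_star_limit_0_def by blast
    qed auto
  }
qed

end
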